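(* Let $u_0\in H^2_{\mathrm{per}}([0,1])$ satisfy $u_0\ge0$ and $\int_0^1\frac1{u_0}\,dh=L$ (with $L<\infty$), and let $u:[0,\infty)\times[0,1]\to(0,\infty)$ be the global strong solution (i.e. its restriction to $[0,T]$ is the unique strong solution on $[0,T]$ for every $T>0$) of $$u_t=-u^2(u^3+u)_{hhhh}$$ with initial data $u(0,\cdot)=u_0$. Let $E_0=E(u(0,\cdot))$. Then there is a constant $\beta>0$, depending on $u_0$, such that $$E(u(t,\cdot))\le E_0e^{-\beta t}\quad\text{for all sufficiently large } t.$$ Moreover, with the constant $u^\star=1/L$, $$\|u(t,\cdot)-u^\star\|_{L^\infty([0,1])}\to0\quad\text{as } t\to\infty .$$
   Context: For a nonnegative integer $m$, $H^m_{\mathrm{per}}([0,1]) = \{u\in H^m_{\mathrm{loc}}(\mathbb{R}) : u(h+1)=u(h) \text{ for a.e. } h\in\mathbb{R}\}$, with the $H^m([0,1])$ norm; $L^2_{\mathrm{per}}([0,1])=H^0_{\mathrm{per}}([0,1])$. Subscripts $h$ and $t$ denote partial derivatives in $h$ and $t$. Definition (strong solution). For $T>0$, a strong solution on $[0,T]$ of $u_t=-u^2(u^3+u)_{hhhh}$ with initial data $u_0$ is a positive function $u$ with $u \in C([0,T];H^2_{\mathrm{per}}([0,1]))\cap L^2([0,T];H^4_{\mathrm{per}}([0,1]))$ and $u_t\in L^2([0,T];L^2_{\mathrm{per}}([0,1]))$, satisfying $u(0,\cdot)=u_0$ and $u_t=-u^2(u^3+u)_{hhhh}$ for a.e. $(t,h)\in[0,T]\times[0,1]$.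 Under the stated assumptions on $u_0$, such a solution exists and is unique for every $T>0$. Energy: $E(u)=\int_0^1\big((u^3+u)_{hh}\big)^2\,dh$. *)

theory Defs
  imports "HOL-Analysis.Analysis" "HOL-Probability.Essential_Supremum"
begin

text \<open>
  Elements of Sobolev spaces are represented by functions on the real line; equality of elements
  is equality almost everywhere.  Measurability is with respect to the complete Lebesgue
  sigma-algebra, so that all notions below respect almost-everywhere equality.
\<close>

definition test_function_on :: "real set \<Rightarrow> (real \<Rightarrow> real) \<Rightarrow> bool" where
  "test_function_on U \<phi> \<longleftrightarrow>
     (\<forall>k x. ((deriv ^^ k) \<phi>) field_differentiable (at x)) \<and>
     compact (closure {x. \<phi> x \<noteq> 0}) \<and> closure {x. \<phi> x \<noteq> 0} \<subseteq> U"

definition L1_loc :: "(real \<Rightarrow> real) set" where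
  "L1_loc = {f. \<forall>a b. set_integrable lebesgue {a..b} f}"

definition L2_loc :: "(real \<Rightarrow> real) set" where
  "L2_loc = {f \<in> borel_measurable lebesgue. \<forall>a b. set_integrable lebesgue {a..b} (\<lambda>x. (f x)\<^sup>2)}"

definition has_weak_deriv :: "nat \<Rightarrow> (real \<Rightarrow> real) \<Rightarrow> (real \<Rightarrow> real) \<Rightarrow> bool" where
  "has_weak_deriv k f g \<longleftrightarrow> f \<in> L1_loc \<and> g \<in> L1_loc \<and>
     (\<forall>\<phi>. test_function_on UNIV \<phi> \<longrightarrow>
        (LINT x|lebesgue. f x * (deriv ^^ k) \<phi> x) = (-1) ^ k * (LINT x|lebesgue. g x * \<phi> x))"

text \<open>The weak derivative is only determined almost everywhere; \<open>weak_deriv\<close> picks a representative,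
  and is only used under an integral over the space variable.\<close>

definition weak_deriv :: "nat \<Rightarrow> (real \<Rightarrow> real) \<Rightarrow> real \<Rightarrow> real" where
  "weak_deriv k f = (SOME g. has_weak_deriv k f g)"

definition H_loc :: "nat \<Rightarrow> (real \<Rightarrow> real) set" where
  "H_loc m = {f \<in> L2_loc. \<forall>k\<le>m. \<exists>g\<in>L2_loc. has_weak_deriv k f g}"

definition H_per :: "nat \<Rightarrow> (real \<Rightarrow> real) set" where
  "H_per m = {f \<in> H_loc m. AE h in lebesgue. f (h + 1) = f h}"

definition H_norm :: "nat \<Rightarrow> (real \<Rightarrow> real) \<Rightarrow> real" where
  "H_norm m f = sqrt (\<Sum>k\<le>m. LINT h:{0..1}|lebesgue. (weak_deriv k f h)\<^sup>2)"

definition C_H_per :: "real \<Rightarrow> nat \<Rightarrow> (real \<Rightarrow> real \<Rightarrow> real) set" where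
  "C_H_per T m = {u. (\<forall>t\<in>{0..T}. u t \<in> H_per m) \<and>
     (\<forall>t\<in>{0..T}. ((\<lambda>s. H_norm m (\<lambda>h. u s h - u t h)) \<longlongrightarrow> 0) (at t within {0..T}))}"

text \<open>The Bochner space of square integrable maps from \<open>[0,T]\<close> to \<open>H_per m\<close>.  Strong measurability
  is approximability, almost everywhere in time, by simple functions with values in \<open>H_per m\<close>;
  it makes the norm a Lebesgue measurable function of time.\<close>

definition L2_H_per :: "real \<Rightarrow> nat \<Rightarrow> (real \<Rightarrow> real \<Rightarrow> real) set" where
  "L2_H_per T m = {u.
     (AE t in lebesgue_on {0..T}. u t \<in> H_per m) \<and>
     (\<exists>s :: nat \<Rightarrow> real \<Rightarrow> real \<Rightarrow> real.
        (\<forall>n. simple_function (lebesgue_on {0..T}) (s n) \<and> (\<forall>t\<in>{0..T}. s n t \<in> H_per m)) \<and>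
        (AE t in lebesgue_on {0..T}. (\<lambda>n. H_norm m (\<lambda>h. s n t h - u t h)) \<longlonglongrightarrow> 0)) \<and>
     (\<integral>\<^sup>+ t. ennreal ((H_norm m (u t))\<^sup>2) \<partial>lebesgue_on {0..T}) < \<infinity>}"

definition jointly_measurable :: "real \<Rightarrow> (real \<Rightarrow> real \<Rightarrow> real) \<Rightarrow> bool" where
  "jointly_measurable T w \<longleftrightarrow>
     (\<lambda>(t, h). w t h) \<in> borel_measurable (lebesgue_on ({0..T} \<times> (UNIV :: real set)))"

text \<open>Weak time derivative of a Bochner integrable map: the identity between the Bochner integrals
  of \<open>\<phi>'(t) u(t)\<close> and \<open>- \<phi>(t) w(t)\<close> is an identity in \<open>L\<^sup>2\<close>, i.e. it is required almost
  everywhere in \<open>h\<close>.  For jointly measurable representatives the Bochner integral is computed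
  pointwise in \<open>h\<close>.\<close>

definition has_weak_time_deriv ::
  "real \<Rightarrow> (real \<Rightarrow> real \<Rightarrow> real) \<Rightarrow> (real \<Rightarrow> real \<Rightarrow> real) \<Rightarrow> bool" where
  "has_weak_time_deriv T u w \<longleftrightarrow>
     (\<forall>\<phi>. test_function_on {0<..<T} \<phi> \<longrightarrow>
        (AE h in lebesgue. (LINT t:{0..T}|lebesgue. deriv \<phi> t * u t h)
                         = - (LINT t:{0..T}|lebesgue. \<phi> t * w t h)))"

text \<open>
  Strong solutions of \<open>u\<^sub>t = - u\<^sup>2 (u\<^sup>3 + u)\<^sub>h\<^sub>h\<^sub>h\<^sub>h\<close> on \<open>[0,T]\<close>, extended periodically in \<open>h\<close>.
  As \<open>u t \<in> H_per 2\<close>, it is identified with its continuous representative, which is what makes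
  pointwise positivity meaningful; together with the continuity in time this makes \<open>u\<close> jointly
  continuous.  Below \<open>w\<close> stands for \<open>u\<^sub>t\<close> and \<open>z\<close> for \<open>(u\<^sup>3 + u)\<^sub>h\<^sub>h\<^sub>h\<^sub>h\<close>.
\<close>

definition strong_solution ::
  "real \<Rightarrow> (real \<Rightarrow> real) \<Rightarrow> (real \<Rightarrow> real \<Rightarrow> real) \<Rightarrow> bool" where
  "strong_solution T u0 u \<longleftrightarrow>
     (\<forall>t\<in>{0..T}. continuous_on UNIV (u t)) \<and>
     (\<forall>t\<in>{0..T}. \<forall>h. u t h > 0) \<and>
     u \<in> C_H_per T 2 \<and> u \<in> L2_H_per T 4 \<and>
     (AE h in lebesgue. u 0 h = u0 h) \<and>
     (\<exists>w z. w \<in> L2_H_per T 0 \<and> jointly_measurable T w \<and> has_weak_time_deriv T u w \<and>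
        (AE t in lebesgue_on {0..T}. has_weak_deriv 4 (\<lambda>h. (u t h) ^ 3 + u t h) (z t)) \<and>
        (AE (t, h) in lebesgue_on ({0..T} \<times> {0..1}). w t h = - (u t h)\<^sup>2 * z t h))"

definition global_strong_solution :: "(real \<Rightarrow> real) \<Rightarrow> (real \<Rightarrow> real \<Rightarrow> real) \<Rightarrow> bool" where
  "global_strong_solution u0 u \<longleftrightarrow> (\<forall>T>0. strong_solution T u0 u)"

definition energy :: "(real \<Rightarrow> real) \<Rightarrow> real" where
  "energy f = (LINT h:{0..1}|lebesgue. (weak_deriv 2 (\<lambda>x. (f x) ^ 3 + f x) h)\<^sup>2)"

end

theory Submission
  imports Defs "HOL-Computational_Algebra.Polynomial" "HOL-Probability.Probability_Measure"
begin

text \<open>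
  Write \<open>v = u\<^sup>3 + u\<close>, \<open>Z = v\<^sub>h\<^sub>h\<^sub>h\<^sub>h\<close> and \<open>E = \<integral>(v\<^sub>h\<^sub>h)\<^sup>2\<close>. Dividing the equation by \<open>u\<^sup>2\<close> shows that
  \<open>\<integral>1/u = L\<close> is conserved, and testing it with \<open>(3u\<^sup>2 + 1) Z\<close> gives \<open>E' = - 2 \<integral>(3u\<^sup>2 + 1) u\<^sup>2 Z\<^sup>2\<close>.
  Near a minimum point of \<open>u\<close> with value \<open>m\<close> the function \<open>v\<close> grows at most like \<open>E\<^bsup>1/2\<^esup> s\<^bsup>3/2\<^esup>\<close>, so
  \<open>\<integral>1/u = L\<close> forces \<open>u\<close> to stay above a positive constant that depends only on \<open>L\<close> and the initial
  energy. As \<open>E \<le> \<integral>Z\<^sup>2\<close> by integration by parts, \<open>E\<close> decays exponentially. Finally \<open>u\<close> takes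
  the value \<open>1/L\<close> somewhere, hence \<open>\<bar>u - 1/L\<bar> \<le> E\<^bsup>1/2\<^esup>\<close>.

  The energy identity is justified by replacing \<open>v\<^sub>h\<^sub>h\<close> by second difference quotients: at almost
  every \<open>h\<close> these are absolutely continuous in time, and the discrete dissipation equals the pairing
  of twice averaged copies of \<open>Z\<close> and \<open>v\<^sub>t\<close>, which converges as the step tends to zero.
\<close>

section \<open>Smooth functions and test functions\<close>

text \<open>The velocity u_t is only square integrable, so E cannot be differentiated directly: v_hh
  has no time derivative in L2. For a fixed step, a difference quotient is a finite combination of
  shifts, and time regularity at almost every h is enough for it. That regularity must itself be
  extracted: the weak time derivative is an identity at almost every h for each test function, with
  a null set depending on the test function, so only countably many test functions can be used.

  E is never shown to be differentiable. If m is a lower bound of u, then the dissipation bound, the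
  monotonicity of E and E <= int Z^2 give E(t) (1 + 2 m^2 (t - s)) <= E(s). Unit steps yield the
  factor 1 + 2 m^2 per unit of time, and half of its logarithm serves as beta. The constant one in E
  <= int Z^2 comes from E = int Z (v - v(0)) and (v - v(0))^2 <= E. Since E does not increase, m
  depends on L and E(0) only and not on T, unlike the crude bounds from compactness, which serve
  integrability alone.\<close>

definition smooth :: "(real \<Rightarrow> real) \<Rightarrow> bool" where
  "smooth f \<longleftrightarrow> (\<forall>k x. ((deriv ^^ k) f) field_differentiable (at x))"

text \<open>A family of differentiable functions that is closed under \<open>deriv\<close> contains
  all iterated derivatives of its members. No formula for the k-th derivative is ever
  needed.\<close>

lemma smooth_coinduct:
  assumes "f \<in> S" and step: "\<And>g x. g \<in> S \<Longrightarrow> g field_differentiable (at x)" "\<And>g. g \<in> S \<Longrightarrow> deriv g \<in> S"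
  shows "smooth f"
proof -
  have "(deriv ^^ k) f \<in> S" for k
    by (induction k) (use assms in auto)
  then show ?thesis
    unfolding smooth_def using step by blast
qed

lemma smooth_deriv: "smooth f \<Longrightarrow> smooth (deriv f)"
  unfolding smooth_def by (metis funpow_Suc_right comp_apply)

lemma smooth_imp_differentiable: "smooth f \<Longrightarrow> f field_differentiable (at x)"
  unfolding smooth_def by (metis funpow_0)

lemma smooth_has_deriv: "smooth f \<Longrightarrow> (f has_field_derivative deriv f x) (at x)"
  by (simp add: smooth_imp_differentiable field_differentiable_derivI)

lemma smooth_continuous_on: "smooth f \<Longrightarrow> continuous_on A f"
  by (meson smooth_has_deriv DERIV_isCont continuous_at_imp_continuous_on)

lemma smooth_antideriv:
  assumes "\<And>x. (F has_field_derivative f x) (at x)" "smooth f"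
  shows "smooth F"
proof (rule smooth_coinduct[where S="{F} \<union> {g. smooth g}"])
  have *: "deriv F = f"
    using assms(1) DERIV_imp_deriv by blast
  show "g field_differentiable at x" if "g \<in> {F} \<union> {g. smooth g}" for g x
    using that assms(1) smooth_imp_differentiable[of g] unfolding field_differentiable_def by auto
  show "deriv g \<in> {F} \<union> {g. smooth g}" if "g \<in> {F} \<union> {g. smooth g}" for g
    using that assms * by (auto simp: smooth_deriv)
qed auto

lemma smooth_affine:
  assumes "smooth f"
  shows "smooth (\<lambda>x. c * f (a * x + b))"
proof (rule smooth_coinduct[where S="{\<lambda>x. c * g (a * x + b) | c g. smooth g}"])
  have D: "((\<lambda>x. c * g (a * x + b)) has_field_derivative ((c * a) * deriv g (a * x + b))) (at x)"
    if "smooth g" for c g x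
    by (rule derivative_eq_intros DERIV_chain2[OF smooth_has_deriv[OF that]] refl | simp)+
  show "g field_differentiable at x" if "g \<in> {\<lambda>x. c * g (a * x + b) | c g. smooth g}" for g x
    using that D by (auto simp: field_differentiable_def)
  show "deriv g \<in> {\<lambda>x. c * g (a * x + b) | c g. smooth g}"
    if g: "g \<in> {\<lambda>x. c * g (a * x + b) | c g. smooth g}" for g
  proof -
    obtain c k where k: "g = (\<lambda>x. c * k (a * x + b))" "smooth k" using g by auto
    have "deriv g = (\<lambda>x. (c * a) * deriv k (a * x + b))"
      using DERIV_imp_deriv[OF D[OF k(2)]] k(1) by auto
    then show ?thesis using smooth_deriv[OF k(2)] by blast
  qed
qed (use assms in auto)

text \<open>Products of smooth functions are not visibly closed under \<open>deriv\<close>; finite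
  sums of products are, by the Leibniz rule. This is the closed family behind
  \<open>smooth_mult\<close> and \<open>smooth_add\<close>.\<close>

inductive_set smooth_alg :: "(real \<Rightarrow> real) set" where
  base: "smooth f \<Longrightarrow> smooth g \<Longrightarrow> (\<lambda>x. f x * g x) \<in> smooth_alg"
| add: "f \<in> smooth_alg \<Longrightarrow> g \<in> smooth_alg \<Longrightarrow> (\<lambda>x. f x + g x) \<in> smooth_alg"

lemma smooth_alg_deriv:
  "f \<in> smooth_alg \<Longrightarrow> (\<forall>x. f field_differentiable (at x)) \<and> deriv f \<in> smooth_alg"
proof (induction rule: smooth_alg.induct)
  case (base f g)
  have D: "((\<lambda>x. f x * g x) has_field_derivative (deriv f x * g x + f x * deriv g x)) (at x)" for x
    by (rule derivative_eq_intros smooth_has_deriv base refl | simp)+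
  have "deriv (\<lambda>x. f x * g x) = (\<lambda>x. deriv f x * g x + f x * deriv g x)"
    using DERIV_imp_deriv[OF D] by auto
  then show ?case
    using D base smooth_deriv smooth_alg.intros by (auto simp: field_differentiable_def)
next
  case (add f g)
  then have D: "((\<lambda>x. f x + g x) has_field_derivative (deriv f x + deriv g x)) (at x)" for x
    by (intro DERIV_add field_differentiable_derivI) auto
  have "deriv (\<lambda>x. f x + g x) = (\<lambda>x. deriv f x + deriv g x)"
    using DERIV_imp_deriv[OF D] by auto
  then show ?case
    using D add smooth_alg.intros by (auto simp: field_differentiable_def)
qed

lemma smooth_alg_smooth: "f \<in> smooth_alg \<Longrightarrow> smooth f"
  using smooth_alg_deriv smooth_coinduct by blast

lemma smooth_mult: "smooth f \<Longrightarrow> smooth g \<Longrightarrow> smooth (\<lambda>x. f x * g x)"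
  by (simp add: smooth_alg.base smooth_alg_smooth)

lemma smooth_const: "smooth (\<lambda>x. c)"
  by (rule smooth_coinduct[where S="range (\<lambda>c. \<lambda>x. c)"]) (auto simp: field_differentiable_const)

lemma smooth_add: "smooth f \<Longrightarrow> smooth g \<Longrightarrow> smooth (\<lambda>x. f x + g x)"
  using smooth_alg_smooth[OF smooth_alg.add[OF smooth_alg.base smooth_alg.base], of f "\<lambda>_. 1" g "\<lambda>_. 1"]
  by (simp add: smooth_const)

lemma smooth_diff_cmult: "smooth f \<Longrightarrow> smooth g \<Longrightarrow> smooth (\<lambda>x. f x - c * g x)"
  using smooth_add[of f "\<lambda>x. (-c) * g x"] smooth_mult[OF smooth_const, of g "-c"] by simp

section \<open>Functions that are flat at the origin, and a smooth step\<close>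

definition flat :: "real poly \<Rightarrow> real \<Rightarrow> real" where
  "flat p x = (if x > 0 then poly p (1/x) * exp (- (1/x)) else 0)"

lemma poly_exp_tendsto_0: "((\<lambda>y. poly p y * exp (- y)) \<longlongrightarrow> (0::real)) at_top"
proof -
  have "((\<lambda>y. \<Sum>i\<le>degree p. coeff p i * (y ^ i / exp y)) \<longlongrightarrow> (\<Sum>i\<le>degree p. coeff p i * 0)) at_top"
    by (intro tendsto_sum tendsto_mult tendsto_const tendsto_power_div_exp_0)
  then show ?thesis
    by (simp add: poly_altdef sum_distrib_right exp_minus divide_inverse mult.assoc)
qed

text \<open>With y = 1/x the chain rule turns p(y) exp(-y) into y^2 (p - p')(y) exp(-y), which is
  again of this form; \<open>[:0,0,1:]\<close> is the polynomial y^2. At the origin the exponential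
  beats every polynomial.\<close>

lemma flat_has_deriv:
  "(flat p has_field_derivative flat ([:0,0,1:] * (p - pderiv p)) x) (at x)"
proof -
  consider "x > 0" | "x < 0" | "x = 0" by linarith
  then show ?thesis
  proof cases
    case 1
    have "((\<lambda>x. poly p (1/x) * exp (- (1/x))) has_field_derivative
        flat ([:0,0,1:] * (p - pderiv p)) x) (at x)"
      using 1 by (auto intro!: derivative_eq_intros DERIV_chain2[OF poly_DERIV] simp: flat_def field_simps power2_eq_square)
    then show ?thesis
      by (rule DERIV_cong_ev[OF refl _ refl, THEN iffD1, rotated])
         (use 1 in \<open>auto simp: flat_def eventually_nhds intro!: exI[of _ "{0<..}"]\<close>)
  next
    case 2
    have "((\<lambda>x::real. 0) has_field_derivative flat ([:0,0,1:] * (p - pderiv p)) x) (at x)"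
      using 2 by (auto simp: flat_def)
    then show ?thesis
      by (rule DERIV_cong_ev[OF refl _ refl, THEN iffD1, rotated])
         (use 2 in \<open>auto simp: flat_def eventually_nhds intro!: exI[of _ "{..<0}"]\<close>)
  next
    case 3
    have "((\<lambda>h. (flat p h) / h) \<longlongrightarrow> 0) (at_left 0)"
      by (rule tendsto_eventually) (auto simp: flat_def eventually_at intro!: exI[of _ 1])
    moreover have "((\<lambda>h. (flat p h) / h) \<longlongrightarrow> 0) (at_right 0)"
    proof -
      \<comment> \<open>Dividing by h multiplies by y = 1/h, so the difference quotient belongs to
        the polynomial y p(y).\<close>
      have "((\<lambda>h. poly ([:0,1:] * p) (inverse h) * exp (- inverse h)) \<longlongrightarrow> 0) (at_right 0)"
        by (rule filterlim_compose[OF poly_exp_tendsto_0 filterlim_inverse_at_top_right])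
      then show ?thesis
        by (rule Lim_transform_eventually)
           (auto simp: flat_def eventually_at field_simps intro!: exI[of _ 1])
    qed
    ultimately have "((\<lambda>h. (flat p h) / h) \<longlongrightarrow> 0) (at 0)"
      by (simp add: filterlim_split_at)
    then show ?thesis
      using 3 by (simp add: DERIV_def flat_def)
  qed
qed

lemma smooth_flat: "smooth (flat p)"
proof (rule smooth_coinduct[where S="range flat"])
  show "g field_differentiable at x" if "g \<in> range flat" for g x
    using that flat_has_deriv by (auto simp: field_differentiable_def)
  show "deriv g \<in> range flat" if g: "g \<in> range flat" for g
  proof -
    obtain p where "g = flat p" using g by auto
    moreover have "deriv (flat p) = flat ([:0,0,1:] * (p - pderiv p))"
      using DERIV_imp_deriv[OF flat_has_deriv] by blast
    ultimately show ?thesis by blast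
  qed
qed auto

lemma continuous_antideriv:
  fixes f :: "real \<Rightarrow> real"
  assumes "continuous_on UNIV f"
  obtains F where "\<And>x. (F has_field_derivative f x) (at x)"
proof -
  have "\<exists>F. \<forall>x. (-\<infinity>::ereal) < ereal x \<longrightarrow> ereal x < \<infinity> \<longrightarrow> (F has_vector_derivative f x) (at x)"
    by (rule einterval_antiderivative) (use assms in \<open>auto simp: continuous_on_eq_continuous_at\<close>)
  then show ?thesis
    using that by (auto simp: has_real_derivative_iff_has_vector_derivative)
qed

text \<open>The step is the normalised primitive of a smooth bump that is positive exactly on the
  open unit interval.\<close>

lemma smooth_step_exists:
  "\<exists>S. smooth S \<and> (\<forall>x\<le>0. S x = 0) \<and> (\<forall>x\<ge>1. S x = 1) \<and> (\<forall>x. 0 \<le> S x \<and> S x \<le> (1::real))"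
proof -
  \<comment> \<open>The factors vanish for x <= 0 and for x >= 1 respectively; the redundant
    coefficients match the shape of \<open>smooth_affine\<close>.\<close>
  define b where "b x = flat 1 x * (1 * flat 1 ((-1) * x + 1))" for x
  have sb: "smooth b"
    unfolding b_def by (intro smooth_mult smooth_flat smooth_affine)
  obtain F where F: "\<And>x. (F has_field_derivative b x) (at x)"
    using continuous_antideriv[OF smooth_continuous_on[OF sb]] by blast
  have sF: "smooth F" by (rule smooth_antideriv[OF F sb])
  have b0: "b x \<ge> 0" for x by (auto simp: b_def flat_def)
  have bz: "b x = 0" if "x \<le> 0 \<or> x \<ge> 1" for x using that by (auto simp: b_def flat_def)
  have bp: "b x > 0" if "0 < x" "x < 1" for x using that by (auto simp: b_def flat_def)
  have mono: "F x \<le> F y" if "x \<le> y" for x y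
    using DERIV_nonneg_imp_nondecreasing[OF that] F b0 by blast
  have pos: "F 0 < F 1"
    by (rule DERIV_pos_imp_increasing_open[of 0 1 F])
       (use F bp smooth_continuous_on[OF sF] in auto)
  have c0: "F x = F 0" if "x \<le> 0" for x
  proof (rule antisym)
    show "F 0 \<le> F x"
    proof (rule DERIV_nonpos_imp_nonincreasing[OF that])
      show "\<exists>y. (F has_real_derivative y) (at z) \<and> y \<le> 0" if "x \<le> z" "z \<le> 0" for z
        using F[of z] bz[of z] that by auto
    qed
  qed (rule mono[OF that])
  have c1: "F x = F 1" if "x \<ge> 1" for x
  proof (rule antisym)
    show "F x \<le> F 1"
    proof (rule DERIV_nonpos_imp_nonincreasing[OF that])
      show "\<exists>y. (F has_real_derivative y) (at z) \<and> y \<le> 0" if "1 \<le> z" "z \<le> x" for z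
        using F[of z] bz[of z] that by auto
    qed
  qed (rule mono[OF that])
  define S where "S x = (1 / (F 1 - F 0)) * (F (1 * x + 0) - F 0 * 1)" for x
  have "smooth S"
    unfolding S_def
    by (intro smooth_mult smooth_const smooth_diff_cmult) (use sF in simp)
  moreover have "S x = 0" if "x \<le> 0" for x using c0[OF that] by (simp add: S_def)
  moreover have "S x = 1" if "x \<ge> 1" for x using c1[OF that] pos by (simp add: S_def)
  moreover have "0 \<le> S x" for x
    using mono[of 0 x] c0[of x] pos by (cases "x \<le> 0") (simp_all add: S_def)
  moreover have "S x \<le> 1" for x
    using mono[of x 1] c1[of x] pos by (cases "x \<ge> 1") (simp_all add: S_def divide_le_eq)
  ultimately show ?thesis by blast
qed

definition step :: "real \<Rightarrow> real" where
  "step = (SOME S. smooth S \<and> (\<forall>x\<le>0. S x = 0) \<and> (\<forall>x\<ge>1. S x = 1) \<and> (\<forall>x. 0 \<le> S x \<and> S x \<le> 1))"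

lemma step: "smooth step" "x \<le> 0 \<Longrightarrow> step x = 0" "x \<ge> 1 \<Longrightarrow> step x = 1" "0 \<le> step x" "step x \<le> 1"
  using someI_ex[OF smooth_step_exists, folded step_def] by auto

lemma test_functionI:
  assumes "smooth f" "\<And>x. x \<notin> {a..b} \<Longrightarrow> f x = 0" "{a..b} \<subseteq> U"
  shows "test_function_on U f"
proof -
  have "closure {x. f x \<noteq> 0} \<subseteq> {a..b}"
    by (rule closure_minimal) (use assms(2) in blast, simp)
  moreover from this have "compact (closure {x. f x \<noteq> 0})"
    by (metis bounded_subset closed_closure compact_eq_bounded_closed compact_Icc)
  ultimately show ?thesis
    using assms unfolding test_function_on_def smooth_def by blast
qed

lemma test_functionD:
  assumes "test_function_on U f"
  obtains a b where "smooth f" "a \<le> b" "\<And>x. x \<notin> {a..b} \<Longrightarrow> f x = 0"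
proof -
  have "bounded (closure {x. f x \<noteq> 0})"
    using assms compact_imp_bounded unfolding test_function_on_def by blast
  then obtain B where B: "\<And>x. x \<in> closure {x. f x \<noteq> 0} \<Longrightarrow> norm x \<le> B"
    unfolding bounded_iff by blast
  have "f x = 0" if "x \<notin> {-\<bar>B\<bar>..\<bar>B\<bar>}" for x
  proof (rule ccontr)
    assume "f x \<noteq> 0"
    then have "x \<in> closure {x. f x \<noteq> 0}" using closure_subset[of "{x. f x \<noteq> 0}"] by auto
    then show False using B[of x] that by (auto simp: abs_le_iff)
  qed
  moreover have "smooth f" using assms by (auto simp: smooth_def test_function_on_def)
  ultimately show ?thesis using that[of "-\<bar>B\<bar>" "\<bar>B\<bar>"] by auto
qed

lemma deriv_zero_outside:
  assumes "\<And>x. x \<notin> {a..b} \<Longrightarrow> f x = 0" "x \<notin> {a..b::real}"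
  shows "deriv f x = (0::real)"
proof -
  have "(f has_field_derivative 0) (at x)"
  proof (rule DERIV_cong_ev[OF refl _ refl, THEN iffD2])
    have "open (- {a..b})" by auto
    then show "\<forall>\<^sub>F x in nhds x. f x = (\<lambda>x. 0) x"
      using assms unfolding eventually_nhds by (intro exI[of _ "- {a..b}"]) auto
  qed auto
  then show ?thesis by (rule DERIV_imp_deriv)
qed

lemma test_function_deriv:
  assumes "test_function_on UNIV f" shows "test_function_on UNIV (deriv f)"
proof -
  obtain a b where *: "smooth f" "a \<le> b" "\<And>x. x \<notin> {a..b} \<Longrightarrow> f x = 0"
    using test_functionD[OF assms] by blast
  then show ?thesis
    by (intro test_functionI[of _ a b] smooth_deriv deriv_zero_outside[OF *(3)]) auto
qed

text \<open>Smooth approximation of the indicator of ]a,b], supported in [a, b + 1/(n+1)]. Its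
  derivative is the difference of two approximate identities at a and b, so testing with it turns
  weak identities into statements on increments and interval integrals.\<close>

definition plateau :: "real \<Rightarrow> real \<Rightarrow> nat \<Rightarrow> real \<Rightarrow> real" where
  "plateau a b n x = step (real (Suc n) * (x - a)) - step (real (Suc n) * (x - b))"

lemma smooth_plateau: "smooth (plateau a b n)"
proof -
  have *: "smooth (\<lambda>x. step (real (Suc n) * (x - c)))" for c
    using smooth_affine[OF step(1), of 1 "real (Suc n)" "- real (Suc n) * c"] by (simp add: algebra_simps)
  show ?thesis
    unfolding plateau_def using smooth_diff_cmult[OF *[of a] *[of b], of 1] by simp
qed

lemma plateau_outside:
  assumes "a \<le> b" "x \<notin> {a..b + 1 / real (Suc n)}" shows "plateau a b n x = 0"
proof -
  consider "x < a" | "x > b + 1 / real (Suc n)" using assms by fastforce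
  then show ?thesis
  proof cases
    case 1
    then have "real (Suc n) * (x - a) \<le> 0" "real (Suc n) * (x - b) \<le> 0"
      using assms by (auto intro!: mult_nonneg_nonpos)
    then show ?thesis by (simp add: plateau_def step)
  next
    case 2
    then have b: "real (Suc n) * (x - b) \<ge> 1" by (simp add: field_simps)
    moreover have "real (Suc n) * (x - b) \<le> real (Suc n) * (x - a)"
      using assms by (intro mult_left_mono) auto
    ultimately have "1 \<le> real (Suc n) * (x - a)" by (rule order_trans)
    with b show ?thesis unfolding plateau_def by (simp only: step(3))
  qed
qed

lemma plateau_bounds: "\<bar>plateau a b n x\<bar> \<le> 1"
  using step(4,5)[of "real (Suc n) * (x - a)"] step(4,5)[of "real (Suc n) * (x - b)"]
  by (auto simp: plateau_def abs_le_iff)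

lemma step_scaled_tendsto: "(\<lambda>n. step (real (Suc n) * (x - a))) \<longlonglongrightarrow> indicator {a<..} x"
proof (cases "x \<le> a")
  case True
  then have "step (real (Suc n) * (x - a)) = 0" for n
    by (intro step mult_nonneg_nonpos) auto
  then show ?thesis using True by simp
next
  case False
  then obtain N :: nat where N: "real N * (x - a) > 1"
    using ex_less_of_nat_mult[of "x - a" 1] by auto
  have "step (real (Suc n) * (x - a)) = 1" if "n \<ge> N" for n
  proof (rule step)
    have "1 \<le> real N * (x - a)" using N by simp
    also have "... \<le> real (Suc n) * (x - a)" using that False by (intro mult_right_mono) auto
    finally show "1 \<le> real (Suc n) * (x - a)" .
  qed
  then show ?thesis using False
    by (intro tendsto_eventually) (auto simp: eventually_sequentially)
qed

lemma plateau_tendsto: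
  assumes "a \<le> b"
  shows "(\<lambda>n. plateau a b n x) \<longlonglongrightarrow> indicator {a<..b} x"
proof -
  have "indicator {a<..b} x = indicator {a<..} x - (indicator {b<..} x :: real)"
    using assms by (auto simp: indicator_def)
  then show ?thesis
    unfolding plateau_def by (simp only:) (intro tendsto_diff step_scaled_tendsto)
qed

section \<open>Primitives of locally integrable functions\<close>

text \<open>Borel counterpart of \<open>L1_loc\<close>. Lebesgue measurable functions are exchanged
  for Borel representatives, which stay measurable under shifts, compositions and products of
  measures.\<close>

definition loc_int :: "(real \<Rightarrow> real) \<Rightarrow> bool" where
  "loc_int g \<longleftrightarrow> g \<in> borel_measurable borel \<and> (\<forall>a b. set_integrable lborel {a..b} g)"

lemma loc_intD: "loc_int g \<Longrightarrow> g \<in> borel_measurable borel" "loc_int g \<Longrightarrow> set_integrable lborel {a..b} g"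
  by (auto simp: loc_int_def)

lemma loc_int_HK:
  assumes "loc_int g"
  shows "g integrable_on {a..b}" "(LINT x:{a..b}|lborel. g x) = integral {a..b} g"
  using set_borel_integral_eq_integral loc_intD(2)[OF assms] by blast+

lemma loc_int_add: "loc_int f \<Longrightarrow> loc_int g \<Longrightarrow> loc_int (\<lambda>x. f x + g x)"
  by (auto simp: loc_int_def)

lemma loc_int_diff: "loc_int f \<Longrightarrow> loc_int g \<Longrightarrow> loc_int (\<lambda>x. f x - g x)"
  by (auto simp: loc_int_def)

lemma loc_int_cmult: "loc_int f \<Longrightarrow> loc_int (\<lambda>x. c * f x)"
  by (auto simp: loc_int_def)

lemma loc_int_abs: "loc_int f \<Longrightarrow> loc_int (\<lambda>x. \<bar>f x\<bar>)"
  by (auto simp: loc_int_def intro: set_integrable_abs)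

lemma loc_int_cont_mult:
  assumes c: "continuous_on UNIV c" and g: "loc_int g"
  shows "loc_int (\<lambda>x. c x * g x)"
proof -
  have [measurable]: "c \<in> borel_measurable borel" "g \<in> borel_measurable borel"
    using c g borel_measurable_continuous_onI loc_intD by blast+
  have "set_integrable lborel {a..b} (\<lambda>x. c x * g x)" for a b
  proof -
    have "compact (c ` {a..b})"
      using c by (meson compact_Icc compact_continuous_image continuous_on_subset top_greatest)
    then obtain B where B: "\<And>x. x \<in> {a..b} \<Longrightarrow> norm (c x) \<le> B"
      by (meson bounded_iff compact_imp_bounded imageI)
    have "set_integrable lborel {a..b} (\<lambda>x. B * g x)"
      using loc_intD(2)[OF g] by auto
    then show ?thesis
    proof (rule set_integrable_bound)
      show "AE x in lborel. x \<in> {a..b} \<longrightarrow> norm (c x * g x) \<le> norm (B * g x)"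
      proof (intro AE_I2 impI)
        fix x assume "x \<in> {a..b}"
        then have "\<bar>c x\<bar> \<le> \<bar>B\<bar>" using B by fastforce
        then show "norm (c x * g x) \<le> norm (B * g x)" by (simp add: abs_mult mult_right_mono)
      qed
    qed (simp add: set_borel_measurable_def)
  qed
  then show ?thesis by (auto simp: loc_int_def)
qed

lemma loc_int_cont: "continuous_on UNIV c \<Longrightarrow> loc_int c"
  unfolding loc_int_def
  by (meson borel_integrable_atLeastAtMost' borel_measurable_continuous_onI continuous_on_subset top_greatest)

text \<open>Absolute continuity with its density on display. The density is an arbitrary
  representative, so no pointwise differentiability of F has to be discussed.\<close>

definition ac :: "(real \<Rightarrow> real) \<Rightarrow> (real \<Rightarrow> real) \<Rightarrow> bool" where
  "ac F g \<longleftrightarrow> loc_int g \<and> (\<forall>a b. a \<le> b \<longrightarrow> F b - F a = integral {a..b} g)"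

lemma acD: "ac F g \<Longrightarrow> loc_int g" "ac F g \<Longrightarrow> a \<le> b \<Longrightarrow> F b - F a = integral {a..b} g"
  by (auto simp: ac_def)

lemma ac_LINT: "ac F g \<Longrightarrow> a \<le> b \<Longrightarrow> F b - F a = (LINT x:{a..b}|lborel. g x)"
  by (simp add: acD loc_int_HK(2))

lemma ac_continuous:
  assumes "ac F g" shows "continuous_on A F"
proof -
  have "isCont F x" for x
  proof -
    have "continuous_on {x-1..x+1} (\<lambda>y. integral {x-1..y} g)"
      by (rule indefinite_integral_continuous_1) (use loc_int_HK acD(1)[OF assms] in auto)
    then have "continuous_on {x-1..x+1} (\<lambda>y. F (x-1) + integral {x-1..y} g)"
      by (intro continuous_intros)
    moreover have "F (x-1) + integral {x-1..y} g = F y" if "y \<in> {x-1..x+1}" for y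
      using acD(2)[OF assms, of "x-1" y] that by auto
    ultimately have "continuous_on {x-1..x+1} F"
      by (rule continuous_on_eq)
    then show ?thesis
      by (rule continuous_on_interior) (auto simp: interior_atLeastAtMost_real)
  qed
  then show ?thesis by (simp add: continuous_at_imp_continuous_on)
qed

lemma ac_exists:
  assumes "loc_int g" obtains F where "ac F g"
proof -
  define F where "F x = (if 0 \<le> x then integral {0..x} g else - integral {x..0} g)" for x
  have c: "integral {a..b} g + integral {b..c} g = integral {a..c} g" if "a \<le> b" "b \<le> c" for a b c
    using Henstock_Kurzweil_Integration.integral_combine[OF that loc_int_HK(1)[OF assms]] .
  have "F b - F a = integral {a..b} g" if "a \<le> b" for a b
    using that c[of 0 a b] c[of a 0 b] c[of a b 0] by (auto simp: F_def)
  then show ?thesis using that assms unfolding ac_def by blast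
qed

lemma ac_add: "ac F f \<Longrightarrow> ac G g \<Longrightarrow> ac (\<lambda>x. F x + G x) (\<lambda>x. f x + g x)"
  unfolding ac_def using loc_int_add loc_int_HK(1) by (auto simp: Henstock_Kurzweil_Integration.integral_add algebra_simps)

lemma ac_cmult: "ac F f \<Longrightarrow> ac (\<lambda>x. c * F x) (\<lambda>x. c * f x)"
  unfolding ac_def using loc_int_cmult[of f c] by (auto simp: right_diff_distrib[symmetric])

lemma ac_const: "ac (\<lambda>x. c) (\<lambda>x. 0)"
  by (auto simp: ac_def loc_int_def set_integrable_def)

lemma ac_cong:
  assumes "ac F f" "\<And>x. F x = G x" "\<And>x. f x = g x"
  shows "ac G g"
  using assms(1) ext[of F G, OF assms(2)] ext[of f g, OF assms(3)] by simp

lemma ac_diff: "ac F f \<Longrightarrow> ac G g \<Longrightarrow> ac (\<lambda>x. F x - G x) (\<lambda>x. f x - g x)"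
  using ac_add[OF _ ac_cmult[of G g "-1"], of F f] by simp

lemma ac_shift:
  assumes "ac F f" shows "ac (\<lambda>x. F (x + s)) (\<lambda>x. f (x + s))"
proof -
  have 1: "(LINT x:{a..b}|lborel. f (x + s)) = (LINT x:{a+s..b+s}|lborel. f x)"
    and 2: "set_integrable lborel {a..b} (\<lambda>x. f (x + s))" for a b
  proof -
    have eq: "indicat_real {a..b} x *\<^sub>R f (x + s) = indicat_real {a+s..b+s} (s + 1 * x) *\<^sub>R f (s + 1 * x)" for x
      by (auto simp: indicator_def algebra_simps)
    show "(LINT x:{a..b}|lborel. f (x + s)) = (LINT x:{a+s..b+s}|lborel. f x)"
      unfolding set_lebesgue_integral_def eq by (subst lborel_integral_real_affine[of 1 _ s]) auto
    show "set_integrable lborel {a..b} (\<lambda>x. f (x + s))"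
      using lborel_integrable_real_affine[OF loc_intD(2)[OF acD(1)[OF assms], of "a+s" "b+s", unfolded set_integrable_def], of 1 s]
      unfolding set_integrable_def eq by simp
  qed
  have [measurable]: "f \<in> borel_measurable borel" using assms acD loc_intD by blast
  have li: "loc_int (\<lambda>x. f (x + s))"
    using 2 by (auto simp: loc_int_def)
  have "F (b + s) - F (a + s) = integral {a..b} (\<lambda>x. f (x + s))" if "a \<le> b" for a b
    using ac_LINT[OF assms, of "a+s" "b+s"] that 1[of a b] loc_int_HK(2)[OF li] by auto
  then show ?thesis using li by (auto simp: ac_def)
qed

lemma ac_deriv:
  assumes "\<And>x. (F has_field_derivative f x) (at x)" "continuous_on UNIV f"
  shows "ac F f"
proof -
  have "(f has_integral (F b - F a)) {a..b}" if "a \<le> b" for a b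
    using that assms(1)
    by (intro fundamental_theorem_of_calculus)
       (auto simp: has_real_derivative_iff_has_vector_derivative[symmetric] has_field_derivative_at_within)
  then show ?thesis
    using loc_int_cont[OF assms(2)] unfolding ac_def by (metis integral_unique)
qed

lemma ac_has_deriv:
  assumes "ac F f" "isCont f x"
  shows "(F has_field_derivative f x) (at x)"
proof -
  have i: "f integrable_on {x-1..x+1}" using assms acD loc_int_HK by blast
  have "((\<lambda>u. integral {x-1..u} f) has_vector_derivative f x) (at x within {x-1..x+1})"
    by (rule integral_has_vector_derivative_continuous_at[OF i, where S="{}", simplified]) (use assms in \<open>auto intro: continuous_at_imp_continuous_at_within\<close>)
  then have "((\<lambda>u. integral {x-1..u} f) has_field_derivative f x) (at x within {x-1..x+1})"
    by (simp add: has_real_derivative_iff_has_vector_derivative)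
  then have "((\<lambda>u. integral {x-1..u} f) has_field_derivative f x) (at x)"
    using at_within_interior[of x "{x-1..x+1}"] by (simp add: interior_atLeastAtMost_real)
  then have "((\<lambda>u. F (x-1) + integral {x-1..u} f) has_field_derivative f x) (at x)"
    by (auto intro!: derivative_eq_intros)
  then show ?thesis
  proof (rule DERIV_cong_ev[OF refl _ refl, THEN iffD1, rotated])
    have "F (x-1) + integral {x-1..u} f = F u" if "u \<in> {x-1<..}" for u
      using acD(2)[OF assms(1), of "x-1" u] that by simp
    then show "\<forall>\<^sub>F u in nhds x. F (x-1) + integral {x-1..u} f = F u"
      unfolding eventually_nhds by (intro exI[of _ "{x-1<..}"]) simp
  qed
qed

text \<open>On short intervals the mean value theorem compares the increment with the
  integral up to \<open>\<epsilon>\<close> times the variation, and Bolzano's lemma adds up the intervals.\<close>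

lemma ac_chain:
  assumes F: "ac F g" and I: "\<And>x. F x \<in> I" "is_interval I"
    and D: "\<And>y. y \<in> I \<Longrightarrow> (P has_field_derivative P' y) (at y)" and cont: "continuous_on I P'"
  shows "ac (\<lambda>x. P (F x)) (\<lambda>x. P' (F x) * g x)"
proof -
  let ?h = "\<lambda>x. P' (F x) * g x"
  have cF: "continuous_on A F" for A by (rule ac_continuous[OF F])
  have cP: "continuous_on UNIV (\<lambda>x. P' (F x))"
    by (rule continuous_on_compose2[OF cont cF]) (use I in auto)
  have g: "loc_int g" using F acD by blast
  have h: "loc_int ?h" by (rule loc_int_cont_mult[OF cP g])
  have ga: "loc_int (\<lambda>x. \<bar>g x\<bar>)" by (rule loc_int_abs[OF g])
  have "P (F b) - P (F a) = integral {a..b} ?h" if "a \<le> b" for a b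
  proof -
    have est: "\<bar>P (F b) - P (F a) - integral {a..b} ?h\<bar> \<le> e * integral {a..b} (\<lambda>x. \<bar>g x\<bar>)" if "e > 0" for e
      using \<open>a \<le> b\<close>
    proof (induction rule: Bolzano)
      case (trans p q r)
      have "integral {p..q} k + integral {q..r} k = integral {p..r} k" if "loc_int k" for k
        using Henstock_Kurzweil_Integration.integral_combine trans loc_int_HK(1)[OF that] by blast
      from this[OF h] this[OF ga] trans show ?case
        by (smt (verit) distrib_left)
    next
      case (local x)
      have "isCont (\<lambda>x. P' (F x)) x" using cP by (simp add: continuous_on_eq_continuous_at)
      then obtain d where d: "d > 0" "\<And>y. dist y x < d \<Longrightarrow> dist (P' (F y)) (P' (F x)) < e / 2"
        using \<open>e > 0\<close> unfolding continuous_at_eps_delta by (metis half_gt_zero)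
      show ?case
      proof (intro exI[of _ d] conjI allI impI d(1))
        fix p q assume pq: "p \<le> x \<and> x \<le> q \<and> q - p < d"
        \<comment> \<open>The mean value point lies between F p and F q; by the intermediate value
          theorem it is a value F th with th in the same short interval, where P' o F varies by at
          most e.\<close>
        obtain th where th: "th \<in> {p..q}" "P (F q) - P (F p) = P' (F th) * (F q - F p)"
        proof -
          have seg: "\<exists>th\<in>{p..q}. F th = y" if "min (F p) (F q) \<le> y" "y \<le> max (F p) (F q)" for y
          proof (cases "F p \<le> F q")
            case True
            then show ?thesis using IVT'[of F p y q] that pq cF by fastforce
          next
            case False
            then show ?thesis using IVT2'[of F q y p] that pq cF by fastforce
          qed
          have inI: "y \<in> I" if "min (F p) (F q) \<le> y" "y \<le> max (F p) (F q)" for y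
            using seg[OF that] I(1) by auto
          consider "F p < F q" | "F q < F p" | "F p = F q" by linarith
          then show ?thesis
          proof cases
            case 1
            obtain z where z: "F p < z" "z < F q" "P (F q) - P (F p) = (F q - F p) * P' z"
              using MVT2[OF 1, of P P'] D inI by auto
            then obtain th where "th \<in> {p..q}" "F th = z" using seg[of z] by auto
            then show ?thesis using that[of th] z by (simp add: mult.commute)
          next
            case 2
            obtain z where z: "F q < z" "z < F p" "P (F p) - P (F q) = (F p - F q) * P' z"
              using MVT2[OF 2, of P P'] D inI by auto
            then obtain th where "th \<in> {p..q}" "F th = z" using seg[of z] by auto
            then show ?thesis using that[of th] z by (simp add: algebra_simps)
          next
            case 3
            then show ?thesis using that[of p] pq by auto
          qed
        qed
        have "P (F q) - P (F p) - integral {p..q} ?h = integral {p..q} (\<lambda>x. P' (F th) * g x - ?h x)"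
          using acD(2)[OF F, of p q] pq th(2) loc_int_HK(1)[OF g] loc_int_HK(1)[OF h]
            loc_int_HK(1)[OF loc_int_cmult[OF g]]
          by (simp add: Henstock_Kurzweil_Integration.integral_diff)
        moreover have "norm (integral {p..q} (\<lambda>x. P' (F th) * g x - ?h x)) \<le> integral {p..q} (\<lambda>x. e * \<bar>g x\<bar>)"
        proof (rule Henstock_Kurzweil_Integration.integral_norm_bound_integral)
          fix y assume y: "y \<in> {p..q}"
          have "dist y x < d" "dist th x < d" using pq y th(1) by (auto simp: dist_real_def abs_if)
          then have "dist (P' (F y)) (P' (F x)) < e / 2" "dist (P' (F th)) (P' (F x)) < e / 2"
            using d(2) by blast+
          then have "\<bar>P' (F th) - P' (F y)\<bar> \<le> e" by (auto simp: dist_real_def abs_if split: if_splits)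
          then show "norm (P' (F th) * g y - ?h y) \<le> e * \<bar>g y\<bar>"
            by (simp add: left_diff_distrib[symmetric] abs_mult mult_right_mono)
        qed (use loc_int_HK(1)[OF loc_int_diff[OF loc_int_cmult[OF g] h]] loc_int_HK(1)[OF loc_int_cmult[OF ga]] in auto)
        ultimately show "\<bar>P (F q) - P (F p) - integral {p..q} ?h\<bar> \<le> e * integral {p..q} (\<lambda>x. \<bar>g x\<bar>)"
          by simp
      qed
    qed
    let ?C = "integral {a..b} (\<lambda>x. \<bar>g x\<bar>)"
    have "\<bar>P (F b) - P (F a) - integral {a..b} ?h\<bar> \<le> 0"
    proof (rule field_le_epsilon)
      fix e :: real assume "e > 0"
      have C: "?C \<ge> 0" by (intro Henstock_Kurzweil_Integration.integral_nonneg loc_int_HK(1)[OF ga]) auto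
      have "\<bar>P (F b) - P (F a) - integral {a..b} ?h\<bar> \<le> e / (?C + 1) * ?C"
        using \<open>e > 0\<close> C by (intro est) auto
      also have "... \<le> e" using \<open>e > 0\<close> C by (simp add: field_simps)
      finally show "\<bar>P (F b) - P (F a) - integral {a..b} ?h\<bar> \<le> 0 + e" by simp
    qed
    then show ?thesis by simp
  qed
  then show ?thesis using h by (auto simp: ac_def)
qed

lemma ac_square: "ac F f \<Longrightarrow> ac (\<lambda>x. (F x)\<^sup>2) (\<lambda>x. 2 * F x * f x)"
  by (rule ac_chain[where I=UNIV and P="\<lambda>y. y\<^sup>2"]) (auto intro!: derivative_eq_intros continuous_intros)

text \<open>Polarisation: F G is half of (F + G)^2 - F^2 - G^2, so the chain rule for the square
  suffices.\<close>

lemma ac_mult: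
  assumes "ac F f" "ac G g" shows "ac (\<lambda>x. F x * G x) (\<lambda>x. f x * G x + F x * g x)"
  by (rule ac_cong[OF ac_cmult[OF ac_diff[OF ac_square[OF ac_add[OF assms]] ac_add[OF ac_square[OF assms(1)] ac_square[OF assms(2)]]], of "1/2"]])
     (auto simp: power2_eq_square algebra_simps)

text \<open>Lebesgue differentiation: off a negligible set r x is the limit of the means of r over
  the intervals from x to x + h, and these means are all zero.\<close>

lemma AE_zero_interval:
  assumes r: "loc_int r" and z: "\<And>a b. a \<le> b \<Longrightarrow> integral {a..b} r = 0"
  shows "AE x in lborel. r x = 0"
proof -
  have i: "r integrable_on cbox a b" for a b
    using loc_int_HK(1)[OF r] by auto
  obtain N where N: "negligible N"
    "\<And>x e. \<lbrakk>x \<notin> N; 0 < e\<rbrakk> \<Longrightarrow> \<exists>d>0. \<forall>h. 0 < h \<and> h < d \<longrightarrow>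
         norm(integral (cbox x (x + h *\<^sub>R One)) r /\<^sub>R h ^ DIM(real) - r x) < e"
    using integrable_ccontinuous_explicit[OF i] by blast
  have "r x = 0" if nx: "x \<notin> N" for x
  proof (rule ccontr)
    assume "r x \<noteq> 0"
    obtain d where d: "d > 0" "\<forall>h. 0 < h \<and> h < d \<longrightarrow>
         norm(integral (cbox x (x + h *\<^sub>R One)) r /\<^sub>R h ^ DIM(real) - r x) < \<bar>r x\<bar>"
      using N(2)[OF nx, of "\<bar>r x\<bar>"] \<open>r x \<noteq> 0\<close> by (metis zero_less_abs_iff)
    from d(2)[rule_format, of "d/2"] d(1) z[of x "x + d/2"] show False by auto
  qed
  moreover have "N \<in> null_sets lebesgue" using N(1) negligible_iff_null_sets by blast
  ultimately have "AE x in lebesgue. r x = 0"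
    by (intro AE_I'[of N]) auto
  then show ?thesis by (simp add: AE_completion_iff)
qed

lemma ac_unique:
  assumes "ac F f" "ac F g" shows "AE x in lborel. f x = g x"
proof -
  have "loc_int f" "loc_int g" using assms acD by blast+
  then have "AE x in lborel. f x - g x = 0"
    by (intro AE_zero_interval loc_int_diff)
       (use acD(2)[OF assms(1)] acD(2)[OF assms(2)] in \<open>auto simp: Henstock_Kurzweil_Integration.integral_diff loc_int_HK(1)\<close>)
  then show ?thesis by simp
qed

section \<open>Weak derivatives\<close>

lemma L1_loc_measurable:
  assumes "f \<in> L1_loc" shows "f \<in> borel_measurable lebesgue"
proof (rule borel_measurable_LIMSEQ_real)
  show "(\<lambda>x. indicat_real {- real n..real n} x *\<^sub>R f x) \<in> borel_measurable lebesgue" for n :: nat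
    using assms by (auto simp: L1_loc_def set_integrable_def)
  show "(\<lambda>n. indicat_real {- real n..real n} x *\<^sub>R f x) \<longlonglongrightarrow> f x" for x
  proof (rule tendsto_eventually)
    obtain N :: nat where N: "\<bar>x\<bar> \<le> real N" using real_arch_simple by blast
    have "indicat_real {- real n..real n} x *\<^sub>R f x = f x" if "n \<ge> N" for n
      using N that by (auto simp: indicator_def)
    then show "\<forall>\<^sub>F n in sequentially. indicat_real {- real n..real n} x *\<^sub>R f x = f x"
      unfolding eventually_sequentially by blast
  qed
qed

lemma AE_lebesgue_iff: "(AE x in lebesgue. P x) \<longleftrightarrow> (AE x in lborel. P x)"
  by (rule AE_completion_iff)

lemma indicator_lebesgue [measurable]: "indicat_real {a..b::real} \<in> borel_measurable lebesgue"
  by (intro measurable_completion borel_measurable_indicator) auto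

lemma L1_loc_rep:
  assumes f: "f \<in> L1_loc"
  obtains f' where "loc_int f'" "AE x in lborel. f x = f' x"
proof -
  obtain f' where f': "f' \<in> borel_measurable lborel" "AE x in lborel. f x = f' x"
    using completion_ex_borel_measurable_real[OF L1_loc_measurable[OF f]] by blast
  have [measurable]: "f \<in> borel_measurable lebesgue" "f' \<in> borel_measurable lebesgue"
    by (rule L1_loc_measurable[OF f]) (rule measurable_completion[OF f'(1)])
  have "set_integrable lborel {a..b} f'" for a b
  proof -
    have "integrable lebesgue (\<lambda>x. indicat_real {a..b} x *\<^sub>R f x)"
      using f by (auto simp: L1_loc_def set_integrable_def)
    also have "?this \<longleftrightarrow> integrable lebesgue (\<lambda>x. indicat_real {a..b} x *\<^sub>R f' x)"
    proof (rule integrable_cong_AE)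
      show "AE x in lebesgue. indicat_real {a..b} x *\<^sub>R f x = indicat_real {a..b} x *\<^sub>R f' x"
        using f'(2) unfolding AE_lebesgue_iff by eventually_elim simp
    qed measurable
    also have "... \<longleftrightarrow> integrable lborel (\<lambda>x. indicat_real {a..b} x *\<^sub>R f' x)"
      by (rule integrable_completion) (use f' in measurable)
    finally show ?thesis by (simp add: set_integrable_def)
  qed
  then show ?thesis using that f' by (auto simp: loc_int_def)
qed

lemma loc_int_L1_loc:
  assumes f: "loc_int f" shows "f \<in> L1_loc"
proof -
  have [measurable]: "f \<in> borel_measurable borel" by (rule loc_intD(1)[OF f])
  have "integrable lebesgue (\<lambda>x. indicat_real {a..b} x *\<^sub>R f x)" for a b
    using loc_intD(2)[OF f] by (subst integrable_completion) (auto simp: set_integrable_def)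
  then show ?thesis by (auto simp: L1_loc_def set_integrable_def)
qed

lemma test_funpow_borel:
  assumes "test_function_on U p" shows "(deriv ^^ k) p \<in> borel_measurable borel"
proof -
  have "isCont ((deriv ^^ k) p) x" for x
    using assms unfolding test_function_on_def field_differentiable_def by (metis DERIV_isCont)
  then show ?thesis
    by (simp add: borel_measurable_continuous_onI continuous_at_imp_continuous_on)
qed

lemma lebesgue_mult_cong:
  assumes "f \<in> L1_loc" "AE x in lborel. f x = f' x" "loc_int f'" "c \<in> borel_measurable borel"
  shows "(LINT x|lebesgue. f x * c x) = (LINT x|lborel. f' x * c x)"
proof -
  have [measurable]: "f' \<in> borel_measurable borel" by (rule loc_intD(1)[OF assms(3)])
  have [measurable]: "c \<in> borel_measurable borel" by (rule assms(4))
  have c: "c \<in> borel_measurable lebesgue" "f' \<in> borel_measurable lebesgue"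
    by (rule measurable_completion, measurable)+
  have "(LINT x|lebesgue. f x * c x) = (LINT x|lebesgue. f' x * c x)"
    by (rule integral_cong_AE)
       (use assms(2) L1_loc_measurable[OF assms(1)] c in \<open>auto simp: AE_lebesgue_iff intro!: borel_measurable_times\<close>)
  also have "... = (LINT x|lborel. f' x * c x)"
    by (rule integral_completion) measurable
  finally show ?thesis .
qed

text \<open>Both integrals see only almost-everywhere classes, so the defining identity can be
  checked on Borel representatives with respect to \<open>lborel\<close>.\<close>

lemma has_weak_deriv_rep:
  assumes "f \<in> L1_loc" "g \<in> L1_loc"
    and "AE x in lborel. f x = f' x" "AE x in lborel. g x = g' x" "loc_int f'" "loc_int g'"
  shows "has_weak_deriv k f g \<longleftrightarrow>
    (\<forall>\<phi>. test_function_on UNIV \<phi> \<longrightarrow>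
        (LINT x|lborel. f' x * (deriv ^^ k) \<phi> x) = (-1) ^ k * (LINT x|lborel. g' x * \<phi> x))"
proof -
  have "(LINT x|lebesgue. f x * (deriv ^^ k) \<phi> x) = (LINT x|lborel. f' x * (deriv ^^ k) \<phi> x) \<and>
        (LINT x|lebesgue. g x * \<phi> x) = (LINT x|lborel. g' x * \<phi> x)" if "test_function_on UNIV \<phi>" for \<phi>
    using lebesgue_mult_cong[OF assms(1,3,5) test_funpow_borel[OF that]]
      lebesgue_mult_cong[OF assms(2,4,6) test_funpow_borel[OF that, of 0]] by simp
  then show ?thesis
    using assms(1,2) unfolding has_weak_deriv_def by auto
qed

lemma has_weak_deriv_loc_int:
  assumes "loc_int f" "loc_int g"
  shows "has_weak_deriv k f g \<longleftrightarrow>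
    (\<forall>\<phi>. test_function_on UNIV \<phi> \<longrightarrow>
        (LINT x|lborel. f x * (deriv ^^ k) \<phi> x) = (-1) ^ k * (LINT x|lborel. g x * \<phi> x))"
  by (rule has_weak_deriv_rep) (use assms loc_int_L1_loc in auto)

lemma has_weak_deriv_AE:
  assumes "has_weak_deriv k f g" "AE x in lborel. f x = f' x" "AE x in lborel. g x = g' x" "loc_int f'" "loc_int g'"
  shows "has_weak_deriv k f' g'"
  using assms has_weak_deriv_rep[OF _ _ assms(2-5)] has_weak_deriv_loc_int[OF assms(4,5)]
  by (metis has_weak_deriv_def)

lemma loc_int_test:
  assumes f: "loc_int f" and p: "continuous_on UNIV p" "\<And>x. x \<notin> {a..b} \<Longrightarrow> p x = 0"
  shows "integrable lborel (\<lambda>x. f x * p x)" "(LINT x|lborel. f x * p x) = integral {a..b} (\<lambda>x. f x * p x)"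
proof -
  have l: "loc_int (\<lambda>x. f x * p x)"
    using loc_int_cont_mult[OF p(1) f] by (simp add: mult.commute)
  have e: "indicat_real {a..b} x *\<^sub>R (f x * p x) = f x * p x" for x
    using p(2)[of x] by (auto simp: indicator_def)
  show "integrable lborel (\<lambda>x. f x * p x)"
    using loc_intD(2)[OF l, of a b] unfolding set_integrable_def e .
  show "(LINT x|lborel. f x * p x) = integral {a..b} (\<lambda>x. f x * p x)"
    using loc_int_HK(2)[OF l, of a b] unfolding set_lebesgue_integral_def e .
qed

lemma test_function_plateau:
  assumes "a \<le> b" "{a..b + 1 / real (Suc n)} \<subseteq> U" shows "test_function_on U (plateau a b n)"
  using test_functionI[OF smooth_plateau plateau_outside[OF assms(1)] assms(2)] .

lemma plateau_integral_tendsto: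
  assumes r: "loc_int r" and ab: "a \<le> b"
  shows "(\<lambda>n. LINT x|lborel. r x * plateau a b n x) \<longlonglongrightarrow> integral {a..b} r"
proof -
  have [measurable]: "r \<in> borel_measurable borel" by (rule loc_intD(1)[OF r])
  have [measurable]: "plateau a b n \<in> borel_measurable borel" for n
    using smooth_continuous_on[OF smooth_plateau] by (rule borel_measurable_continuous_onI)
  have "(\<lambda>n. LINT x|lborel. r x * plateau a b n x) \<longlonglongrightarrow> (LINT x|lborel. r x * indicator {a<..b} x)"
  proof (rule integral_dominated_convergence[where w="\<lambda>x. indicat_real {a..b+1} x *\<^sub>R \<bar>r x\<bar>"])
    show "integrable lborel (\<lambda>x. indicat_real {a..b+1} x *\<^sub>R \<bar>r x\<bar>)"
      using loc_intD(2)[OF loc_int_abs[OF r]] by (auto simp: set_integrable_def)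
    show "AE x in lborel. (\<lambda>n. r x * plateau a b n x) \<longlonglongrightarrow> r x * indicator {a<..b} x"
      by (intro AE_I2 tendsto_mult tendsto_const plateau_tendsto ab)
    show "AE x in lborel. norm (r x * plateau a b n x) \<le> indicat_real {a..b+1} x *\<^sub>R \<bar>r x\<bar>" for n
    proof (rule AE_I2)
      fix x
      have "1 / real (Suc n) \<le> 1" by simp
      then have "{a..b + 1 / real (Suc n)} \<subseteq> {a..b+1}" by (simp del: of_nat_Suc)
      then have "plateau a b n x = 0" if "x \<notin> {a..b+1}"
        using that by (intro plateau_outside[OF ab]) blast
      then show "norm (r x * plateau a b n x) \<le> indicat_real {a..b+1} x *\<^sub>R \<bar>r x\<bar>"
        using plateau_bounds[of a b n x] mult_left_mono[of "\<bar>plateau a b n x\<bar>" 1 "\<bar>r x\<bar>"]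
        by (cases "x \<in> {a..b+1}") (auto simp: abs_mult)
    qed
  qed measurable
  also have "(LINT x|lborel. r x * indicator {a<..b} x) = (LINT x:{a..b}|lborel. r x)"
    unfolding set_lebesgue_integral_def
  proof (rule integral_cong_AE)
    show "AE x in lborel. r x * indicat_real {a<..b} x = indicat_real {a..b} x *\<^sub>R r x"
      using AE_lborel_singleton[of a] by eventually_elim (auto simp: indicator_def)
  qed measurable
  finally show ?thesis using loc_int_HK(2)[OF r] by simp
qed

text \<open>Testing with plateaus gives, in the limit, zero integrals over all intervals.\<close>

lemma fundamental_lemma:
  assumes r: "loc_int r" and z: "\<And>\<phi>. test_function_on UNIV \<phi> \<Longrightarrow> (LINT x|lborel. r x * \<phi> x) = 0"
  shows "AE x in lborel. r x = 0"
proof (rule AE_zero_interval[OF r])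
  fix a b :: real assume ab: "a \<le> b"
  show "integral {a..b} r = 0"
    using plateau_integral_tendsto[OF r ab] z[OF test_function_plateau[OF ab]]
    by (simp add: LIMSEQ_const_iff)
qed

lemma has_weak_deriv_unique:
  assumes "has_weak_deriv k f g" "has_weak_deriv k f g'"
  shows "AE x in lborel. g x = g' x"
proof -
  have L: "f \<in> L1_loc" "g \<in> L1_loc" "g' \<in> L1_loc" using assms by (auto simp: has_weak_deriv_def)
  obtain f1 where f1: "loc_int f1" "AE x in lborel. f x = f1 x" using L1_loc_rep[OF L(1)] by blast
  obtain g1 where g1: "loc_int g1" "AE x in lborel. g x = g1 x" using L1_loc_rep[OF L(2)] by blast
  obtain g2 where g2: "loc_int g2" "AE x in lborel. g' x = g2 x" using L1_loc_rep[OF L(3)] by blast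
  have "AE x in lborel. g1 x - g2 x = 0"
  proof (rule fundamental_lemma[OF loc_int_diff[OF g1(1) g2(1)]])
    fix \<phi> assume t: "test_function_on UNIV \<phi>"
    obtain a b where ab: "smooth \<phi>" "a \<le> b" "\<And>x. x \<notin> {a..b} \<Longrightarrow> \<phi> x = 0"
      using test_functionD[OF t] by blast
    have i: "integrable lborel (\<lambda>x. g1 x * \<phi> x)" "integrable lborel (\<lambda>x. g2 x * \<phi> x)"
      using loc_int_test(1)[OF _ smooth_continuous_on[OF ab(1)] ab(3)] g1 g2 by blast+
    have "(LINT x|lborel. g1 x * \<phi> x) = (LINT x|lborel. g2 x * \<phi> x)"
      using assms t has_weak_deriv_rep[OF L(1,2) f1(2) g1(2) f1(1) g1(1), of k]
        has_weak_deriv_rep[OF L(1,3) f1(2) g2(2) f1(1) g2(1), of k] by auto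
    then show "(LINT x|lborel. (g1 x - g2 x) * \<phi> x) = 0"
      using i by (simp add: left_diff_distrib)
  qed
  with g1(2) g2(2) show ?thesis by eventually_elim simp
qed

lemma ac_integration_by_parts:
  assumes F: "ac F g" and t: "test_function_on UNIV \<phi>"
  shows "(LINT x|lborel. F x * deriv \<phi> x) = - (LINT x|lborel. g x * \<phi> x)"
proof -
  obtain a b where ab: "smooth \<phi>" "a \<le> b" "\<And>x. x \<notin> {a..b} \<Longrightarrow> \<phi> x = 0"
    using test_functionD[OF t] by blast
  \<comment> \<open>The interval is enlarged by one on each side so that its end points lie outside
    \<open>{a..b}\<close> and the boundary terms vanish.\<close>
  have ab': "x \<notin> {a-1..b+1} \<Longrightarrow> \<phi> x = 0" "x \<notin> {a-1..b+1} \<Longrightarrow> deriv \<phi> x = 0" for x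
    using ab(3) deriv_zero_outside[OF ab(3)] by auto
  have c: "continuous_on UNIV \<phi>" "continuous_on UNIV (deriv \<phi>)"
    by (intro smooth_continuous_on smooth_deriv ab(1))+
  have p: "ac \<phi> (deriv \<phi>)"
    by (intro ac_deriv smooth_has_deriv ab(1) c(2))
  have lF: "loc_int F" "loc_int g" using ac_continuous[OF F] loc_int_cont F acD by blast+
  have s: "integral {a-1..b+1} (\<lambda>x. g x * \<phi> x + F x * deriv \<phi> x) = 0"
    using acD(2)[OF ac_mult[OF F p], of "a-1" "b+1"] ab by simp
  have "(\<lambda>x. g x * \<phi> x) integrable_on {a-1..b+1}" "(\<lambda>x. F x * deriv \<phi> x) integrable_on {a-1..b+1}"
    using loc_int_HK(1)[OF loc_int_cont_mult[OF c(1) lF(2)]] loc_int_HK(1)[OF loc_int_cont_mult[OF c(2) lF(1)]]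
    by (auto simp: mult.commute)
  then show ?thesis
    using loc_int_test(2)[OF lF(1) c(2) ab'(2)] loc_int_test(2)[OF lF(2) c(1) ab'(1)] s
    by (simp add: Henstock_Kurzweil_Integration.integral_add)
qed

lemma ac_has_weak_deriv_Suc:
  assumes "has_weak_deriv k f F" "ac F g" "loc_int f" shows "has_weak_deriv (Suc k) f g"
proof -
  have lF: "loc_int F" "loc_int g" using ac_continuous loc_int_cont assms(2) acD by blast+
  show ?thesis
    unfolding has_weak_deriv_loc_int[OF assms(3) lF(2)]
  proof (intro allI impI)
    fix \<phi> assume t: "test_function_on UNIV \<phi>"
    have "(LINT x|lborel. f x * (deriv ^^ Suc k) \<phi> x) = (LINT x|lborel. f x * (deriv ^^ k) (deriv \<phi>) x)"
      by (simp only: funpow_Suc_right comp_apply)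
    also have "... = (-1) ^ k * (LINT x|lborel. F x * deriv \<phi> x)"
      using assms(1) test_function_deriv[OF t] unfolding has_weak_deriv_loc_int[OF assms(3) lF(1)] by blast
    also have "... = (-1) ^ Suc k * (LINT x|lborel. g x * \<phi> x)"
      using ac_integration_by_parts[OF assms(2) t] by simp
    finally show "(LINT x|lborel. f x * (deriv ^^ Suc k) \<phi> x) = (-1) ^ Suc k * (LINT x|lborel. g x * \<phi> x)" .
  qed
qed

lemma has_weak_deriv_0: "loc_int f \<Longrightarrow> has_weak_deriv 0 f f"
  by (subst has_weak_deriv_loc_int) auto

lemma deriv_step_outside: "x \<notin> {0..1} \<Longrightarrow> deriv step x = 0"
proof -
  assume "x \<notin> {0..1}"
  then have "x < 0 \<or> x > 1" by auto
  then show ?thesis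
  proof
    assume 1: "x < 0"
    have "(step has_field_derivative 0) (at x)"
      by (rule DERIV_cong_ev[OF refl _ refl, THEN iffD2, of _ "\<lambda>_. 0"])
         (use 1 step in \<open>auto simp: eventually_nhds intro!: exI[of _ "{..<0}"]\<close>)
    then show ?thesis by (rule DERIV_imp_deriv)
  next
    assume 2: "x > 1"
    have "(step has_field_derivative 0) (at x)"
      by (rule DERIV_cong_ev[OF refl _ refl, THEN iffD2, of _ "\<lambda>_. 1"])
         (use 2 step in \<open>auto simp: eventually_nhds intro!: exI[of _ "{1<..}"]\<close>)
    then show ?thesis by (rule DERIV_imp_deriv)
  qed
qed

text \<open>The argument of du Bois-Reymond: a test function \<open>\<psi>\<close> minus \<open>(\<integral>\<psi>)\<close> times a fixed test function
  of integral one is the derivative of a test function.\<close>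

lemma weakly_constant:
  assumes r: "loc_int r" and z: "\<And>\<phi>. test_function_on UNIV \<phi> \<Longrightarrow> (LINT x|lborel. r x * deriv \<phi> x) = 0"
  obtains c where "AE x in lborel. r x = c"
proof -
  define th where "th = deriv step"
  have th: "smooth th" unfolding th_def by (intro smooth_deriv step)
  have thz: "th x = 0" if "x \<notin> {0..1}" for x
    unfolding th_def using that by (rule deriv_step_outside)
  define C where "C = (LINT x|lborel. r x * th x)"
  have "AE x in lborel. r x - C = 0"
  proof (rule fundamental_lemma)
    show "loc_int (\<lambda>x. r x - C)" by (intro loc_int_diff r loc_int_cont continuous_on_const)
    fix \<psi> assume t: "test_function_on UNIV \<psi>"
    obtain a b where ab: "smooth \<psi>" "a \<le> b" "\<And>x. x \<notin> {a..b} \<Longrightarrow> \<psi> x = 0"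
      using test_functionD[OF t] by blast
    obtain F0 where F0: "\<And>x. (F0 has_field_derivative \<psi> x) (at x)"
      using continuous_antideriv[OF smooth_continuous_on[OF ab(1)]] by blast
    define F where "F x = F0 x - F0 a" for x
    have F: "(F has_field_derivative \<psi> x) (at x)" for x
      unfolding F_def using F0 by (auto intro!: derivative_eq_intros)
    have sF: "smooth F" by (rule smooth_antideriv[OF F ab(1)])
    have acF: "ac F \<psi>" by (intro ac_deriv F smooth_continuous_on ab)
    have iz: "integral {x..y} \<psi> = 0" if "y \<le> a \<or> b \<le> x" for x y
    proof -
      have "integral {x..y} \<psi> = integral {x..y} (\<lambda>x. 0)"
      proof (rule integral_spike[where S="{a,b}"])
        show "negligible {a,b}" by simp
        show "(\<lambda>x. 0) u = \<psi> u" if "u \<in> {x..y} - {a,b}" for u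
          using that \<open>y \<le> a \<or> b \<le> x\<close> ab(3)[of u] by auto
      qed
      then show ?thesis by simp
    qed
    have Fl: "F x = 0" if "x \<le> a" for x
      using acD(2)[OF acF that] iz[of a x] by (simp add: F_def)
    have Fr: "F x = F b" if "x \<ge> b" for x
      using acD(2)[OF acF that] iz[of x b] by simp
    have Ib: "(LINT x|lborel. \<psi> x) = F b"
      using loc_int_test(2)[of "\<lambda>_. 1" \<psi> a b] loc_int_cont[of "\<lambda>_. 1"] ab smooth_continuous_on[OF ab(1)]
        acD(2)[OF acF ab(2)] Fl[of a] by simp
    \<comment> \<open>F is zero left of a and constantly F b right of b; subtracting F b times the
      step removes the right tail and makes the support compact.\<close>
    define \<phi> where "\<phi> x = F x - F b * step x" for x
    have "test_function_on UNIV \<phi>"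
    proof (rule test_functionI[of _ "min a 0" "max b 1"])
      show "smooth \<phi>" unfolding \<phi>_def by (intro smooth_diff_cmult sF step)
      show "\<phi> x = 0" if x: "x \<notin> {min a 0..max b 1}" for x
      proof (cases "x < min a 0")
        case True then show ?thesis using Fl[of x] step(2)[of x] by (simp add: \<phi>_def)
      next
        case False
        then have "x \<ge> b" "x \<ge> 1" using x by auto
        then show ?thesis using Fr[of x] step(3)[of x] by (simp add: \<phi>_def)
      qed
    qed auto
    from z[OF this] have z1: "(LINT x|lborel. r x * deriv \<phi> x) = 0" .
    have d: "deriv \<phi> x = \<psi> x - F b * th x" for x
      unfolding \<phi>_def th_def
      by (rule DERIV_imp_deriv) (auto intro!: derivative_eq_intros F smooth_has_deriv step(1))
    have i1: "integrable lborel (\<lambda>x. r x * \<psi> x)" and i2: "integrable lborel (\<lambda>x. r x * th x)"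
      and i3: "integrable lborel (\<lambda>x. 1 * \<psi> x)"
      using loc_int_test(1)[OF r smooth_continuous_on[OF ab(1)] ab(3)]
        loc_int_test(1)[OF r smooth_continuous_on[OF th] thz]
        loc_int_test(1)[OF loc_int_cont[OF continuous_on_const] smooth_continuous_on[OF ab(1)] ab(3)] by blast+
    have "(LINT x|lborel. r x * deriv \<phi> x) = (LINT x|lborel. r x * \<psi> x - F b * (r x * th x))"
      by (simp add: d algebra_simps)
    also have "... = (LINT x|lborel. r x * \<psi> x) - F b * C"
      using i1 i2 by (simp add: C_def)
    finally have e: "(LINT x|lborel. r x * \<psi> x) = F b * C" using z1 by simp
    have "(LINT x|lborel. (r x - C) * \<psi> x) = (LINT x|lborel. r x * \<psi> x - C * \<psi> x)"
      by (simp add: algebra_simps)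
    also have "... = (LINT x|lborel. r x * \<psi> x) - C * (LINT x|lborel. \<psi> x)"
      using i1 i3 by simp
    finally show "(LINT x|lborel. (r x - C) * \<psi> x) = 0" by (simp add: e Ib)
  qed
  then show ?thesis using that[of C] by simp
qed

text \<open>The difference of f and a primitive of g has weak derivative zero, hence is almost
  everywhere constant.\<close>

lemma weak_deriv_1_ac:
  assumes f: "loc_int f" "loc_int g" "has_weak_deriv 1 f g"
  obtains F where "ac F g" "AE x in lborel. f x = F x"
proof -
  obtain G where G: "ac G g" using ac_exists[OF f(2)] .
  have lG: "loc_int G" by (intro loc_int_cont ac_continuous[OF G])
  have "(LINT x|lborel. (f x - G x) * deriv \<phi> x) = 0" if t: "test_function_on UNIV \<phi>" for \<phi>
  proof -
    obtain a b where ab: "smooth \<phi>" "a \<le> b" "\<And>x. x \<notin> {a..b} \<Longrightarrow> \<phi> x = 0"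
      using test_functionD[OF t] by blast
    have dz: "deriv \<phi> x = 0" if "x \<notin> {a..b}" for x
      by (rule deriv_zero_outside[of a b \<phi>, OF ab(3) that])
    have i: "integrable lborel (\<lambda>x. f x * deriv \<phi> x)" "integrable lborel (\<lambda>x. G x * deriv \<phi> x)"
      by (rule loc_int_test(1)[OF f(1) smooth_continuous_on[OF smooth_deriv[OF ab(1)]] dz],
          simp, rule loc_int_test(1)[OF lG smooth_continuous_on[OF smooth_deriv[OF ab(1)]] dz], simp)
    have "(LINT x|lborel. f x * deriv \<phi> x) = (LINT x|lborel. G x * deriv \<phi> x)"
      using f(3) ac_integration_by_parts[OF G t] t unfolding has_weak_deriv_loc_int[OF f(1,2)] by simp
    then show ?thesis using i by (simp add: left_diff_distrib)
  qed
  from weakly_constant[OF loc_int_diff[OF f(1) lG] this] obtain c where "AE x in lborel. f x - G x = c" by blast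
  then have "AE x in lborel. f x = G x + c" by (rule eventually_mono) simp
  moreover have "ac (\<lambda>x. G x + c) g"
    using ac_add[OF G ac_const] by simp
  ultimately show ?thesis using that by blast
qed

lemma continuous_AE_eq:
  fixes f g :: "real \<Rightarrow> real"
  assumes "continuous_on UNIV f" "continuous_on UNIV g" "AE x in lborel. f x = g x"
  shows "f = g"
proof (rule ccontr)
  let ?S = "{x. f x \<noteq> g x}"
  assume "f \<noteq> g"
  then have "?S \<noteq> {}" by auto
  moreover have "open ?S" by (rule open_Collect_neq[OF assms(1,2)])
  ultimately have "\<not> negligible ?S" using open_not_negligible by blast
  moreover have "?S \<in> null_sets lebesgue"
    using assms(3) unfolding AE_lebesgue_iff[symmetric] completion.AE_iff_null_sets by simp
  ultimately show False using negligible_iff_null_sets by blast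
qed

lemma ac_AE_cong:
  assumes "ac F g" "AE x in lborel. g x = g' x" "loc_int g'"
  shows "ac F g'"
proof -
  have "integral {a..b} g = integral {a..b} g'" for a b
  proof -
    have "(LINT x:{a..b}|lborel. g x) = (LINT x:{a..b}|lborel. g' x)"
      by (rule set_lebesgue_integral_cong_AE)
         (use assms acD loc_intD in auto)
    then show ?thesis using assms acD loc_int_HK(2) by metis
  qed
  then show ?thesis using assms by (simp add: ac_def)
qed

lemma AE_shift:
  assumes "AE x in lborel. P x" shows "AE x in lborel. P (x + (s::real))"
proof -
  obtain N where N: "N \<in> null_sets lborel" "{x. \<not> P x} \<subseteq> N"
    using assms unfolding eventually_ae_filter by auto
  have [measurable]: "N \<in> sets borel" using N by auto
  have "AE x in lborel. x \<notin> N" using N(1) by (rule AE_not_in)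
  then have "AE x in lborel. s + 1 * x \<notin> N"
    by (intro AE_borel_affine) (auto simp: pred_def)
  then show ?thesis
    by eventually_elim (use N in \<open>auto simp: add.commute\<close>)
qed

text \<open>The null sets of all integer shifts form a countable family. Off their union g agrees
  with its composition with the fractional part, which is exactly periodic.\<close>

lemma AE_periodic_rep:
  assumes g: "loc_int g" and p: "AE x in lborel. g (x + 1) = g x"
  obtains g' where "loc_int g'" "\<And>x. g' (x + 1) = g' x" "AE x in lborel. g x = g' x"
proof -
  have [measurable]: "g \<in> borel_measurable borel" by (rule loc_intD(1)[OF g])
  define g' where "g' x = g (x - real_of_int \<lfloor>x\<rfloor>)" for x
  have [measurable]: "g' \<in> borel_measurable borel" unfolding g'_def by measurable
  have "AE x in lborel. g (x + real n) = g x" for n :: nat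
  proof (induction n)
    case (Suc n)
    have "AE x in lborel. g ((x + real n) + 1) = g (x + real n)"
      using AE_shift[OF p, of "real n"] by simp
    with Suc show ?case by eventually_elim (simp add: algebra_simps)
  qed auto
  then have 1: "AE x in lborel. \<forall>n::nat. g (x + real n) = g x" by (simp add: AE_all_countable)
  have 2: "AE x in lborel. \<forall>n::nat. g (x - real n) = g x"
  proof -
    have "AE x in lborel. g (x - real n) = g x" for n :: nat
      using AE_shift[of "\<lambda>x. \<forall>n::nat. g (x + real n) = g x" "- real n", OF 1]
      by eventually_elim (metis add.commute diff_add_cancel uminus_add_conv_diff)
    then show ?thesis by (simp add: AE_all_countable)
  qed
  have ae: "AE x in lborel. g x = g' x"
    using 1 2
  proof eventually_elim
    case (elim x)
    show ?case
    proof (cases "\<lfloor>x\<rfloor> \<ge> 0")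
      case True
      then show ?thesis using elim(2)[rule_format, of "nat \<lfloor>x\<rfloor>"] by (simp add: g'_def)
    next
      case False
      then show ?thesis using elim(1)[rule_format, of "nat (- \<lfloor>x\<rfloor>)"] by (simp add: g'_def)
    qed
  qed
  have "set_integrable lborel {a..b} g'" for a b
    using loc_intD(2)[OF g, of a b]
    by (rule set_integrable_cong_AE[THEN iffD1, rotated -1]) (use ae in auto)
  then have "loc_int g'" by (auto simp: loc_int_def)
  moreover have "g' (x + 1) = g' x" for x by (simp add: g'_def)
  ultimately show ?thesis using that ae by blast
qed

lemma ac_periodic:
  assumes F: "ac F g" "\<And>x. F (x + 1) = F x"
  shows "AE x in lborel. g (x + 1) = g x"
  using ac_unique[OF ac_shift[OF F(1), of 1]] F by simp

lemma weak_deriv_AE: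
  assumes "has_weak_deriv k f g" shows "AE x in lborel. weak_deriv k f x = g x"
proof -
  have "has_weak_deriv k f (weak_deriv k f)"
    unfolding weak_deriv_def using someI[of "has_weak_deriv k f" g] assms by simp
  then show ?thesis using assms by (rule has_weak_deriv_unique)
qed

lemma LINT_weak_deriv_square:
  assumes "has_weak_deriv k f g" "loc_int g'" "AE x in lborel. g x = g' x"
  shows "(LINT h:{0..1}|lebesgue. (weak_deriv k f h)\<^sup>2) = (LINT h:{0..1}|lborel. (g' h)\<^sup>2)"
proof -
  have [measurable]: "g' \<in> borel_measurable borel" by (rule loc_intD(1)[OF assms(2)])
  have "has_weak_deriv k f (weak_deriv k f)"
    unfolding weak_deriv_def using someI[of "has_weak_deriv k f" g] assms(1) by simp
  then have m: "weak_deriv k f \<in> borel_measurable lebesgue"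
    by (auto simp: has_weak_deriv_def intro: L1_loc_measurable)
  have m': "g' \<in> borel_measurable lebesgue" by (rule measurable_completion) measurable
  have "AE x in lborel. weak_deriv k f x = g' x"
    using weak_deriv_AE[OF assms(1)] assms(3) by eventually_elim simp
  then have "(LINT h:{0..1}|lebesgue. (weak_deriv k f h)\<^sup>2) = (LINT h:{0..1}|lebesgue. (g' h)\<^sup>2)"
    unfolding set_lebesgue_integral_def
    by (intro integral_cong_AE) (use m m' in \<open>auto simp: AE_lebesgue_iff\<close>)
  also have "... = (LINT h:{0..1}|lborel. (g' h)\<^sup>2)"
    unfolding set_lebesgue_integral_def by (rule integral_completion) measurable
  finally show ?thesis .
qed

section \<open>Sobolev functions as chains of primitives\<close>

lemma L2_loc_rep:
  assumes "g \<in> L2_loc" "AE x in lborel. g x = g' x" "loc_int g'"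
  shows "set_integrable lborel {a..b} (\<lambda>x. (g' x)\<^sup>2)"
proof -
  have [measurable]: "g' \<in> borel_measurable borel" by (rule loc_intD(1)[OF assms(3)])
  have m': "g' \<in> borel_measurable lebesgue" by (rule measurable_completion) measurable
  have m: "g \<in> borel_measurable lebesgue" using assms by (simp add: L2_loc_def)
  have "set_integrable lebesgue {a..b} (\<lambda>x. (g x)\<^sup>2)" using assms by (simp add: L2_loc_def)
  also have "?this \<longleftrightarrow> set_integrable lebesgue {a..b} (\<lambda>x. (g' x)\<^sup>2)"
    unfolding set_integrable_def
  proof (rule integrable_cong_AE)
    show "AE x in lebesgue. indicat_real {a..b} x *\<^sub>R (g x)\<^sup>2 = indicat_real {a..b} x *\<^sub>R (g' x)\<^sup>2"
      using assms(2) unfolding AE_lebesgue_iff by eventually_elim simp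
  qed (use m m' in measurable)
  also have "... \<longleftrightarrow> set_integrable lborel {a..b} (\<lambda>x. (g' x)\<^sup>2)"
    unfolding set_integrable_def by (rule integrable_completion) measurable
  finally show ?thesis .
qed

text \<open>\<open>H_loc\<close> provides each weak derivative of f separately. Testing the identity
  of order k with \<open>deriv \<phi>\<close> and comparing it with the one of order k + 1 shows
  that consecutive derivatives are weak derivatives of each other, so every one below the top has an
  absolutely continuous representative.\<close>

lemma H_loc_chain:
  assumes f: "f \<in> H_loc m" "continuous_on UNIV f" and m: "m > 0"
  obtains G where "G 0 = f" "\<And>k. k < m \<Longrightarrow> ac (G k) (G (Suc k))"
    "\<And>k. k \<le> m \<Longrightarrow> has_weak_deriv k f (G k)" "\<And>a b. set_integrable lborel {a..b} (\<lambda>x. (G m x)\<^sup>2)"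
proof -
  have lf: "loc_int f" by (rule loc_int_cont[OF f(2)])
  have "\<forall>k. \<exists>g. k \<le> m \<longrightarrow> g \<in> L2_loc \<and> has_weak_deriv k f g"
    using f(1) by (auto simp: H_loc_def)
  then obtain g where g: "\<And>k. k \<le> m \<Longrightarrow> g k \<in> L2_loc" "\<And>k. k \<le> m \<Longrightarrow> has_weak_deriv k f (g k)" by metis
  have "\<forall>k. \<exists>g'. k \<le> m \<longrightarrow> loc_int g' \<and> (AE x in lborel. g k x = g' x)"
    using g(2) L1_loc_rep unfolding has_weak_deriv_def by metis
  then obtain g' where g': "\<And>k. k \<le> m \<Longrightarrow> loc_int (g' k)" "\<And>k. k \<le> m \<Longrightarrow> AE x in lborel. g k x = g' k x" by metis
  have wd: "has_weak_deriv k f (g' k)" if "k \<le> m" for k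
    by (rule has_weak_deriv_AE[OF g(2)]) (use that g' lf in auto)
  have wd1: "has_weak_deriv 1 (g' k) (g' (Suc k))" if k: "k < m" for k
  proof -
    have l: "loc_int (g' k)" "loc_int (g' (Suc k))" using g' k by auto
    show ?thesis
      unfolding has_weak_deriv_loc_int[OF l]
    proof (intro allI impI)
      fix \<phi> assume t: "test_function_on UNIV \<phi>"
      have "(-1) ^ k * (LINT x|lborel. g' k x * deriv \<phi> x) = (LINT x|lborel. f x * (deriv ^^ k) (deriv \<phi>) x)"
        using wd[of k] k test_function_deriv[OF t] unfolding has_weak_deriv_loc_int[OF lf l(1)] by auto
      also have "... = (LINT x|lborel. f x * (deriv ^^ Suc k) \<phi> x)"
        by (simp only: funpow_Suc_right comp_apply)
      also have "... = (-1) ^ Suc k * (LINT x|lborel. g' (Suc k) x * \<phi> x)"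
        using wd[of "Suc k"] k t unfolding has_weak_deriv_loc_int[OF lf l(2)] by auto
      finally show "(LINT x|lborel. g' k x * (deriv ^^ 1) \<phi> x) = (-1) ^ 1 * (LINT x|lborel. g' (Suc k) x * \<phi> x)"
        by (cases "even k") auto
    qed
  qed
  have "\<forall>k. \<exists>F. k < m \<longrightarrow> ac F (g' (Suc k)) \<and> (AE x in lborel. g' k x = F x)"
    using weak_deriv_1_ac[OF g'(1) g'(1) wd1] by (metis Suc_leI less_imp_le_nat)
  then obtain F where F: "\<And>k. k < m \<Longrightarrow> ac (F k) (g' (Suc k))" "\<And>k. k < m \<Longrightarrow> AE x in lborel. g' k x = F k x"
    by metis
  \<comment> \<open>Below order m the primitive is chosen; at order m a mere Borel representative
    remains.\<close>
  define G where "G k = (if k < m then F k else g' k)" for k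
  have lG: "loc_int (G k)" if "k \<le> m" for k
    using that F(1)[of k] g'(1)[of k] ac_continuous loc_int_cont by (cases "k < m") (auto simp: G_def)
  have aeG: "AE x in lborel. g' k x = G k x" if "k \<le> m" for k
    using that F(2)[of k] by (cases "k < m") (auto simp: G_def)
  have wdG: "has_weak_deriv k f (G k)" if "k \<le> m" for k
    by (rule has_weak_deriv_AE[OF wd]) (use that aeG lG lf in auto)
  show ?thesis
  proof (rule that)
    show "G 0 = f"
    proof (rule continuous_AE_eq)
      show "continuous_on UNIV (G 0)" using F(1)[of 0] m ac_continuous by (auto simp: G_def)
      show "AE x in lborel. G 0 x = f x"
        using has_weak_deriv_unique[OF wdG[of 0] has_weak_deriv_0[OF lf]] by simp
    qed (rule f)
    show "ac (G k) (G (Suc k))" if "k < m" for k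
      using ac_AE_cong[OF F(1)[OF that] aeG[of "Suc k"] lG[of "Suc k"]] that by (simp add: G_def)
    show "has_weak_deriv k f (G k)" if "k \<le> m" for k by (rule wdG[OF that])
    show "set_integrable lborel {a..b} (\<lambda>x. (G m x)\<^sup>2)" for a b
      using L2_loc_rep[OF g(1)[of m] g'(2)[of m] g'(1)[of m]] by (simp add: G_def)
  qed
qed

text \<open>Periodicity climbs the chain, since the shifted function has the shifted density and
  densities are unique almost everywhere; below the top, continuity turns this into exact
  periodicity.\<close>

lemma H_per_chain:
  assumes f: "f \<in> H_per m" "continuous_on UNIV f" and m: "m > 0"
  obtains G where "G 0 = f" "\<And>k. k < m \<Longrightarrow> ac (G k) (G (Suc k))"
    "\<And>k. k \<le> m \<Longrightarrow> has_weak_deriv k f (G k)" "\<And>a b. set_integrable lborel {a..b} (\<lambda>x. (G m x)\<^sup>2)"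
    "\<And>k x. k \<le> m \<Longrightarrow> G k (x + 1) = G k x"
proof -
  obtain G where G: "G 0 = f" "\<And>k. k < m \<Longrightarrow> ac (G k) (G (Suc k))"
    "\<And>k. k \<le> m \<Longrightarrow> has_weak_deriv k f (G k)" "\<And>a b. set_integrable lborel {a..b} (\<lambda>x. (G m x)\<^sup>2)"
    using H_loc_chain[of f m] f m by (auto simp: H_per_def)
  have cs: "continuous_on UNIV (\<lambda>x. g (x + 1))" if "continuous_on UNIV g" for g :: "real \<Rightarrow> real"
    by (rule continuous_on_compose2[OF that]) (auto intro!: continuous_intros)
  have per: "k < m \<Longrightarrow> G k (x + 1) = G k x" for k x
  proof (induction k arbitrary: x)
    case 0
    have "(\<lambda>x. f (x + 1)) = f"
      by (rule continuous_AE_eq[OF cs[OF f(2)] f(2)]) (use f in \<open>simp add: H_per_def AE_lebesgue_iff\<close>)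
    then show ?case using G(1) by metis
  next
    case (Suc k)
    have c: "continuous_on UNIV (G (Suc k))" by (rule ac_continuous[OF G(2)[OF Suc.prems]])
    have "(\<lambda>x. G (Suc k) (x + 1)) = G (Suc k)"
      by (rule continuous_AE_eq[OF cs[OF c] c]) (rule ac_periodic[OF G(2)], use Suc in auto)
    then show ?case by metis
  qed
  obtain j where j: "m = Suc j" using m gr0_implies_Suc by blast
  have "AE x in lborel. G m (x + 1) = G m x"
    using ac_periodic[OF G(2)[of j]] per[of j] j by simp
  moreover have lm: "loc_int (G m)" using acD(1)[OF G(2)[of j]] j by simp
  ultimately obtain g where g: "loc_int g" "\<And>x. g (x + 1) = g x" "AE x in lborel. G m x = g x"
    using AE_periodic_rep by blast
  \<comment> \<open>The top derivative is periodic only almost everywhere and is exchanged for an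
    exactly periodic representative.\<close>
  define H where "H = G(m := g)"
  show ?thesis
  proof (rule that)
    show "H 0 = f" using G(1) m by (simp add: H_def)
    show "ac (H k) (H (Suc k))" if "k < m" for k
      using G(2)[OF that] ac_AE_cong[OF G(2)[of j] _ g(1)] g(3) j that
      by (cases "Suc k = m") (auto simp: H_def)
    show "has_weak_deriv k f (H k)" if "k \<le> m" for k
      using G(3)[OF that] has_weak_deriv_AE[OF G(3)[of m] _ g(3) loc_int_cont[OF f(2)] g(1)]
      by (auto simp: H_def)
    show "set_integrable lborel {a..b} (\<lambda>x. (H m x)\<^sup>2)" for a b
    proof -
      have [measurable]: "g \<in> borel_measurable borel" "G m \<in> borel_measurable borel"
        using loc_intD(1) g(1) lm by blast+
      show ?thesis
        using G(4)[of a b] unfolding set_integrable_def H_def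
        by (rule integrable_cong_AE[THEN iffD1, rotated -1]) (use g(3) in auto)
    qed
    show "H k (x + 1) = H k x" if "k \<le> m" for k x
      using per[of k x] g(2) that by (auto simp: H_def)
  qed
qed

section \<open>Square integrable periodic functions\<close>

text \<open>Lebesgue measure of the unit interval, kept as a probability measure on the whole line:
  functions need no restriction, shifts act on them through periodicity, and Jensen's inequality has
  constant one.\<close>

definition circle :: "real measure" where
  "circle = density lborel (\<lambda>x. ennreal (indicator {0..1} x))"

lemma sets_circle [simp, measurable_cong]: "sets circle = sets borel" and space_circle [simp]: "space circle = UNIV"
  by (simp_all add: circle_def)

lemma integrable_circle_iff: "f \<in> borel_measurable borel \<Longrightarrow> integrable circle f \<longleftrightarrow> set_integrable lborel {0..1} f" for f :: "real \<Rightarrow> real"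
  unfolding circle_def set_integrable_def by (subst integrable_density) auto

lemma integral_circle: "f \<in> borel_measurable borel \<Longrightarrow> (LINT x|circle. f x) = (LINT x:{0..1}|lborel. f x)" for f :: "real \<Rightarrow> real"
  unfolding circle_def set_lebesgue_integral_def by (subst integral_density) auto

lemma AE_circle: "(AE x in circle. P x) \<longleftrightarrow> (AE x in lborel. x \<in> {0..1} \<longrightarrow> P x)"
  unfolding circle_def by (subst AE_density) (auto simp: indicator_def)

lemma AE_lborel_circle: "AE x in lborel. P x \<Longrightarrow> AE x in circle. P x"
  unfolding AE_circle by (rule eventually_mono) auto

lemma prob_space_circle: "prob_space circle"
proof
  have "emeasure circle UNIV = (\<integral>\<^sup>+ x. ennreal (indicator {0..1::real} x) * indicator UNIV x \<partial>lborel)"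
    unfolding circle_def by (subst emeasure_density) auto
  also have "... = (\<integral>\<^sup>+ x. indicator {0..1::real} x \<partial>lborel)"
    by (rule nn_integral_cong) (simp add: indicator_def)
  also have "... = emeasure lborel {0..1::real}" by (rule nn_integral_indicator) simp
  finally show "emeasure circle (space circle) = 1" by simp
qed

interpretation circle: prob_space circle by (rule prob_space_circle)
interpretation circle2: pair_sigma_finite circle circle ..

lemma measure_circle_UNIV [simp]: "measure circle UNIV = 1"
  using circle.prob_space by simp

lemma borel_measurable_circle: "f \<in> borel_measurable borel \<Longrightarrow> f \<in> borel_measurable circle"
  by (simp add: measurable_cong_sets[OF sets_circle refl])

lemma nn_integral_circle: "f \<in> borel_measurable borel \<Longrightarrow> (\<integral>\<^sup>+ x. f x \<partial>circle) = (\<integral>\<^sup>+ x. f x * indicator {0..<1} x \<partial>lborel)"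
proof -
  assume [measurable]: "f \<in> borel_measurable borel"
  have "(\<integral>\<^sup>+ x. f x \<partial>circle) = (\<integral>\<^sup>+ x. ennreal (indicator {0..1} x) * f x \<partial>lborel)"
    unfolding circle_def by (subst nn_integral_density) auto
  also have "... = (\<integral>\<^sup>+ x. f x * indicator {0..<1} x \<partial>lborel)"
    by (rule nn_integral_cong_AE) (use AE_lborel_singleton[of 1] in eventually_elim, auto simp: indicator_def)
  finally show ?thesis .
qed

text \<open>With r = \<open>frac s\<close> the rotation translates [0, 1 - r) to [r, 1) and [1 - r,
  1) to [0, r); each piece is handled by translation invariance of \<open>lborel\<close>.\<close>

lemma distr_circle_rotate: "distr circle borel (\<lambda>x. frac (x + s)) = circle"
proof (rule measure_eqI)
  have fm [measurable]: "frac \<in> borel_measurable (borel :: real measure)"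
    unfolding frac_def by measurable
  fix A :: "real set" assume "A \<in> sets (distr circle borel (\<lambda>x. frac (x + s)))"
  then have [measurable]: "A \<in> sets borel" by simp
  define r where "r = frac s"
  have r: "0 \<le> r" "r < 1" by (auto simp: r_def frac_lt_1)
  have fr: "frac (x + s) = (if x < 1 - r then x + r else x + r - 1)" if "x \<in> {0..<1}" for x
  proof -
    have "x + r = (x + s) - of_int \<lfloor>s\<rfloor>" by (simp add: r_def frac_def)
    then have "frac (x + s) = frac (x + r)" by (simp only: frac_def floor_diff_of_int)
    moreover have "frac (x + r) = x + r" if "x < 1 - r"
      using that \<open>x \<in> {0..<1}\<close> r by (simp add: frac_eq)
    moreover have "frac (x + r) = x + r - 1" if "\<not> x < 1 - r"
      using that \<open>x \<in> {0..<1}\<close> r by (subst frac_unique_iff) auto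
    ultimately show ?thesis by simp
  qed
  let ?I = "\<lambda>B. \<lambda>x. indicator B x :: ennreal"
  have "emeasure (distr circle borel (\<lambda>x. frac (x + s))) A = (\<integral>\<^sup>+ x. ?I A (frac (x + s)) \<partial>circle)"
    by (subst nn_integral_indicator[symmetric], simp, subst nn_integral_distr) auto
  also have "... = (\<integral>\<^sup>+ x. ?I A (frac (x + s)) * ?I {0..<1} x \<partial>lborel)"
    by (rule nn_integral_circle) measurable
  also have "... = (\<integral>\<^sup>+ x. (?I (A \<inter> {r..<1}) (r + 1 * x) + ?I (A \<inter> {0..<r}) ((r - 1) + 1 * x)) \<partial>lborel)"
    by (rule nn_integral_cong) (use r in \<open>auto simp: indicator_def fr add.commute[of r] diff_add_eq split: if_splits\<close>)
  also have "... = (\<integral>\<^sup>+ x. ?I (A \<inter> {r..<1}) (r + 1 * x) \<partial>lborel) + (\<integral>\<^sup>+ x. ?I (A \<inter> {0..<r}) ((r - 1) + 1 * x) \<partial>lborel)"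
    by (rule nn_integral_add) measurable
  also have "... = (\<integral>\<^sup>+ x. ?I (A \<inter> {r..<1}) x \<partial>lborel) + (\<integral>\<^sup>+ x. ?I (A \<inter> {0..<r}) x \<partial>lborel)"
    by (subst (3 4) nn_integral_real_affine[where c=1]) auto
  also have "... = (\<integral>\<^sup>+ x. (?I (A \<inter> {r..<1}) x + ?I (A \<inter> {0..<r}) x) \<partial>lborel)"
    by (rule nn_integral_add[symmetric]) measurable
  also have "... = (\<integral>\<^sup>+ x. ?I A x * ?I {0..<1} x \<partial>lborel)"
    by (rule nn_integral_cong) (use r in \<open>auto simp: indicator_def\<close>)
  also have "... = (\<integral>\<^sup>+ x. ?I A x \<partial>circle)"
    by (rule nn_integral_circle[symmetric]) measurable
  also have "... = emeasure circle A" by simp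
  finally show "emeasure (distr circle borel (\<lambda>x. frac (x + s))) A = emeasure circle A" .
qed simp

lemma distr_circle_reflect: "distr circle borel (\<lambda>x. 1 - x) = circle"
proof (rule measure_eqI)
  fix A :: "real set" assume "A \<in> sets (distr circle borel (\<lambda>x. 1 - x))"
  then have [measurable]: "A \<in> sets borel" by simp
  let ?f = "\<lambda>x. ennreal (indicator {0..1::real} x) * indicator A x"
  have "emeasure (distr circle borel (\<lambda>x. 1 - x)) A = (\<integral>\<^sup>+ x. indicator A (1 - x) \<partial>circle)"
    by (subst nn_integral_indicator[symmetric], simp, subst nn_integral_distr) auto
  also have "... = (\<integral>\<^sup>+ x. ennreal (indicator {0..1} x) * indicator A (1 - x) \<partial>lborel)"
    unfolding circle_def by (subst nn_integral_density) auto
  also have "... = (\<integral>\<^sup>+ x. ?f (1 + (-1) * x) \<partial>lborel)"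
    by (rule nn_integral_cong) (auto simp: indicator_def)
  also have "... = (\<integral>\<^sup>+ x. ?f x \<partial>lborel)"
    by (subst (2) nn_integral_real_affine[where c="-1" and t=1]) auto
  also have "... = (\<integral>\<^sup>+ x. indicator A x \<partial>circle)"
    unfolding circle_def by (subst nn_integral_density) auto
  also have "... = emeasure circle A" by simp
  finally show "emeasure (distr circle borel (\<lambda>x. 1 - x)) A = emeasure circle A" .
qed simp

lemma integral_circle_reflect: "f \<in> borel_measurable borel \<Longrightarrow> (LINT x|circle. f (1 - x)) = (LINT x|circle. (f x :: real))"
  by (subst (2) distr_circle_reflect[symmetric], subst integral_distr) auto

definition per :: "(real \<Rightarrow> real) \<Rightarrow> bool" where
  "per f \<longleftrightarrow> f \<in> borel_measurable borel \<and> (\<forall>x. f (x + 1) = f x)"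

lemma per_measurable: "per f \<Longrightarrow> f \<in> borel_measurable borel" by (simp add: per_def)

lemma per_int: assumes "per f" shows "f (x + of_int k) = f x"
proof -
  have n: "f (x + real n) = f x" for n x
  proof (induction n)
    case (Suc n)
    have "f (x + real (Suc n)) = f ((x + real n) + 1)" by (simp add: algebra_simps)
    then show ?case using assms Suc by (simp add: per_def)
  qed simp
  show ?thesis
  proof (cases "k \<ge> 0")
    case True then show ?thesis using n[of x "nat k"] by simp
  next
    case False then show ?thesis using n[of "x + of_int k" "nat (-k)"] by simp
  qed
qed

lemma per_frac: "per f \<Longrightarrow> f (frac x) = f x"
  using per_int[of f x "- \<lfloor>x\<rfloor>"] by (simp add: frac_def)

lemma frac_borel [measurable]: "frac \<in> borel_measurable (borel :: real measure)"
  unfolding frac_def by measurable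

lemma per_shift_integrable:
  assumes "per f" shows "integrable circle (\<lambda>x. f (x + s)) \<longleftrightarrow> integrable circle f"
proof -
  have [measurable]: "f \<in> borel_measurable borel" by (rule per_measurable[OF assms])
  have "integrable circle f \<longleftrightarrow> integrable (distr circle borel (\<lambda>x. frac (x + s))) f" by (simp add: distr_circle_rotate)
  also have "... \<longleftrightarrow> integrable circle (\<lambda>x. f (frac (x + s)))" by (rule integrable_distr_eq) auto
  finally show ?thesis by (simp add: per_frac[OF assms])
qed

lemma per_shift_integral:
  assumes "per f" shows "(LINT x|circle. f (x + s)) = (LINT x|circle. f x)"
proof -
  have [measurable]: "f \<in> borel_measurable borel" by (rule per_measurable[OF assms])
  have "(LINT x|circle. f x) = integral\<^sup>L (distr circle borel (\<lambda>x. frac (x + s))) f" by (simp add: distr_circle_rotate)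
  also have "... = (LINT x|circle. f (frac (x + s)))" by (rule integral_distr) auto
  finally show ?thesis by (simp add: per_frac[OF assms])
qed

lemma per_shift: "per f \<Longrightarrow> per (\<lambda>x. f (x + s))"
  unfolding per_def by (auto simp: algebra_simps) (metis add.commute add.left_commute)

lemma per_loc_int:
  assumes "per f" "integrable circle f" shows "loc_int f"
proof -
  have [measurable]: "f \<in> borel_measurable borel" by (rule per_measurable[OF assms(1)])
  have unit: "set_integrable lborel {s..s+1} f" for s
  proof -
    have "integrable lborel (\<lambda>x. indicator {0..1} x *\<^sub>R f (x + s))"
      using per_shift_integrable[OF assms(1), of s] assms(2) by (subst (asm) integrable_circle_iff) (auto simp: set_integrable_def integrable_circle_iff)
    note a = lborel_integrable_real_affine[OF this, of 1 "-s", OF one_neq_zero]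
    have "(\<lambda>x. indicat_real {s..s + 1} x *\<^sub>R f x) =
        (\<lambda>x. indicat_real {0..1} (- s + 1 * x) *\<^sub>R f (- s + 1 * x + s))"
      by (rule ext) (auto simp: indicator_def)
    with a show ?thesis unfolding set_integrable_def by (simp only:)
  qed
  have n: "set_integrable lborel {a..a + real n} f" for a n
  proof (induction n)
    case 0
    show ?case by (rule set_integrable_subset[OF unit[of a]]) auto
  next
    case (Suc n)
    have "{a..a + real (Suc n)} = {a..a + real n} \<union> {a + real n..a + real n + 1}" by auto
    then show ?case using set_integrable_Un[OF Suc unit] by simp
  qed
  have "set_integrable lborel {a..b} f" for a b
  proof -
    obtain m :: nat where "b - a \<le> real m" using real_arch_simple by blast
    then show ?thesis by (intro set_integrable_subset[OF n[of a m]]) auto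
  qed
  then show ?thesis by (auto simp: loc_int_def)
qed

definition L2p :: "(real \<Rightarrow> real) \<Rightarrow> bool" where
  "L2p f \<longleftrightarrow> per f \<and> integrable circle (\<lambda>x. (f x)\<^sup>2)"

lemma L2p_per: "L2p f \<Longrightarrow> per f" by (simp add: L2p_def)

lemma L2p_measurable: "L2p f \<Longrightarrow> f \<in> borel_measurable borel" by (simp add: L2p_def per_def)

lemma L2p_sq: "L2p f \<Longrightarrow> integrable circle (\<lambda>x. (f x)\<^sup>2)" by (simp add: L2p_def)

lemma young: "\<bar>a * b\<bar> \<le> (a\<^sup>2 + b\<^sup>2) / (2::real)"
  using sum_squares_bound[of "\<bar>a\<bar>" "\<bar>b\<bar>"] by (simp add: abs_mult)

lemma integrable_mult_sq:
  fixes f g :: "'a \<Rightarrow> real"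
  assumes [measurable]: "f \<in> borel_measurable M" "g \<in> borel_measurable M"
    and "integrable M (\<lambda>x. (f x)\<^sup>2)" "integrable M (\<lambda>x. (g x)\<^sup>2)"
  shows "integrable M (\<lambda>x. f x * g x)"
proof (rule Bochner_Integration.integrable_bound)
  show "integrable M (\<lambda>x. ((f x)\<^sup>2 + (g x)\<^sup>2) / 2)" using assms by auto
  show "AE x in M. norm (f x * g x) \<le> norm (((f x)\<^sup>2 + (g x)\<^sup>2) / 2)"
    using young by (intro AE_I2) simp
qed measurable

lemma L2p_mult: "L2p f \<Longrightarrow> L2p g \<Longrightarrow> integrable circle (\<lambda>x. f x * g x)"
  by (rule integrable_mult_sq) (auto intro: L2p_sq L2p_measurable borel_measurable_circle)

lemma per_const: "per (\<lambda>x. c)" by (simp add: per_def)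

lemma L2p_const: "L2p (\<lambda>x. c)" by (simp add: L2p_def per_const)

lemma L2p_integrable: "L2p f \<Longrightarrow> integrable circle f"
  using L2p_mult[OF L2p_const[of 1]] by simp

lemma L2p_loc_int: "L2p f \<Longrightarrow> loc_int f"
  by (rule per_loc_int) (auto intro: L2p_per L2p_integrable)

lemma L2p_loc_int_sq: "L2p f \<Longrightarrow> loc_int (\<lambda>x. (f x)\<^sup>2)"
  by (rule per_loc_int) (auto simp: L2p_def per_def)

lemma L2p_add: "L2p f \<Longrightarrow> L2p g \<Longrightarrow> L2p (\<lambda>x. f x + g x)"
  using L2p_mult[of f g] unfolding L2p_def per_def by (auto simp: power2_sum mult.assoc)

lemma L2p_cmult: "L2p f \<Longrightarrow> L2p (\<lambda>x. c * f x)"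
  unfolding L2p_def per_def by (auto simp: power_mult_distrib)

lemma L2p_diff: "L2p f \<Longrightarrow> L2p g \<Longrightarrow> L2p (\<lambda>x. f x - g x)"
  using L2p_add[OF _ L2p_cmult[of g "-1"], of f] by simp

lemma L2p_shift: "L2p f \<Longrightarrow> L2p (\<lambda>x. f (x + s))"
  using per_shift[of f s] per_shift_integrable[of "\<lambda>x. (f x)\<^sup>2" s] unfolding L2p_def by (auto simp: per_def)

lemma L2p_bounded:
  assumes "per f" "\<And>x. \<bar>f x\<bar> \<le> B" shows "L2p f"
proof -
  have [measurable]: "f \<in> borel_measurable borel" using assms(1) by (rule per_measurable)
  have "(f x)\<^sup>2 \<le> B\<^sup>2" for x using assms(2)[of x] by (simp add: abs_le_square_iff[symmetric])
  then have "integrable circle (\<lambda>x. (f x)\<^sup>2)" by (intro circle.integrable_const_bound[where B="B\<^sup>2"]) auto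
  then show ?thesis using assms by (simp add: L2p_def)
qed

lemma per_continuous_bounded:
  assumes "per f" "continuous_on UNIV f"
  obtains B where "\<And>x. \<bar>f x\<bar> \<le> B"
proof -
  have "compact (f ` {0..1})"
    using assms(2) by (meson compact_Icc compact_continuous_image continuous_on_subset top_greatest)
  then obtain B where B: "\<And>x. x \<in> {0..1} \<Longrightarrow> norm (f x) \<le> B"
    by (meson bounded_iff compact_imp_bounded imageI)
  have "\<bar>f x\<bar> \<le> B" for x
    using B[of "frac x"] frac_lt_1[of x] by (simp add: per_frac[OF assms(1)] less_imp_le)
  then show ?thesis using that by blast
qed

lemma L2p_continuous: "per f \<Longrightarrow> continuous_on UNIV f \<Longrightarrow> L2p f"
  by (metis per_continuous_bounded L2p_bounded)

lemma L2p_cont_mult: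
  assumes "L2p f" "per c" "continuous_on UNIV c" shows "L2p (\<lambda>x. c x * f x)"
proof -
  obtain B where B: "\<And>x. \<bar>c x\<bar> \<le> B" using per_continuous_bounded assms by blast
  have [measurable]: "f \<in> borel_measurable borel" "c \<in> borel_measurable borel"
    using assms per_measurable L2p_measurable by auto
  have "integrable circle (\<lambda>x. (c x * f x)\<^sup>2)"
  proof (rule Bochner_Integration.integrable_bound)
    show "integrable circle (\<lambda>x. B\<^sup>2 * (f x)\<^sup>2)" using assms L2p_sq by simp
    have "(c x)\<^sup>2 \<le> B\<^sup>2" for x using B[of x] by (simp add: abs_le_square_iff[symmetric])
    then show "AE x in circle. norm ((c x * f x)\<^sup>2) \<le> norm (B\<^sup>2 * (f x)\<^sup>2)"
      by (intro AE_I2) (simp add: power_mult_distrib mult_right_mono)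
  qed measurable
  then show ?thesis using assms by (auto simp: L2p_def per_def)
qed

text \<open>For d > 0 this is the mean of f over [x, x + d]. As an integral over the scaled variable
  s it can be exchanged by Fubini with an integral over x, where shifts are harmless.\<close>

definition avg :: "real \<Rightarrow> (real \<Rightarrow> real) \<Rightarrow> real \<Rightarrow> real" where
  "avg d f x = (LINT s|circle. f (x + d * s))"

definition dq :: "real \<Rightarrow> (real \<Rightarrow> real) \<Rightarrow> real \<Rightarrow> real" where
  "dq d f x = (f (x + d) - f x) / d"

lemma loc_int_affine:
  assumes "loc_int f" "d > 0"
  shows "integrable circle (\<lambda>s. f (x + d * s))" "(LINT s|circle. f (x + d * s)) = integral {x..x+d} f / d"
proof -
  have [measurable]: "f \<in> borel_measurable borel" by (rule loc_intD[OF assms(1)])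
  have eq: "indicat_real {0..1} s *\<^sub>R f (x + d * s) = indicat_real {x..x+d} (x + d * s) *\<^sub>R f (x + d * s)" for s
    using assms(2) by (auto simp: indicator_def mult_le_cancel_left1 zero_le_mult_iff)
  have i: "integrable lborel (\<lambda>s. indicat_real {x..x+d} s *\<^sub>R f s)"
    using loc_intD(2)[OF assms(1)] by (simp add: set_integrable_def)
  show "integrable circle (\<lambda>s. f (x + d * s))"
    using lborel_integrable_real_affine[OF i, of d x] assms(2)
    by (subst integrable_circle_iff) (simp_all only: set_integrable_def eq, simp_all)
  have "(LINT s|circle. f (x + d * s)) = (LINT s|lborel. indicat_real {x..x+d} (x + d * s) *\<^sub>R f (x + d * s))"
    by (subst integral_circle) (simp_all only: set_lebesgue_integral_def eq, simp_all)
  also have "... = (LINT s:{x..x+d}|lborel. f s) / d"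
    unfolding set_lebesgue_integral_def using assms(2)
    by (subst lborel_integral_real_affine[of d _ x]) auto
  finally show "(LINT s|circle. f (x + d * s)) = integral {x..x+d} f / d"
    by (simp add: loc_int_HK(2)[OF assms(1)])
qed

text \<open>Link between the two discretisations: difference quotients of a primitive are means of
  its density, so they inherit L2 bounds and limits.\<close>

lemma dq_ac: "ac F f \<Longrightarrow> d > 0 \<Longrightarrow> dq d F x = avg d f x"
  unfolding dq_def avg_def by (simp add: loc_int_affine acD)

lemma circle_jensen:
  fixes f :: "real \<Rightarrow> real"
  assumes [measurable]: "f \<in> borel_measurable circle" and i: "integrable circle f" "integrable circle (\<lambda>x. (f x)\<^sup>2)"
  shows "(LINT x|circle. f x)\<^sup>2 \<le> (LINT x|circle. (f x)\<^sup>2)"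
proof -
  let ?c = "LINT x|circle. f x"
  have "0 \<le> (LINT x|circle. (f x - ?c)\<^sup>2)" by (rule Bochner_Integration.integral_nonneg) simp
  also have "(\<lambda>x. (f x - ?c)\<^sup>2) = (\<lambda>x. (f x)\<^sup>2 - 2 * ?c * f x + ?c\<^sup>2)"
    by (auto simp: power2_diff algebra_simps)
  also have "(LINT x|circle. (f x)\<^sup>2 - 2 * ?c * f x + ?c\<^sup>2) = (LINT x|circle. (f x)\<^sup>2) - 2 * ?c * ?c + ?c\<^sup>2"
    using i by (simp add: circle.prob_space)
  finally show ?thesis by (simp add: power2_eq_square)
qed

lemma avg_jensen: "L2p f \<Longrightarrow> d > 0 \<Longrightarrow> (avg d f x)\<^sup>2 \<le> avg d (\<lambda>x. (f x)\<^sup>2) x"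
  unfolding avg_def using L2p_measurable[of f]
  by (intro circle_jensen loc_int_affine L2p_loc_int L2p_loc_int_sq) auto

lemma avg_measurable:
  assumes [measurable]: "f \<in> borel_measurable borel"
  shows "avg d f \<in> borel_measurable borel"
  unfolding avg_def by measurable

lemma per_mult: "per f \<Longrightarrow> per g \<Longrightarrow> per (\<lambda>x. f x * g x)"
  by (auto simp: per_def)

lemma per_add: "per f \<Longrightarrow> per g \<Longrightarrow> per (\<lambda>x. f x + g x)"
  by (auto simp: per_def)

lemma per_square: "per f \<Longrightarrow> per (\<lambda>x. (f x)\<^sup>2)"
  by (auto simp: per_def)

lemma avg_per: "per f \<Longrightarrow> per (avg d f)"
  using avg_measurable[of f d] unfolding per_def avg_def
  by (auto simp: add.assoc) (metis add.assoc add.commute)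

text \<open>For fixed s the inner integral over x does not depend on s, by periodicity.
  Integrability on the product is therefore checked with s as the outer variable and swapped
  afterwards.\<close>

lemma integrable_UU_shift:
  assumes "per g" "integrable circle g"
  shows "integrable (circle \<Otimes>\<^sub>M circle) (\<lambda>(x, s). g (x + d * s))"
    "integrable circle (\<lambda>x. LINT s|circle. g (x + d * s))" "(LINT x|circle. LINT s|circle. g (x + d * s)) = (LINT x|circle. g x)"
proof -
  have [measurable]: "g \<in> borel_measurable borel" by (rule per_measurable[OF assms(1)])
  have pa: "per (\<lambda>x. \<bar>g x\<bar>)" using assms(1) by (auto simp: per_def)
  have "integrable (circle \<Otimes>\<^sub>M circle) (\<lambda>(s, x). g (x + d * s))"
  proof (rule circle2.Fubini_integrable)
    show "integrable circle (\<lambda>s. LINT x|circle. norm (case (s, x) of (s, x) \<Rightarrow> g (x + d * s)))"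
      using per_shift_integral[OF pa] by simp
    show "AE s in circle. integrable circle (\<lambda>x. case (s, x) of (s, x) \<Rightarrow> g (x + d * s))"
      using per_shift_integrable[OF assms(1)] assms(2) by simp
  qed measurable
  from circle2.integrable_product_swap[OF this]
  show i: "integrable (circle \<Otimes>\<^sub>M circle) (\<lambda>(x, s). g (x + d * s))" by (simp add: case_prod_unfold)
  show "integrable circle (\<lambda>x. LINT s|circle. g (x + d * s))"
    using circle2.integrable_fst'[OF i] by simp
  have "(LINT x|circle. LINT s|circle. g (x + d * s)) = (LINT s|circle. LINT x|circle. g (x + d * s))"
    using circle2.Fubini_integral[OF i] by simp
  then show "(LINT x|circle. LINT s|circle. g (x + d * s)) = (LINT x|circle. g x)"
    by (simp add: per_shift_integral[OF assms(1)] circle.prob_space)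
qed

text \<open>Jensen bounds the square of the mean by the mean of the square, and averaging preserves
  the integral over a period: averaging is a contraction of L2.\<close>

lemma avg_L2:
  assumes f: "L2p f" and d: "d > 0"
  shows "L2p (avg d f)" "(LINT x|circle. (avg d f x)\<^sup>2) \<le> (LINT x|circle. (f x)\<^sup>2)"
proof -
  have p2: "per (\<lambda>x. (f x)\<^sup>2)" by (rule per_square[OF L2p_per[OF f]])
  have [measurable]: "avg d f \<in> borel_measurable borel" by (rule avg_measurable[OF L2p_measurable[OF f]])
  have i2: "integrable circle (avg d (\<lambda>x. (f x)\<^sup>2))"
    unfolding avg_def by (rule integrable_UU_shift[OF p2 L2p_sq[OF f]])
  have i: "integrable circle (\<lambda>x. (avg d f x)\<^sup>2)"
  proof (rule Bochner_Integration.integrable_bound[OF i2])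
    show "AE x in circle. norm ((avg d f x)\<^sup>2) \<le> norm (avg d (\<lambda>x. (f x)\<^sup>2) x)"
      using avg_jensen[OF f d] by (intro AE_I2) (auto intro: order_trans[OF _ abs_ge_self])
  qed measurable
  then show "L2p (avg d f)" using avg_per[OF L2p_per[OF f]] by (simp add: L2p_def)
  have "(LINT x|circle. (avg d f x)\<^sup>2) \<le> (LINT x|circle. avg d (\<lambda>x. (f x)\<^sup>2) x)"
    by (rule integral_mono[OF i i2 avg_jensen[OF f d]])
  also have "... = (LINT x|circle. (f x)\<^sup>2)" unfolding avg_def by (rule integrable_UU_shift[OF p2 L2p_sq[OF f]])
  finally show "(LINT x|circle. (avg d f x)\<^sup>2) \<le> (LINT x|circle. (f x)\<^sup>2)" .
qed

lemma dq_L2: "L2p f \<Longrightarrow> L2p (dq d f)"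
  using L2p_cmult[OF L2p_diff[OF L2p_shift[of f d]], of f "1/d"] unfolding dq_def by (simp add: fun_eq_iff)

lemma avg_diff: "loc_int f \<Longrightarrow> loc_int g \<Longrightarrow> d > 0 \<Longrightarrow> avg d (\<lambda>x. f x - g x) x = avg d f x - avg d g x"
  unfolding avg_def by (intro Bochner_Integration.integral_diff loc_int_affine)

lemma avg_dq:
  assumes "loc_int f" "d > 0" shows "avg d (dq d f) = dq d (avg d f)"
proof
  fix x
  have "avg d (dq d f) x = (LINT s|circle. (f ((x + d) + d * s) - f (x + d * s)) / d)"
    unfolding avg_def dq_def by (simp add: algebra_simps)
  also have "... = dq d (avg d f) x"
    unfolding avg_def dq_def using loc_int_affine(1)[OF assms] by simp
  finally show "avg d (dq d f) x = dq d (avg d f) x" .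
qed

text \<open>Replacing x by x - d s moves the average onto g as a backward mean starting at x + d.
  The reflection s to 1 - s reads it as the forward mean starting at x, which explains the shift on
  the left.\<close>

lemma avg_adjoint:
  assumes f: "L2p f" and g: "L2p g" and d: "d > 0"
  shows "(LINT x|circle. avg d f x * g (x + d)) = (LINT x|circle. f x * avg d g x)"
proof -
  have [measurable]: "f \<in> borel_measurable borel" "g \<in> borel_measurable borel"
    using L2p_measurable f g by auto
  have p2: "per (\<lambda>x. (f x)\<^sup>2)" "per (\<lambda>x. (g x)\<^sup>2)" by (intro per_square L2p_per f g)+
  have sw: "integrable (circle \<Otimes>\<^sub>M circle) (\<lambda>(x, s). (g (x + d))\<^sup>2)"
    using integrable_UU_shift(1)[OF per_shift[OF p2(2), of d] L2p_sq[OF L2p_shift[OF g]], of 0] by simp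
  have i1: "integrable (circle \<Otimes>\<^sub>M circle) (\<lambda>(x, s). f (x + d * s) * g (x + d))"
    using integrable_mult_sq[of "\<lambda>(x, s). f (x + d * s)" "circle \<Otimes>\<^sub>M circle" "\<lambda>(x, s). g (x + d)"]
      integrable_UU_shift(1)[OF p2(1) L2p_sq[OF f], of d] sw by (simp add: case_prod_unfold)
  have sw2: "integrable (circle \<Otimes>\<^sub>M circle) (\<lambda>(x, s). (f x)\<^sup>2)"
    using integrable_UU_shift(1)[OF p2(1) L2p_sq[OF f], of 0] by simp
  have p3: "per (\<lambda>x. (g (x + d))\<^sup>2)" by (rule per_shift[OF p2(2)])
  have i2: "integrable (circle \<Otimes>\<^sub>M circle) (\<lambda>(x, s). f x * g (x + d + (-d) * s))"
    using integrable_mult_sq[of "\<lambda>(x, s). f x" "circle \<Otimes>\<^sub>M circle" "\<lambda>(x, s). g (x + d + (-d) * s)"]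
      integrable_UU_shift(1)[OF p3 L2p_sq[OF L2p_shift[OF g]], of "-d"] sw2
    by (simp add: case_prod_unfold algebra_simps)
  have "(LINT x|circle. avg d f x * g (x + d)) = (LINT x|circle. LINT s|circle. f (x + d * s) * g (x + d))"
    by (simp add: avg_def)
  also have "... = (LINT s|circle. LINT x|circle. f (x + d * s) * g (x + d))"
    using circle2.Fubini_integral[OF i1] by simp
  also have "... = (LINT s|circle. LINT x|circle. f x * g (x + d + (-d) * s))"
  proof (rule Bochner_Integration.integral_cong[OF refl])
    fix s
    have "per (\<lambda>x. f x * g (x + d + (-d) * s))"
      using per_mult[OF L2p_per[OF f] L2p_per[OF L2p_shift[OF g, of "d + (-d) * s"]]] by (simp add: algebra_simps)
    from per_shift_integral[OF this, of "d * s"]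
    show "(LINT x|circle. f (x + d * s) * g (x + d)) = (LINT x|circle. f x * g (x + d + (-d) * s))"
      by (simp add: algebra_simps)
  qed
  also have "... = (LINT x|circle. LINT s|circle. f x * g (x + d + (-d) * s))"
    using circle2.Fubini_integral[OF i2] by simp
  also have "... = (LINT x|circle. f x * (LINT s|circle. g (x + d * (1 - s))))"
    by (simp add: algebra_simps)
  also have "... = (LINT x|circle. f x * avg d g x)"
  proof (rule Bochner_Integration.integral_cong[OF refl])
    fix x
    show "f x * (LINT s|circle. g (x + d * (1 - s))) = f x * avg d g x"
      unfolding avg_def by (subst integral_circle_reflect[of "\<lambda>s. g (x + d * s)"]) auto
  qed
  finally show ?thesis .
qed

lemma dq_adjoint:
  assumes f: "L2p f" and g: "L2p g"
  shows "(LINT x|circle. dq d f x * g (x + d)) = - (LINT x|circle. f x * dq d g x)"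
proof -
  have p: "per (\<lambda>x. f x * g x)" by (intro per_mult L2p_per f g)
  have s: "(LINT x|circle. f (x + d) * g (x + d)) = (LINT x|circle. f x * g x)"
    by (rule per_shift_integral[OF p])
  have i: "integrable circle (\<lambda>x. f (x + d) * g (x + d))" "integrable circle (\<lambda>x. f x * g x)" "integrable circle (\<lambda>x. f x * g (x + d))"
    using L2p_mult L2p_shift f g by blast+
  have "(LINT x|circle. dq d f x * g (x + d)) = (LINT x|circle. (f (x + d) * g (x + d) - f x * g (x + d)) / d)"
    unfolding dq_def by (simp add: left_diff_distrib)
  also have "... = ((LINT x|circle. f (x + d) * g (x + d)) - (LINT x|circle. f x * g (x + d))) / d" using i by simp
  also have "... = - (((LINT x|circle. f x * g (x + d)) - (LINT x|circle. f x * g x)) / d)" by (simp only: s minus_divide_left minus_diff_eq)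
  also have "((LINT x|circle. f x * g (x + d)) - (LINT x|circle. f x * g x)) / d = (LINT x|circle. (f x * g (x + d) - f x * g x) / d)"
    using i by simp
  also have "... = (LINT x|circle. f x * dq d g x)" unfolding dq_def by (simp add: right_diff_distrib)
  finally show ?thesis .
qed

section \<open>Convergence of averages in L2 as the step tends to zero\<close>

definition dl :: "nat \<Rightarrow> real" where "dl n = 1 / real (Suc n)"

lemma dl_pos: "dl n > 0" by (simp add: dl_def)

lemma avg_tendsto_AE:
  assumes f: "loc_int f" shows "AE x in lborel. (\<lambda>n. avg (dl n) f x) \<longlonglongrightarrow> f x"
proof -
  have i: "f integrable_on cbox a b" for a b
    using loc_int_HK(1)[OF f] by auto
  obtain N where N: "negligible N"
    "\<And>x e. \<lbrakk>x \<notin> N; 0 < e\<rbrakk> \<Longrightarrow> \<exists>d>0. \<forall>h. 0 < h \<and> h < d \<longrightarrow>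
         norm(integral (cbox x (x + h *\<^sub>R One)) f /\<^sub>R h ^ DIM(real) - f x) < e"
    using integrable_ccontinuous_explicit[OF i] by blast
  have "(\<lambda>n. avg (dl n) f x) \<longlonglongrightarrow> f x" if nx: "x \<notin> N" for x
  proof (rule LIMSEQ_I)
    fix e :: real assume e: "e > 0"
    obtain d where d: "d > 0" "\<forall>h. 0 < h \<and> h < d \<longrightarrow>
         norm(integral (cbox x (x + h *\<^sub>R One)) f /\<^sub>R h ^ DIM(real) - f x) < e"
      using N(2)[OF nx e] by blast
    obtain n0 where n0: "inverse (real (Suc n0)) < d" using reals_Archimedean d(1) by blast
    have "norm (avg (dl n) f x - f x) < e" if "n \<ge> n0" for n
    proof -
      have "dl n \<le> dl n0" using that by (simp add: dl_def frac_le)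
      then have "dl n < d" using n0 by (simp add: dl_def inverse_eq_divide)
      then show ?thesis
        using d(2)[rule_format, of "dl n"] dl_pos[of n] loc_int_affine(2)[OF f dl_pos[of n]]
        by (simp add: avg_def divide_inverse_commute)
    qed
    then show "\<exists>no. \<forall>n\<ge>no. norm (avg (dl n) f x - f x) < e" by blast
  qed
  moreover have "N \<in> null_sets lebesgue" using N(1) negligible_iff_null_sets by blast
  ultimately have "AE x in lebesgue. (\<lambda>n. avg (dl n) f x) \<longlonglongrightarrow> f x"
    by (intro AE_I'[of N]) auto
  then show ?thesis by (simp add: AE_completion_iff)
qed

lemma L2_triangle3: "(a + b + c)\<^sup>2 \<le> 3 * (a\<^sup>2 + b\<^sup>2 + (c::real)\<^sup>2)"
proof -
  have "3 * (a\<^sup>2 + b\<^sup>2 + c\<^sup>2) - (a + b + c)\<^sup>2 = (a - b)\<^sup>2 + (b - c)\<^sup>2 + (a - c)\<^sup>2"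
    by (simp add: power2_eq_square algebra_simps)
  then show ?thesis by (smt (verit) zero_le_power2)
qed

lemma L2p_triangle3:
  assumes "L2p f" "L2p g" "L2p h"
  shows "(LINT x|circle. (f x + g x + h x)\<^sup>2) \<le> 3 * ((LINT x|circle. (f x)\<^sup>2) + (LINT x|circle. (g x)\<^sup>2) + (LINT x|circle. (h x)\<^sup>2))"
proof -
  have "(LINT x|circle. (f x + g x + h x)\<^sup>2) \<le> (LINT x|circle. 3 * ((f x)\<^sup>2 + (g x)\<^sup>2 + (h x)\<^sup>2))"
    by (rule integral_mono[OF L2p_sq[OF L2p_add[OF L2p_add]] _ L2_triangle3]) (use assms L2p_sq in auto)
  also have "... = 3 * ((LINT x|circle. (f x)\<^sup>2) + (LINT x|circle. (g x)\<^sup>2) + (LINT x|circle. (h x)\<^sup>2))"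
    using assms L2p_sq by simp
  finally show ?thesis .
qed

lemma avg_tendsto_L2_bounded:
  assumes f: "per f" "\<And>x. \<bar>f x\<bar> \<le> B"
  shows "(\<lambda>n. LINT x|circle. (avg (dl n) f x - f x)\<^sup>2) \<longlonglongrightarrow> 0"
proof -
  have L: "L2p f" by (rule L2p_bounded[OF f])
  have [measurable]: "f \<in> borel_measurable borel" by (rule per_measurable[OF f(1)])
  have [measurable]: "avg d f \<in> borel_measurable borel" for d by (rule avg_measurable) measurable
  have ab: "\<bar>avg (dl n) f x\<bar> \<le> B" for n x
  proof -
    have "\<bar>avg (dl n) f x\<bar> \<le> (LINT s|circle. \<bar>f (x + dl n * s)\<bar>)" unfolding avg_def by (rule integral_abs_bound)
    also have "... \<le> (LINT s|circle. B)"
      by (rule integral_mono) (use loc_int_affine(1)[OF L2p_loc_int[OF L] dl_pos] f(2) in auto)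
    finally show ?thesis by (simp add: circle.prob_space)
  qed
  have "(\<lambda>n. LINT x|circle. (avg (dl n) f x - f x)\<^sup>2) \<longlonglongrightarrow> (LINT x|circle. 0)"
  proof (rule integral_dominated_convergence[where w="\<lambda>x. (2 * B)\<^sup>2"])
    show "AE x in circle. (\<lambda>n. (avg (dl n) f x - f x)\<^sup>2) \<longlonglongrightarrow> 0"
      using AE_lborel_circle[OF avg_tendsto_AE[OF L2p_loc_int[OF L]]]
    proof eventually_elim
      case (elim x)
      have "(\<lambda>n. (avg (dl n) f x - f x)\<^sup>2) \<longlonglongrightarrow> (f x - f x)\<^sup>2"
        by (intro tendsto_intros elim)
      then show ?case by simp
    qed
    have "\<bar>avg (dl n) f x - f x\<bar> \<le> 2 * B" for n x using ab[of n x] f(2)[of x] by linarith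
    then have "(avg (dl n) f x - f x)\<^sup>2 \<le> (2 * B)\<^sup>2" for n x
      by (metis abs_ge_zero power2_abs power_mono)
    then show "AE x in circle. norm ((avg (dl n) f x - f x)\<^sup>2) \<le> (2 * B)\<^sup>2" for n by simp
  qed auto
  then show ?thesis by simp
qed

text \<open>Density argument: for truncations of f dominated convergence applies, and the
  contraction property controls the average of the truncation error uniformly in the step.\<close>

lemma avg_tendsto_L2:
  assumes f: "L2p f"
  shows "(\<lambda>n. LINT x|circle. (avg (dl n) f x - f x)\<^sup>2) \<longlonglongrightarrow> 0"
proof (rule LIMSEQ_I)
  fix e :: real assume e: "e > 0"
  define tr where "tr k x = max (- real k) (min (real k) (f x))" for k :: nat and x
  have [measurable]: "f \<in> borel_measurable borel" by (rule L2p_measurable[OF f])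
  have [measurable]: "tr k \<in> borel_measurable borel" for k unfolding tr_def by measurable
  have ptr: "per (tr k)" for k using L2p_per[OF f] by (auto simp: per_def tr_def)
  have btr: "\<bar>tr k x\<bar> \<le> real k" for k x by (auto simp: tr_def)
  have Ltr: "L2p (tr k)" for k by (rule L2p_bounded[OF ptr btr])
  have "(\<lambda>k. LINT x|circle. (f x - tr k x)\<^sup>2) \<longlonglongrightarrow> (LINT x|circle. 0)"
  proof (rule integral_dominated_convergence[where w="\<lambda>x. (f x)\<^sup>2"])
    show "AE x in circle. (\<lambda>k. (f x - tr k x)\<^sup>2) \<longlonglongrightarrow> 0"
    proof (intro AE_I2 tendsto_eventually)
      fix x
      obtain K :: nat where "\<bar>f x\<bar> \<le> real K" using real_arch_simple by blast
      then have "(f x - tr k x)\<^sup>2 = 0" if "k \<ge> K" for k using that by (auto simp: tr_def)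
      then show "\<forall>\<^sub>F k in sequentially. (f x - tr k x)\<^sup>2 = 0" unfolding eventually_sequentially by blast
    qed
    have "\<bar>f x - tr k x\<bar> \<le> \<bar>f x\<bar>" for k x by (auto simp: tr_def)
    then show "AE x in circle. norm ((f x - tr k x)\<^sup>2) \<le> (f x)\<^sup>2" for k
      by (intro AE_I2) (simp add: abs_le_square_iff)
  qed (use L2p_sq[OF f] in auto)
  then obtain k where k: "(LINT x|circle. (f x - tr k x)\<^sup>2) < e / 12"
    using order_tendstoD(2)[of _ 0 sequentially "e/12"] e unfolding eventually_sequentially by fastforce
  obtain n0 where n0: "\<And>n. n \<ge> n0 \<Longrightarrow> (LINT x|circle. (avg (dl n) (tr k) x - tr k x)\<^sup>2) < e / 12"
    using order_tendstoD(2)[OF avg_tendsto_L2_bounded[OF ptr btr], of "e/12" k] e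
    unfolding eventually_sequentially by auto
  have "norm ((LINT x|circle. (avg (dl n) f x - f x)\<^sup>2) - 0) < e" if "n \<ge> n0" for n
  proof -
    let ?g = "\<lambda>x. f x - tr k x"
    have g: "L2p ?g" by (rule L2p_diff[OF f Ltr])
    have eq: "avg (dl n) f x - f x = avg (dl n) ?g x + (avg (dl n) (tr k) x - tr k x) + (-1) * ?g x" for x
      using avg_diff[OF L2p_loc_int[OF f] L2p_loc_int[OF Ltr] dl_pos, of n k x] by simp
    have "(LINT x|circle. (avg (dl n) f x - f x)\<^sup>2) \<le> 3 * ((LINT x|circle. (avg (dl n) ?g x)\<^sup>2)
        + (LINT x|circle. (avg (dl n) (tr k) x - tr k x)\<^sup>2) + (LINT x|circle. ((-1) * ?g x)\<^sup>2))"
      unfolding eq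
      by (intro L2p_triangle3 avg_L2 dl_pos g L2p_diff L2p_cmult Ltr)
    also have "... < e"
    proof -
      have "((-1) * ?g x)\<^sup>2 = (?g x)\<^sup>2" for x by (simp only: power_mult_distrib) simp
      then have eq2: "(LINT x|circle. ((-1) * ?g x)\<^sup>2) = (LINT x|circle. (?g x)\<^sup>2)" by (simp only:)
      have "3 * (A + B + C) < e" if "A \<le> C" "C < e / 12" "B < e / 12" for A B C
        using that e by (simp add: field_simps)
      from this[OF avg_L2(2)[OF g dl_pos, of n] k n0[OF \<open>n \<ge> n0\<close>]]
      show ?thesis unfolding eq2 .
    qed
    finally show ?thesis by simp
  qed
  then show "\<exists>no. \<forall>n\<ge>no. norm ((LINT x|circle. (avg (dl n) f x - f x)\<^sup>2) - 0) < e" by blast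
qed

section \<open>Estimates at a fixed time\<close>

lemma Cauchy_Schwarz_integral:
  fixes f g :: "'a \<Rightarrow> real"
  assumes [measurable]: "f \<in> borel_measurable M" "g \<in> borel_measurable M"
    and i: "integrable M (\<lambda>x. (f x)\<^sup>2)" "integrable M (\<lambda>x. (g x)\<^sup>2)"
  shows "(LINT x|M. f x * g x)\<^sup>2 \<le> (LINT x|M. (f x)\<^sup>2) * (LINT x|M. (g x)\<^sup>2)"
proof -
  let ?F = "LINT x|M. (f x)\<^sup>2" and ?G = "LINT x|M. (g x)\<^sup>2" and ?I = "LINT x|M. f x * g x"
  have fg: "integrable M (\<lambda>x. f x * g x)" by (rule integrable_mult_sq) (use i in auto)
  have G: "?G \<ge> 0" by (rule Bochner_Integration.integral_nonneg) simp
  have q: "0 \<le> ?F - 2 * t * ?I + t\<^sup>2 * ?G" for t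
  proof -
    have "0 \<le> (LINT x|M. (f x - t * g x)\<^sup>2)" by (rule Bochner_Integration.integral_nonneg) simp
    also have "... = (LINT x|M. (f x)\<^sup>2 - 2 * t * (f x * g x) + t\<^sup>2 * (g x)\<^sup>2)"
      by (rule Bochner_Integration.integral_cong) (auto simp: power2_eq_square algebra_simps)
    also have "... = ?F - 2 * t * ?I + t\<^sup>2 * ?G" using i fg by simp
    finally show ?thesis .
  qed
  show ?thesis
  proof (cases "?G = 0")
    case True
    have "?I = 0"
    proof (rule ccontr)
      assume "?I \<noteq> 0"
      \<comment> \<open>At this value of t the quadratic equals -1.\<close>
      then show False using q[of "(?F + 1) / (2 * ?I)"] True by simp
    qed
    then show ?thesis using True by simp
  next
    case False
    then have G0: "?G > 0" using G by (simp add: order_less_le)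
    define t where "t = ?I / ?G"
    have I: "?I = t * ?G" using G0 by (simp add: t_def)
    have "t * (t * ?G) \<le> ?F" using q[of t] unfolding I by (simp add: power2_eq_square algebra_simps)
    then have "t * (t * ?G) * ?G \<le> ?F * ?G" using G by (rule mult_right_mono)
    then show ?thesis unfolding I by (simp add: power2_eq_square mult_ac)
  qed
qed

lemma ip_bound:
  assumes "L2p f" "L2p g"
  shows "\<bar>LINT x|circle. f x * g x\<bar> \<le> sqrt (LINT x|circle. (f x)\<^sup>2) * sqrt (LINT x|circle. (g x)\<^sup>2)"
proof -
  have "(LINT x|circle. f x * g x)\<^sup>2 \<le> (LINT x|circle. (f x)\<^sup>2) * (LINT x|circle. (g x)\<^sup>2)"
    by (rule Cauchy_Schwarz_integral) (use assms L2p_sq L2p_measurable borel_measurable_circle in auto)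
  then show ?thesis by (metis real_sqrt_abs real_sqrt_le_mono real_sqrt_mult)
qed

lemma ip_young:
  assumes "L2p f" "L2p g"
  shows "\<bar>LINT x|circle. f x * g x\<bar> \<le> ((LINT x|circle. (f x)\<^sup>2) + (LINT x|circle. (g x)\<^sup>2)) / 2"
proof -
  let ?a = "LINT x|circle. (f x)\<^sup>2" and ?b = "LINT x|circle. (g x)\<^sup>2"
  have "?a \<ge> 0" "?b \<ge> 0" by (auto intro!: Bochner_Integration.integral_nonneg)
  then have "sqrt ?a * sqrt ?b \<le> (?a + ?b) / 2"
    using young[of "sqrt ?a" "sqrt ?b"] by (simp add: abs_mult)
  then show ?thesis using ip_bound[OF assms] by linarith
qed

lemma ip_tendsto:
  assumes L: "\<And>n. L2p (a n)" "\<And>n. L2p (b n)" "L2p f" "L2p g"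
    and c: "(\<lambda>n. LINT x|circle. (a n x - f x)\<^sup>2) \<longlonglongrightarrow> 0" "(\<lambda>n. LINT x|circle. (b n x - g x)\<^sup>2) \<longlonglongrightarrow> 0"
  shows "(\<lambda>n. LINT x|circle. a n x * b n x) \<longlonglongrightarrow> (LINT x|circle. f x * g x)"
proof -
  let ?N = "\<lambda>f. LINT x|circle. (f x)\<^sup>2"
  have La: "L2p (\<lambda>x. a n x - f x)" and Lb: "L2p (\<lambda>x. b n x - g x)" for n
    using L2p_diff L by blast+
  have "(\<lambda>n. (LINT x|circle. a n x * b n x) - (LINT x|circle. f x * g x)) \<longlonglongrightarrow> 0"
  proof (rule Lim_null_comparison)
    have "norm ((LINT x|circle. a n x * b n x) - (LINT x|circle. f x * g x)) \<le>
      sqrt (?N (\<lambda>x. a n x - f x)) * sqrt (?N (\<lambda>x. b n x - g x)) + sqrt (?N (\<lambda>x. a n x - f x)) * sqrt (?N g)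
        + sqrt (?N f) * sqrt (?N (\<lambda>x. b n x - g x))" for n
    proof -
      have "(LINT x|circle. a n x * b n x) = (LINT x|circle. (a n x - f x) * (b n x - g x) + (a n x - f x) * g x
          + f x * (b n x - g x) + f x * g x)"
        by (simp add: algebra_simps)
      also have "... = (LINT x|circle. (a n x - f x) * (b n x - g x)) + (LINT x|circle. (a n x - f x) * g x)
          + (LINT x|circle. f x * (b n x - g x)) + (LINT x|circle. f x * g x)"
        using L2p_mult[OF La Lb, of n n] L2p_mult[OF La L(4), of n] L2p_mult[OF L(3) Lb, of n] L2p_mult[OF L(3,4)]
        by simp
      finally show ?thesis
        using ip_bound[OF La Lb, of n n] ip_bound[OF La L(4), of n] ip_bound[OF L(3) Lb, of n]
        unfolding real_norm_def by linarith
    qed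
    then show "\<forall>\<^sub>F n in sequentially. norm ((LINT x|circle. a n x * b n x) - (LINT x|circle. f x * g x)) \<le>
      sqrt (?N (\<lambda>x. a n x - f x)) * sqrt (?N (\<lambda>x. b n x - g x)) + sqrt (?N (\<lambda>x. a n x - f x)) * sqrt (?N g)
        + sqrt (?N f) * sqrt (?N (\<lambda>x. b n x - g x))" by simp
    have "(\<lambda>n. sqrt (?N (\<lambda>x. a n x - f x)) * sqrt (?N (\<lambda>x. b n x - g x)) + sqrt (?N (\<lambda>x. a n x - f x)) * sqrt (?N g)
        + sqrt (?N f) * sqrt (?N (\<lambda>x. b n x - g x))) \<longlonglongrightarrow> sqrt 0 * sqrt 0 + sqrt 0 * sqrt (?N g) + sqrt (?N f) * sqrt 0"
      by (intro tendsto_intros c)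
    then show "(\<lambda>n. sqrt (?N (\<lambda>x. a n x - f x)) * sqrt (?N (\<lambda>x. b n x - g x)) + sqrt (?N (\<lambda>x. a n x - f x)) * sqrt (?N g)
        + sqrt (?N f) * sqrt (?N (\<lambda>x. b n x - g x))) \<longlonglongrightarrow> 0" by simp
  qed
  then show ?thesis by (rule LIM_zero_cancel)
qed

section \<open>Second difference quotients and twofold averages\<close>

abbreviation avg2 :: "real \<Rightarrow> (real \<Rightarrow> real) \<Rightarrow> real \<Rightarrow> real" where
  "avg2 d f \<equiv> avg d (avg d f)"

abbreviation dq2 :: "real \<Rightarrow> (real \<Rightarrow> real) \<Rightarrow> real \<Rightarrow> real" where
  "dq2 d f \<equiv> dq d (dq d f)"

lemma avg2_tendsto_L2:
  assumes f: "L2p f"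
  shows "(\<lambda>n. LINT x|circle. (avg2 (dl n) f x - f x)\<^sup>2) \<longlonglongrightarrow> 0"
proof (rule Lim_null_comparison)
  let ?e = "\<lambda>n. LINT x|circle. (avg (dl n) f x - f x)\<^sup>2"
  have "norm (LINT x|circle. (avg2 (dl n) f x - f x)\<^sup>2) \<le> 3 * (?e n + ?e n + 0)" for n
  proof -
    let ?g = "\<lambda>x. avg (dl n) f x - f x"
    have g: "L2p ?g" by (intro L2p_diff avg_L2 dl_pos f)
    have eq: "avg2 (dl n) f x - f x = avg (dl n) ?g x + ?g x + 0" for x
      using avg_diff[OF L2p_loc_int[OF avg_L2(1)[OF f dl_pos]] L2p_loc_int[OF f] dl_pos, of n n x] by simp
    have "(LINT x|circle. (avg2 (dl n) f x - f x)\<^sup>2) \<le> 3 * ((LINT x|circle. (avg (dl n) ?g x)\<^sup>2) + ?e n + (LINT x|circle. 0\<^sup>2))"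
      unfolding eq by (intro L2p_triangle3 avg_L2 dl_pos g L2p_const)
    also have "... \<le> 3 * (?e n + ?e n + 0)" using avg_L2(2)[OF g dl_pos, of n] by simp
    finally show ?thesis by simp
  qed
  then show "\<forall>\<^sub>F n in sequentially. norm (LINT x|circle. (avg2 (dl n) f x - f x)\<^sup>2) \<le> 3 * (?e n + ?e n + 0)" by simp
  have "(\<lambda>n. 3 * (?e n + ?e n + 0)) \<longlonglongrightarrow> 3 * (0 + 0 + 0)"
    by (intro tendsto_intros avg_tendsto_L2 f)
  then show "(\<lambda>n. 3 * (?e n + ?e n + 0)) \<longlonglongrightarrow> 0" by simp
qed

lemma avg2_ip_tendsto:
  assumes "L2p f" "L2p g"
  shows "(\<lambda>n. LINT x|circle. avg2 (dl n) f x * avg2 (dl n) g x) \<longlonglongrightarrow> (LINT x|circle. f x * g x)"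
  by (intro ip_tendsto avg2_tendsto_L2 avg_L2 dl_pos assms)

text \<open>The bound does not depend on d; it is the dominating function when the step tends to
  zero under a time integral.\<close>

lemma avg2_ip_bound:
  assumes "L2p f" "L2p g" "d > 0"
  shows "\<bar>LINT x|circle. avg2 d f x * avg2 d g x\<bar> \<le> ((LINT x|circle. (f x)\<^sup>2) + (LINT x|circle. (g x)\<^sup>2)) / 2"
proof -
  have *: "a \<le> (p + q) / 2" if "a \<le> (p2 + q2) / 2" "p2 \<le> p1" "p1 \<le> p" "q2 \<le> q1" "q1 \<le> q" for a p q p1 q1 p2 q2 :: real
  proof -
    have "p2 + q2 \<le> p + q" using that by (intro add_mono) (auto intro: order_trans)
    then have "(p2 + q2) / 2 \<le> (p + q) / 2" by simp
    with that(1) show ?thesis by (rule order_trans)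
  qed
  show ?thesis
    by (rule *[OF ip_young[OF avg_L2(1)[OF avg_L2(1)] avg_L2(1)[OF avg_L2(1)]]
          avg_L2(2)[OF avg_L2(1)] avg_L2(2) avg_L2(2)[OF avg_L2(1)] avg_L2(2)]) (rule assms)+
qed

lemma dq2_ac:
  assumes "ac v v1" "ac v1 v2" "d > 0" shows "dq2 d v = avg2 d v2"
proof -
  have "dq d v = avg d v1" "dq d v1 = avg d v2" using assms dq_ac by blast+
  then show ?thesis using avg_dq[of v1 d] loc_int_cont[OF ac_continuous[OF assms(2)]] assms(3) by simp
qed

lemma avg_shift: "avg d (\<lambda>x. f (x + s)) = (\<lambda>x. avg d f (x + s))"
  by (rule ext) (simp add: avg_def algebra_simps)

lemma dq_shift: "dq d (\<lambda>x. f (x + s)) = (\<lambda>x. dq d f (x + s))"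
  by (rule ext) (simp add: dq_def algebra_simps)

text \<open>All shifts cancel since the adjoint of averaging forwards is
  averaging backwards.\<close>

lemma dq2_pairing:
  assumes ac: "ac v v1" "ac v1 v2" "ac v2 v3" "ac v3 z"
    and L: "L2p v" "L2p v2" "L2p z" "L2p V" and d: "d > 0"
  shows "(LINT x|circle. dq2 d v x * dq2 d V x) = (LINT x|circle. avg2 d z x * avg2 d V x)"
proof -
  let ?X = "dq2 d v"
  have X: "L2p ?X" "L2p (dq d ?X)" by (intro dq_L2 L)+
  have s: "L2p (\<lambda>x. V (x + d))" "L2p (dq d V)" "L2p (avg d V)" "L2p (avg d z)" "L2p (avg2 d z)" "L2p (avg d (avg2 d z))"
    by (intro L2p_shift dq_L2 avg_L2 L d)+
  have a2: "loc_int v2" "loc_int (avg d v2)" by (intro L2p_loc_int avg_L2 L d)+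
  \<comment> \<open>Two of the four quotients turn v into averages of \<open>v2\<close>; the
    remaining two commute with these averages and turn \<open>v2\<close> into averages of
    \<open>z\<close>.\<close>
  have dq4: "dq2 d ?X = avg2 d (avg2 d z)"
  proof -
    have "dq2 d ?X = dq2 d (avg2 d v2)" using dq2_ac[OF ac(1,2) d] by simp
    also have "... = avg2 d (dq2 d v2)"
      using avg_dq[OF a2(2) d] avg_dq[OF a2(1) d]
        avg_dq[OF L2p_loc_int[OF dq_L2[OF L(2)]] d, of d] avg_dq[OF L2p_loc_int[OF dq_L2[OF avg_L2(1)[OF L(2) d]]] d, of d]
      by simp
    also have "... = avg2 d (avg2 d z)" using dq2_ac[OF ac(3,4) d] by simp
    finally show ?thesis .
  qed
  have "(LINT x|circle. ?X x * dq2 d V x) = - (LINT x|circle. dq d ?X x * dq d V (x + d))"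
    using dq_adjoint[OF X(1) s(2), of d] by simp
  also have "... = - (LINT x|circle. dq d ?X x * dq d (\<lambda>x. V (x + d)) x)" by (simp add: dq_shift)
  also have "... = (LINT x|circle. dq2 d ?X x * V (x + d + d))"
    using dq_adjoint[OF X(2) s(1), of d] by simp
  also have "... = (LINT x|circle. avg d (avg d (avg2 d z)) x * V (x + d + d))" by (simp add: dq4)
  also have "... = (LINT x|circle. avg d (avg2 d z) x * avg d (\<lambda>x. V (x + d)) x)"
    using avg_adjoint[OF s(6) s(1) d] by simp
  also have "... = (LINT x|circle. avg d (avg2 d z) x * avg d V (x + d))" by (simp add: avg_shift)
  also have "... = (LINT x|circle. avg2 d z x * avg2 d V x)"
    by (rule avg_adjoint[OF s(5) s(3) d])
  finally show ?thesis .
qed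

section \<open>The nonlinearity, and bounds in terms of the energy\<close>

definition cub :: "real \<Rightarrow> real" where "cub y = y ^ 3 + y"

lemma cub_chain2:
  assumes "ac f f1" "ac f1 f2"
  shows "ac (\<lambda>x. cub (f x)) (\<lambda>x. (3 * (f x)\<^sup>2 + 1) * f1 x)"
    "ac (\<lambda>x. (3 * (f x)\<^sup>2 + 1) * f1 x) (\<lambda>x. 6 * f x * (f1 x)\<^sup>2 + (3 * (f x)\<^sup>2 + 1) * f2 x)"
proof -
  show "ac (\<lambda>x. cub (f x)) (\<lambda>x. (3 * (f x)\<^sup>2 + 1) * f1 x)"
    unfolding cub_def
    by (rule ac_chain[OF assms(1), where I=UNIV and P="\<lambda>y. y ^ 3 + y" and P'="\<lambda>y. 3 * y\<^sup>2 + 1"])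
       (auto intro!: derivative_eq_intros continuous_intros)
  have c: "ac (\<lambda>x. 3 * (f x)\<^sup>2 + 1) (\<lambda>x. 6 * f x * f1 x)"
    by (rule ac_chain[OF assms(1), where I=UNIV and P="\<lambda>y. 3 * y\<^sup>2 + 1" and P'="\<lambda>y. 6 * y"])
       (auto intro!: derivative_eq_intros continuous_intros)
  show "ac (\<lambda>x. (3 * (f x)\<^sup>2 + 1) * f1 x) (\<lambda>x. 6 * f x * (f1 x)\<^sup>2 + (3 * (f x)\<^sup>2 + 1) * f2 x)"
    by (rule ac_cong[OF ac_mult[OF c assms(2)]]) (auto simp: power2_eq_square)
qed

text \<open>The explicit third and fourth derivatives matter only for absolute continuity and
  periodicity, so their formulas are hidden.\<close>

lemma cub_chain4:
  assumes "ac f f1" "ac f1 f2" "ac f2 f3" "ac f3 f4" and p: "per f" "per f1" "per f2" "per f3" "per f4"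
  obtains v3 v4 where "ac (\<lambda>x. 6 * f x * (f1 x)\<^sup>2 + (3 * (f x)\<^sup>2 + 1) * f2 x) v3" "ac v3 v4" "per v3" "per v4"
proof -
  have c: "ac (\<lambda>x. 3 * (f x)\<^sup>2 + 1) (\<lambda>x. 6 * f x * f1 x)"
    by (rule ac_chain[OF assms(1), where I=UNIV and P="\<lambda>y. 3 * y\<^sup>2 + 1" and P'="\<lambda>y. 6 * y"])
       (auto intro!: derivative_eq_intros continuous_intros)
  have 1: "ac (\<lambda>x. 6 * f x * (f1 x)\<^sup>2 + (3 * (f x)\<^sup>2 + 1) * f2 x)
      (\<lambda>x. 6 * ((f1 x)\<^sup>2 * f1 x) + 18 * ((f x * f1 x) * f2 x) + (3 * (f x)\<^sup>2 + 1) * f3 x)"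
    by (rule ac_cong[OF ac_add[OF ac_cmult[OF ac_mult[OF assms(1) ac_square[OF assms(2)]], of 6] ac_mult[OF c assms(3)]]])
       (auto simp: power2_eq_square algebra_simps)
  note 2 = ac_add[OF ac_add[OF ac_cmult[OF ac_mult[OF ac_square[OF assms(2)] assms(2)], of 6]
    ac_cmult[OF ac_mult[OF ac_mult[OF assms(1,2)] assms(3)], of 18]] ac_mult[OF c assms(4)]]
  show ?thesis
    by (rule that[OF 1 2]) (intro per_add per_mult per_square per_const p)+
qed

lemma integral_square_le:
  assumes g: "loc_int g" "loc_int (\<lambda>x. (g x)\<^sup>2)" and ab: "a \<le> b"
  shows "(integral {a..b} g)\<^sup>2 \<le> (b - a) * integral {a..b} (\<lambda>x. (g x)\<^sup>2)"
proof -
  have [measurable]: "g \<in> borel_measurable borel" by (rule loc_intD[OF g(1)])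
  let ?i = "indicat_real {a..b}"
  have sq: "(?i x)\<^sup>2 = ?i x" "(?i x * g x)\<^sup>2 = ?i x *\<^sub>R (g x)\<^sup>2" "?i x * (?i x * g x) = ?i x *\<^sub>R g x" for x
    by (auto simp: indicator_def)
  have "(LINT x|lborel. ?i x * (?i x * g x))\<^sup>2 \<le> (LINT x|lborel. (?i x)\<^sup>2) * (LINT x|lborel. (?i x * g x)\<^sup>2)"
  proof (rule Cauchy_Schwarz_integral)
    have "integrable lborel ?i" by (rule integrable_real_indicator) (use ab in auto)
    then show "integrable lborel (\<lambda>x. (?i x)\<^sup>2)" by (simp only: sq(1))
    show "integrable lborel (\<lambda>x. (?i x * g x)\<^sup>2)"
      using loc_intD(2)[OF g(2)] unfolding set_integrable_def by (simp only: sq(2))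
  qed measurable
  moreover have "(LINT x|lborel. ?i x) = b - a" using ab by simp
  ultimately show ?thesis
    using loc_int_HK(2)[OF g(1), of a b] loc_int_HK(2)[OF g(2), of a b]
    unfolding set_lebesgue_integral_def by (simp only: sq)
qed

lemma per_integral_unit:
  assumes "per f" "integrable circle f" shows "integral {a..a+1} f = (LINT x|circle. f x)"
proof -
  have "(LINT x|circle. f (x + a)) = integral {a..a+1} f"
    using loc_int_affine(2)[OF per_loc_int[OF assms], of 1 a] by (simp add: add.commute)
  then show ?thesis using per_shift_integral[OF assms(1)] by simp
qed

lemma cub_mono_diff: "x \<le> y \<Longrightarrow> 0 \<le> x \<Longrightarrow> y - x \<le> cub y - cub x"
  unfolding cub_def using power_mono[of x y 3] by simp

lemma per_global:
  assumes "per f" "\<And>s. 0 \<le> s \<Longrightarrow> s \<le> 1 \<Longrightarrow> P (f (a + s))" shows "P (f x)"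
proof -
  have "f x = f (a + frac (x - a))"
    using per_int[OF assms(1), of x "- \<lfloor>x - a\<rfloor>"] by (simp add: frac_def algebra_simps)
  then show ?thesis using assms(2)[of "frac (x - a)"] frac_lt_1[of "x - a"] by (simp add: less_imp_le)
qed

text \<open>An H2 periodic function with its derivatives exhibited: \<open>v1\<close> is absolutely
  continuous, \<open>v2\<close> merely a square integrable representative. For v =
  \<open>cub\<close> of u the quantity E below is the energy of u.\<close>

locale periodic_chain =
  fixes v v1 v2 :: "real \<Rightarrow> real"
  assumes v: "per v" "ac v v1" and v1: "per v1" "ac v1 v2" and v2: "L2p v2"
begin

abbreviation E where "E \<equiv> LINT x|circle. (v2 x)\<^sup>2"

lemma E_nonneg: "E \<ge> 0" by (rule Bochner_Integration.integral_nonneg) simp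

text \<open>At a minimum point v1 vanishes. Cauchy-Schwarz bounds v1^2 by s E on [a, a + s], and a
  second application to the primitive v gives the remaining s^2.\<close>

lemma growth_from_min:
  assumes m: "\<And>x. v a \<le> v x" and s: "0 \<le> s" "s \<le> 1"
  shows "(v (a + s) - v a)\<^sup>2 \<le> s ^ 3 * E"
proof -
  have c1: "isCont v1 x" for x using ac_continuous[OF v1(2), of UNIV] by (simp add: continuous_on_eq_continuous_at)
  have "v1 a = 0"
    using DERIV_local_min[OF ac_has_deriv[OF v(2) c1], of 1 a] m by auto
  have b1: "(v1 (a + r))\<^sup>2 \<le> s * E" if "0 \<le> r" "r \<le> s" for r
  proof -
    have "(v1 (a + r))\<^sup>2 = (integral {a..a+r} v2)\<^sup>2"
      using acD(2)[OF v1(2), of a "a + r"] \<open>v1 a = 0\<close> that by simp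
    also have "... \<le> r * integral {a..a+r} (\<lambda>x. (v2 x)\<^sup>2)"
      using integral_square_le[OF L2p_loc_int[OF v2] L2p_loc_int_sq[OF v2], of a "a + r"] that by simp
    also have "... \<le> s * integral {a..a+1} (\<lambda>x. (v2 x)\<^sup>2)"
      using that s
      by (intro mult_mono integral_subset_le loc_int_HK(1) L2p_loc_int_sq v2 Henstock_Kurzweil_Integration.integral_nonneg) auto
    also have "... = s * E"
      using per_integral_unit[OF per_square[OF L2p_per[OF v2]] L2p_sq[OF v2]] by simp
    finally show ?thesis .
  qed
  have L1: "L2p v1" by (rule L2p_continuous[OF v1(1) ac_continuous[OF v1(2)]])
  have "(v (a + s) - v a)\<^sup>2 = (integral {a..a+s} v1)\<^sup>2" using acD(2)[OF v(2), of a "a + s"] s by simp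
  also have "... \<le> s * integral {a..a+s} (\<lambda>x. (v1 x)\<^sup>2)"
    using integral_square_le[OF L2p_loc_int[OF L1] L2p_loc_int_sq[OF L1], of a "a + s"] s by simp
  also have "... \<le> s * integral {a..a+s} (\<lambda>x. s * E)"
  proof (intro mult_left_mono Henstock_Kurzweil_Integration.integral_le loc_int_HK(1) L2p_loc_int_sq L1 s(1))
    show "(v1 x)\<^sup>2 \<le> s * E" if "x \<in> {a..a+s}" for x
      using b1[of "x - a"] that by simp
  qed (intro loc_int_cont continuous_on_const)
  also have "... = s ^ 3 * E" using s by (simp add: power3_eq_cube)
  finally show ?thesis .
qed

lemma ex_min: "\<exists>a. \<forall>x. v a \<le> v x"
proof -
  have "\<exists>a\<in>{0..1}. \<forall>x\<in>{0..1}. v a \<le> v x"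
    by (rule continuous_attains_inf) (auto intro: ac_continuous[OF v(2)])
  then obtain a where "\<And>x. x \<in> {0..1} \<Longrightarrow> v a \<le> v x" by blast
  then have "v a \<le> v x" for x using per_global[OF v(1), of "\<lambda>y. v a \<le> y" 0] by auto
  then show ?thesis by blast
qed

lemma oscillation: "(v x - v y)\<^sup>2 \<le> E"
proof -
  obtain a where a: "\<And>x. v a \<le> v x" using ex_min by blast
  have "v (a + s) - v a \<le> sqrt E" if "0 \<le> s" "s \<le> 1" for s
  proof (rule real_le_rsqrt)
    have "s ^ 3 * E \<le> 1 * E" using that E_nonneg by (intro mult_right_mono power_le_one) auto
    then show "(v (a + s) - v a)\<^sup>2 \<le> E" using growth_from_min[OF a that] by simp
  qed
  then have "v x - v a \<le> sqrt E" for x using per_global[OF v(1), of "\<lambda>y. y - v a \<le> sqrt E" a] by auto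
  from this[of x] this[of y] a[of x] a[of y] have "\<bar>v x - v y\<bar> \<le> sqrt E" by linarith
  then have "(v x - v y)\<^sup>2 \<le> (sqrt E)\<^sup>2" by (metis abs_ge_zero power2_abs power_mono)
  then show ?thesis using E_nonneg by simp
qed

text \<open>\<open>dq2_pairing\<close> with V = v and step tending to zero replaces two integrations
  by parts: E is the integral of z v. As z is the derivative of a periodic function, v may be
  lowered by v 0, and Young's inequality with \<open>oscillation\<close> gives E <= (int z^2 + E) /
  2.\<close>

lemma E_le_fourth:
  assumes ac: "ac v2 v3" "ac v3 z" and z: "L2p z" and v3: "per v3"
  shows "E \<le> (LINT x|circle. (z x)\<^sup>2)"
proof -
  have Lv: "L2p v" by (rule L2p_continuous[OF v(1) ac_continuous[OF v(2)]])
  have eq: "(LINT x|circle. dq2 (dl n) v x * dq2 (dl n) v x) = (LINT x|circle. avg2 (dl n) z x * avg2 (dl n) v x)" for n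
    by (rule dq2_pairing[OF v(2) v1(2) ac Lv v2 z Lv dl_pos])
  have "(\<lambda>n. LINT x|circle. dq2 (dl n) v x * dq2 (dl n) v x) \<longlonglongrightarrow> (LINT x|circle. v2 x * v2 x)"
    using avg2_ip_tendsto[OF v2 v2] dq2_ac[OF v(2) v1(2) dl_pos] by simp
  moreover have "(\<lambda>n. LINT x|circle. dq2 (dl n) v x * dq2 (dl n) v x) \<longlonglongrightarrow> (LINT x|circle. z x * v x)"
    unfolding eq by (rule avg2_ip_tendsto[OF z Lv])
  ultimately have "E = (LINT x|circle. z x * v x)"
    using LIMSEQ_unique by (simp add: power2_eq_square)
  also have "... = (LINT x|circle. z x * (v x - v 0) + v 0 * z x)" by (simp add: algebra_simps)
  also have "... = (LINT x|circle. z x * (v x - v 0)) + v 0 * (LINT x|circle. z x)"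
    using L2p_mult[OF z L2p_diff[OF Lv L2p_const[of "v 0"]]] L2p_integrable[OF z] by simp
  also have "(LINT x|circle. z x) = 0"
  proof -
    have "v3 (0 + 1) = v3 0" using v3 unfolding per_def by blast
    then show ?thesis
      using per_integral_unit[OF L2p_per[OF z] L2p_integrable[OF z], of 0] acD(2)[OF ac(2), of 0 1] by simp
  qed
  also have "(LINT x|circle. z x * (v x - v 0)) \<le> ((LINT x|circle. (z x)\<^sup>2) + (LINT x|circle. (v x - v 0)\<^sup>2)) / 2"
    using ip_young[OF z L2p_diff[OF Lv L2p_const[of "v 0"]]] by simp
  also have "(LINT x|circle. (v x - v 0)\<^sup>2) \<le> (LINT x|circle. E)"
    by (rule integral_mono) (use L2p_sq[OF L2p_diff[OF Lv L2p_const[of "v 0"]]] oscillation in auto)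
  finally show ?thesis by simp
qed

end

text \<open>If the minimum m of u were below both constants, u would stay below 2 m on an interval
  of length 4 L m, which alone would contribute 2 L to the integral of 1/u.\<close>

lemma lower_bound:
  assumes u: "per u" "continuous_on UNIV u" "\<And>x. u x > 0" and L: "(LINT x|circle. 1 / u x) = L" "L > 0"
    and ch: "periodic_chain (\<lambda>x. cub (u x)) v1 v2" and K: "(LINT x|circle. (v2 x)\<^sup>2) \<le> K" "K > 0"
  shows "min (1 / (4 * L)) (1 / (64 * L ^ 3 * K)) \<le> u x"
proof (rule ccontr)
  assume x: "\<not> ?thesis"
  interpret periodic_chain "\<lambda>x. cub (u x)" v1 v2 by (rule ch)
  obtain a where a: "\<And>x. cub (u a) \<le> cub (u x)" using ex_min by blast
  have ua: "u a \<le> u x" for x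
  proof (rule ccontr)
    assume "\<not> u a \<le> u x"
    then show False using a[of x] cub_mono_diff[of "u x" "u a"] u(3)[of x] by simp
  qed
  define m where "m = u a"
  have m: "m > 0" "m < 1 / (4 * L)" "m < 1 / (64 * L ^ 3 * K)" using x ua[of x] u(3) by (auto simp: m_def)
  \<comment> \<open>The first constant ensures s < 1; the second ensures s^3 K <= m^2, so that
    \<open>cub\<close> of u, and with it u, grows by at most m on [a, a + s].\<close>
  define s where "s = 4 * L * m"
  have s: "0 < s" "s < 1" using m L by (auto simp: s_def field_simps)
  have near: "u (a + r) \<le> 2 * m" if r: "0 \<le> r" "r \<le> s" for r
  proof -
    have "u (a + r) - u a \<le> cub (u (a + r)) - cub (u a)" by (rule cub_mono_diff) (use ua u(3) in \<open>auto simp: less_imp_le\<close>)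
    also have "... \<le> m"
    proof (rule power2_le_imp_le)
      have "(cub (u (a + r)) - cub (u a))\<^sup>2 \<le> r ^ 3 * E" using growth_from_min[OF a] r s by auto
      also have "... \<le> s ^ 3 * K" using r s K E_nonneg by (intro mult_mono power_mono) auto
      also have "... = m\<^sup>2 * (m * (64 * L ^ 3 * K))" by (simp add: s_def power2_eq_square power3_eq_cube)
      also have "... \<le> m\<^sup>2 * 1"
        using m(3) L K by (intro mult_left_mono) (auto simp: field_simps)
      finally show "(cub (u (a + r)) - cub (u a))\<^sup>2 \<le> m\<^sup>2" by simp
    qed (use m in auto)
    finally show ?thesis by (simp add: m_def)
  qed
  have [measurable]: "u \<in> borel_measurable borel" using u(1) by (rule per_measurable)
  have p: "per (\<lambda>x. 1 / u x)" using u(1) by (auto simp: per_def)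
  have c: "continuous_on UNIV (\<lambda>x. 1 / u x)" using u by (intro continuous_intros) (auto simp: less_imp_neq[symmetric])
  have i: "integrable circle (\<lambda>x. 1 / u x)" by (rule L2p_integrable[OF L2p_continuous[OF p c]])
  have "2 * L = integral {a..a+s} (\<lambda>x. 1 / (2 * m))" using s m(1) by (simp add: s_def)
  also have "... \<le> integral {a..a+s} (\<lambda>x. 1 / u x)"
  proof (rule Henstock_Kurzweil_Integration.integral_le)
    show "1 / (2 * m) \<le> 1 / u y" if "y \<in> {a..a+s}" for y
      using near[of "y - a"] that u(3)[of y] m by (auto simp: field_simps)
  qed (use loc_int_HK(1)[OF per_loc_int[OF p i]] in auto)
  also have "... \<le> integral {a..a+1} (\<lambda>x. 1 / u x)"
    using s u(3) by (intro integral_subset_le loc_int_HK(1)[OF per_loc_int[OF p i]]) (auto simp: less_imp_le)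
  also have "... = L" using per_integral_unit[OF p i] L by simp
  finally show False using L by simp
qed

text \<open>Otherwise 1/u - L would be continuous without zeros, hence of constant sign, although
  its mean over the period is zero.\<close>

lemma attains_mean:
  assumes u: "per u" "continuous_on UNIV u" "\<And>x. u x > 0" and L: "(LINT x|circle. 1 / u x) = L"
  shows "\<exists>x. u x = 1 / L"
proof (rule ccontr)
  assume n: "\<not> ?thesis"
  have p: "per (\<lambda>x. 1 / u x)" using u(1) by (auto simp: per_def)
  have c: "continuous_on UNIV (\<lambda>x. 1 / u x)" using u by (intro continuous_intros) (auto simp: less_imp_neq[symmetric])
  have i: "integrable circle (\<lambda>x. 1 / u x)" by (rule L2p_integrable[OF L2p_continuous[OF p c]])
  let ?g = "\<lambda>x. 1 / u x - L"
  have nz: "?g x \<noteq> 0" for x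
  proof
    assume "?g x = 0"
    then have "L = 1 / u x" by simp
    then have "u x = 1 / L" by simp
    then show False using n by blast
  qed
  have cg: "continuous_on A ?g" for A by (intro continuous_intros continuous_on_subset[OF c]) auto
  have sign: "?g x * ?g y > 0" for x y
  proof (rule ccontr)
    assume "\<not> ?thesis"
    then have "?g x < 0 \<and> 0 < ?g y \<or> ?g y < 0 \<and> 0 < ?g x" using nz[of x] nz[of y]
      by (metis linorder_neqE_linordered_idom mult_neg_neg mult_pos_pos)
    moreover have "connected (range ?g)" by (rule connected_continuous_image[OF cg]) simp
    ultimately have "0 \<in> range ?g"
      unfolding connected_iff_interval by (metis less_imp_le rangeI)
    then show False using nz by auto
  qed
  have z: "(LINT x|circle. ?g x) = 0" using i L by simp
  have ig: "integrable circle ?g" using i by simp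
  have F: "False" if "AE x in circle. ?g x = 0"
  proof -
    from that have "AE x in circle. False" by (rule eventually_mono) (use nz in auto)
    then show False using circle.AE_False by simp
  qed
  show False
  proof (cases "?g 0 > 0")
    case True
    then have "?g x \<ge> 0" for x using sign[of 0 x] by (simp add: zero_less_mult_iff less_imp_le)
    then show False using integral_nonneg_eq_0_iff_AE[OF ig] z F by simp
  next
    case False
    then have "- ?g x \<ge> 0" for x using sign[of 0 x] by (simp add: zero_less_mult_iff less_imp_le)
    moreover have "integrable circle (\<lambda>x. - ?g x)" "(LINT x|circle. - ?g x) = 0"
    proof -
      show "integrable circle (\<lambda>x. - ?g x)" by (rule Bochner_Integration.integrable_minus[OF ig])
      have "(LINT x|circle. - ?g x) = - (LINT x|circle. ?g x)" by (rule Bochner_Integration.integral_minus)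
      then show "(LINT x|circle. - ?g x) = 0" unfolding z by simp
    qed
    ultimately have "AE x in circle. - ?g x = 0" using integral_nonneg_eq_0_iff_AE[of circle "\<lambda>x. - ?g x"] by blast
    then have "AE x in circle. ?g x = 0" by (rule eventually_mono) simp
    then show False by (rule F)
  qed
qed

text \<open>\<open>cub\<close> increases with slope at least one, so oscillations of u are bounded
  by those of \<open>cub\<close> of u; u is compared with a point where it equals 1 / L.\<close>

lemma sup_bound:
  assumes u: "per u" "continuous_on UNIV u" "\<And>x. u x > 0" and L: "(LINT x|circle. 1 / u x) = L"
    and ch: "periodic_chain (\<lambda>x. cub (u x)) v1 v2"
  shows "\<bar>u x - 1 / L\<bar> \<le> sqrt (LINT x|circle. (v2 x)\<^sup>2)"
proof -
  interpret periodic_chain "\<lambda>x. cub (u x)" v1 v2 by (rule ch)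
  obtain y where y: "u y = 1 / L" using attains_mean[OF u L] by blast
  have "\<bar>u x - u y\<bar> \<le> \<bar>cub (u x) - cub (u y)\<bar>"
    using cub_mono_diff[of "u x" "u y"] cub_mono_diff[of "u y" "u x"] u(3)[of x] u(3)[of y] by linarith
  also have "... \<le> sqrt E"
    using oscillation[of x y] by (metis real_sqrt_abs real_sqrt_le_mono)
  finally show ?thesis using y by simp
qed

section \<open>Energy dissipation\<close>

interpretation strip: pair_sigma_finite "lborel :: real measure" circle ..

section \<open>Square integrable functions of time and space\<close>

definition meas2 :: "(real \<Rightarrow> real \<Rightarrow> real) \<Rightarrow> bool" where
  "meas2 F \<longleftrightarrow> (\<lambda>(t, h). F t h) \<in> borel_measurable (borel \<Otimes>\<^sub>M borel)"

lemma meas2_compose: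
  assumes "meas2 F" "f \<in> borel_measurable M" "g \<in> borel_measurable M"
  shows "(\<lambda>x. F (f x) (g x)) \<in> borel_measurable M"
proof -
  have "(\<lambda>x. (f x, g x)) \<in> M \<rightarrow>\<^sub>M borel \<Otimes>\<^sub>M borel" using assms by measurable
  from measurable_compose[OF this, of "\<lambda>(t, h). F t h" borel] show ?thesis using assms(1) by (simp add: meas2_def)
qed

lemma meas2_section: "meas2 F \<Longrightarrow> F t \<in> borel_measurable borel"
  by (rule meas2_compose[of F "\<lambda>_. t" borel "\<lambda>h. h"]) auto

text \<open>Time ranges over the whole line: the velocity is later extended by zero, which keeps
  restrictions to \<open>{0..T}\<close> out of the Fubini arguments.\<close>

definition SQ :: "(real \<Rightarrow> real \<Rightarrow> real) \<Rightarrow> bool" where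
  "SQ F \<longleftrightarrow> meas2 F \<and> integrable (lborel \<Otimes>\<^sub>M circle) (\<lambda>(t, h). (F t h)\<^sup>2)"

lemma SQ_meas: "SQ F \<Longrightarrow> (\<lambda>p. F (fst p) (snd p)) \<in> borel_measurable (lborel \<Otimes>\<^sub>M circle)"
  by (rule meas2_compose[of F]) (auto simp: SQ_def)

lemma SQ_integrable: "SQ F \<Longrightarrow> integrable (lborel \<Otimes>\<^sub>M circle) (\<lambda>p. (F (fst p) (snd p))\<^sup>2)"
  by (simp add: SQ_def case_prod_unfold)

lemma SQ_I:
  assumes "meas2 F" "integrable (lborel \<Otimes>\<^sub>M circle) G" "\<And>p. (F (fst p) (snd p))\<^sup>2 \<le> G p"
  shows "SQ F"
proof -
  have [measurable]: "(\<lambda>p. F (fst p) (snd p)) \<in> borel_measurable (lborel \<Otimes>\<^sub>M circle)"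
    by (rule meas2_compose[OF assms(1)]) auto
  have "integrable (lborel \<Otimes>\<^sub>M circle) (\<lambda>p. (F (fst p) (snd p))\<^sup>2)"
    by (rule Bochner_Integration.integrable_bound[OF assms(2)])
       (use assms(3) in \<open>auto intro!: AE_I2 intro: order_trans[OF _ abs_ge_self]\<close>)
  then show ?thesis using assms(1) by (simp add: SQ_def case_prod_unfold)
qed

lemma SQ_cmult:
  assumes "SQ F" shows "SQ (\<lambda>t h. k * F t h)"
proof -
  have "meas2 (\<lambda>t h. k * F t h)"
    using assms unfolding SQ_def meas2_def case_prod_unfold by (intro borel_measurable_times borel_measurable_const) blast
  then show ?thesis
    using SQ_integrable[OF assms] by (simp add: SQ_def case_prod_unfold power_mult_distrib)
qed

lemma meas2_add: "meas2 F \<Longrightarrow> meas2 G \<Longrightarrow> meas2 (\<lambda>t h. F t h + G t h)"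
  unfolding meas2_def by (auto simp: case_prod_unfold)

lemma meas2_mult: "meas2 F \<Longrightarrow> meas2 G \<Longrightarrow> meas2 (\<lambda>t h. F t h * G t h)"
  unfolding meas2_def by (auto simp: case_prod_unfold)

lemma SQ_add:
  assumes "SQ F" "SQ G" shows "SQ (\<lambda>t h. F t h + G t h)"
proof (rule SQ_I)
  show "integrable (lborel \<Otimes>\<^sub>M circle) (\<lambda>p. 2 * (F (fst p) (snd p))\<^sup>2 + 2 * (G (fst p) (snd p))\<^sup>2)"
    using SQ_integrable assms by auto
  show "(F (fst p) (snd p) + G (fst p) (snd p))\<^sup>2 \<le> 2 * (F (fst p) (snd p))\<^sup>2 + 2 * (G (fst p) (snd p))\<^sup>2" for p
    using sum_squares_bound[of "F (fst p) (snd p)" "G (fst p) (snd p)"] by (simp add: power2_sum)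
qed (use assms meas2_add in \<open>auto simp: SQ_def\<close>)

lemma SQ_bmult:
  assumes F: "SQ F" and K: "meas2 K" "\<And>t h. \<bar>K t h\<bar> \<le> B" shows "SQ (\<lambda>t h. K t h * F t h)"
proof (rule SQ_I)
  show "integrable (lborel \<Otimes>\<^sub>M circle) (\<lambda>p. B\<^sup>2 * (F (fst p) (snd p))\<^sup>2)"
    using SQ_integrable F by auto
  have "(K t h)\<^sup>2 \<le> B\<^sup>2" for t h using K(2)[of t h] by (simp add: abs_le_square_iff[symmetric])
  then show "(K (fst p) (snd p) * F (fst p) (snd p))\<^sup>2 \<le> B\<^sup>2 * (F (fst p) (snd p))\<^sup>2" for p
    by (simp add: power_mult_distrib mult_right_mono)
qed (use assms meas2_mult in \<open>auto simp: SQ_def\<close>)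

definition per2 :: "(real \<Rightarrow> real \<Rightarrow> real) \<Rightarrow> bool" where
  "per2 F \<longleftrightarrow> (\<forall>t h. F t (h + 1) = F t h)"

lemma SQ_per:
  assumes "SQ F" "per2 F" shows "per (F t)"
proof -
  have "F t \<in> borel_measurable borel" by (rule meas2_section) (use assms in \<open>simp add: SQ_def\<close>)
  moreover have "\<forall>h. F t (h + 1) = F t h" using assms(2) unfolding per2_def by (rule spec)
  ultimately show ?thesis unfolding per_def by (rule conjI)
qed

lemma SQ_shift:
  assumes F: "SQ F" "per2 F" shows "SQ (\<lambda>t h. F t (h + a))"
proof -
  note p = SQ_per[OF F]
  have p2: "per (\<lambda>h. (F t h)\<^sup>2)" for t by (rule per_square[OF p])
  have m: "meas2 (\<lambda>t h. F t (h + a))"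
    unfolding meas2_def case_prod_unfold
    by (rule meas2_compose[of F]) (use F(1) in \<open>auto simp: SQ_def\<close>)
  have [measurable]: "(\<lambda>p. F (fst p) (snd p + a)) \<in> borel_measurable (lborel \<Otimes>\<^sub>M circle)"
    by (rule meas2_compose[of F]) (use F(1) in \<open>auto simp: SQ_def\<close>)
  have i: "integrable (lborel \<Otimes>\<^sub>M circle) (\<lambda>(t, h). (F t h)\<^sup>2)" using F by (simp add: SQ_def)
  have "integrable (lborel \<Otimes>\<^sub>M circle) (\<lambda>p. (F (fst p) (snd p + a))\<^sup>2)"
  proof (rule strip.Fubini_integrable)
    show "integrable lborel (\<lambda>t. LINT h|circle. norm ((F (fst (t, h)) (snd (t, h) + a))\<^sup>2))"
      using strip.integrable_fst'[OF i] per_shift_integral[OF p2] by simp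
    show "AE t in lborel. integrable circle (\<lambda>h. (F (fst (t, h)) (snd (t, h) + a))\<^sup>2)"
      using strip.AE_integrable_fst'[OF i] per_shift_integrable[OF p2] by simp
  qed measurable
  then show ?thesis using m by (simp add: SQ_def case_prod_unfold)
qed

lemma SQ_dq:
  assumes F: "SQ F" "per2 F" shows "SQ (\<lambda>t. dq d (F t))"
proof -
  have "SQ (\<lambda>t h. F t (h + d))" by (rule SQ_shift[OF F])
  from SQ_add[OF this SQ_cmult[OF F(1), of "-1"]]
  have "SQ (\<lambda>t h. F t (h + d) + - 1 * F t h)" .
  from SQ_cmult[OF this, of "1 / d"]
  have "SQ (\<lambda>t h. 1 / d * (F t (h + d) + - 1 * F t h))" .
  moreover have "(\<lambda>t. dq d (F t)) = (\<lambda>t h. 1 / d * (F t (h + d) + - 1 * F t h))"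
    by (intro ext) (simp add: dq_def)
  ultimately show ?thesis by simp
qed

lemma per2_dq: "per2 F \<Longrightarrow> per2 (\<lambda>t. dq d (F t))"
proof -
  assume F: "per2 F"
  have "F t (h + 1 + d) = F t (h + d)" for t h
  proof -
    have "h + 1 + d = h + d + 1" by simp
    then show ?thesis using F unfolding per2_def by (simp only:)
  qed
  then show ?thesis using F unfolding per2_def dq_def by (simp only: simp_thms)
qed

lemma integrable_strip: "integrable (lborel \<Otimes>\<^sub>M circle) (\<lambda>p. indicat_real {s..t::real} (fst p))"
proof -
  have m: "{s..t} \<times> UNIV \<in> sets ((lborel :: real measure) \<Otimes>\<^sub>M circle)"
    by (rule pair_measureI; simp)
  have e: "emeasure ((lborel :: real measure) \<Otimes>\<^sub>M circle) ({s..t} \<times> UNIV) = emeasure lborel {s..t} * emeasure circle UNIV"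
    by (rule circle.emeasure_pair_measure_Times; simp)
  have o: "emeasure circle UNIV = 1" using circle.emeasure_space_1 by simp
  have f: "emeasure lborel {s..t::real} * 1 < \<infinity>" by (simp add: emeasure_lborel_Icc_eq)
  have i: "indicat_real ({s..t::real} \<times> (UNIV :: real set)) = (\<lambda>p. indicat_real {s..t} (fst p))"
    by (rule ext) (simp add: indicator_def mem_Times_iff)
  have "integrable (lborel \<Otimes>\<^sub>M circle) (indicat_real ({s..t} \<times> UNIV))"
    by (rule integrable_real_indicator[OF m]) (simp only: e o f)
  then show ?thesis by (simp only: i)
qed

lemma SQ_strip_integrable:
  assumes "SQ F" shows "integrable (lborel \<Otimes>\<^sub>M circle) (\<lambda>(r, h). indicat_real {s..t} r * F r h)"
proof -
  have [measurable]: "(\<lambda>p. F (fst p) (snd p)) \<in> borel_measurable (lborel \<Otimes>\<^sub>M circle)" by (rule SQ_meas[OF assms])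
  have "integrable (lborel \<Otimes>\<^sub>M circle) (\<lambda>p. indicat_real {s..t} (fst p) * F (fst p) (snd p))"
  proof (rule integrable_mult_sq)
    have "(\<lambda>p. (indicat_real {s..t} (fst p))\<^sup>2) = (\<lambda>p::real \<times> real. indicat_real {s..t} (fst p))"
      by (auto simp: indicator_def)
    then show "integrable (lborel \<Otimes>\<^sub>M circle) (\<lambda>p. (indicat_real {s..t} (fst p))\<^sup>2)"
      using integrable_strip by simp
  qed (use SQ_integrable[OF assms] in measurable)
  then show ?thesis by (simp add: case_prod_unfold)
qed

lemma strip_Fubini:
  fixes F :: "real \<Rightarrow> real \<Rightarrow> real"
  assumes "integrable (lborel \<Otimes>\<^sub>M circle) (\<lambda>(r, h). indicat_real {s..t} r * F r h)"
  shows "(LINT h|circle. (LINT r:{s..t}|lborel. F r h)) = (LINT r:{s..t}|lborel. LINT h|circle. F r h)"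
    "integrable circle (\<lambda>h. LINT r:{s..t}|lborel. F r h)"
  using strip.Fubini_integral[OF assms] strip.integrable_snd[OF assms]
  by (simp_all add: set_lebesgue_integral_def)

text \<open>The facts about a solution that the energy argument uses, with W in the role of u_t.
  \<open>ftc\<close> is stated on the whole time line, to be met by a solution frozen outside
  \<open>{0..T}\<close>. \<open>chain\<close> holds at every time, since energies are compared at
  arbitrary times; \<open>chain4\<close> holds at almost every time and contains the equation,
  solved for the fourth derivative.\<close>

locale evolution =
  fixes T c C :: real and y W :: "real \<Rightarrow> real \<Rightarrow> real"
  assumes y_meas: "meas2 y" and y_cont: "\<And>t. continuous_on UNIV (y t)" and y_per: "\<And>t. per (y t)"
    and c: "0 < c" "\<And>t h. c \<le> y t h" and C: "\<And>t h. y t h \<le> C"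
    and W_SQ: "SQ W" and W_per: "per2 W"
    and ftc: "AE h in lborel. ac (\<lambda>t. y t h) (\<lambda>t. W t h)"
    and chain: "\<And>t. t \<in> {0..T} \<Longrightarrow> \<exists>v1 v2. periodic_chain (\<lambda>h. cub (y t h)) v1 v2"
    and chain4: "AE t in lborel. t \<in> {0..T} \<longrightarrow> (\<exists>v1 v2 v3. periodic_chain (\<lambda>h. cub (y t h)) v1 v2 \<and>
      ac v2 v3 \<and> per v3 \<and> ac v3 (\<lambda>h. - W t h / (y t h)\<^sup>2))"
begin

definition Z :: "real \<Rightarrow> real \<Rightarrow> real" where "Z t h = - W t h / (y t h)\<^sup>2"

text \<open>By the chain rule this is the time derivative of \<open>cub\<close> of y.\<close>

definition V :: "real \<Rightarrow> real \<Rightarrow> real" where "V t h = (3 * (y t h)\<^sup>2 + 1) * W t h"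

definition v :: "real \<Rightarrow> real \<Rightarrow> real" where "v t h = cub (y t h)"

lemma y_pos: "y t h > 0" using c(1) c(2)[of t h] by linarith

lemma y_per1: "y t (h + 1) = y t h" using y_per by (simp add: per_def)

lemma y2_meas: "meas2 (\<lambda>t h. (y t h)\<^sup>2)"
  using meas2_mult[OF y_meas y_meas] by (simp add: power2_eq_square)

lemma Z_SQ: "SQ Z"
proof -
  have "SQ (\<lambda>t h. - (1 / (y t h)\<^sup>2) * W t h)"
  proof (rule SQ_bmult[OF W_SQ, where B="1 / c\<^sup>2"])
    show "meas2 (\<lambda>t h. - (1 / (y t h)\<^sup>2))"
      using y2_meas unfolding meas2_def by (auto simp: case_prod_unfold)
    show "\<bar>- (1 / (y t h)\<^sup>2)\<bar> \<le> 1 / c\<^sup>2" for t h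
      using c power_mono[OF c(2)[of t h], of 2] by (simp add: frac_le)
  qed
  then show ?thesis unfolding Z_def by simp
qed

lemma V_SQ: "SQ V"
  unfolding V_def
proof (rule SQ_bmult[OF W_SQ, where B="3 * C\<^sup>2 + 1"])
  show "meas2 (\<lambda>t h. 3 * (y t h)\<^sup>2 + 1)"
    using y2_meas unfolding meas2_def by (auto simp: case_prod_unfold)
  show "\<bar>3 * (y t h)\<^sup>2 + 1\<bar> \<le> 3 * C\<^sup>2 + 1" for t h
    using power_mono[OF C[of t h], of 2] y_pos[of t h] by simp
qed

lemma Z_per: "per2 Z" and V_per: "per2 V" and v_per: "v t (h + 1) = v t h"
  using W_per by (simp_all add: per2_def Z_def V_def v_def y_per1)

lemma SQ_AE_L2p:
  assumes "SQ F" "per2 F" shows "AE t in lborel. L2p (F t)"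
proof -
  have i: "integrable (lborel \<Otimes>\<^sub>M circle) (\<lambda>(t, h). (F t h)\<^sup>2)" using assms by (simp add: SQ_def)
  show ?thesis
    using strip.AE_integrable_fst'[OF i] by eventually_elim (use SQ_per[OF assms] in \<open>simp add: L2p_def\<close>)
qed

lemmas Z_L2p = SQ_AE_L2p[OF Z_SQ Z_per] and V_L2p = SQ_AE_L2p[OF V_SQ V_per]

text \<open>The time derivative of 1/y is -W / y^2 = Z, which in space is the derivative of a
  periodic function and integrates to zero over a period.\<close>

lemma mass_conserved:
  assumes "0 \<le> s" "s \<le> t" "t \<le> T"
  shows "(LINT h|circle. 1 / y t h) = (LINT h|circle. 1 / y s h)"
proof -
  have i: "integrable circle (\<lambda>h. 1 / y r h)" for r
  proof -
    have "continuous_on UNIV (\<lambda>h. 1 / y r h)"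
      using y_pos by (intro continuous_intros y_cont) (auto simp: less_imp_neq[symmetric])
    moreover have "per (\<lambda>h. 1 / y r h)" using y_per[of r] by (auto simp: per_def)
    ultimately show ?thesis by (intro L2p_integrable L2p_continuous)
  qed
  have "AE h in circle. 1 / y t h - 1 / y s h = (LINT r:{s..t}|lborel. Z r h)"
    using AE_lborel_circle[OF ftc]
  proof eventually_elim
    case (elim h)
    have "ac (\<lambda>t. 1 / y t h) (\<lambda>t. - (1 / (y t h)\<^sup>2) * W t h)"
      by (rule ac_chain[OF elim, where I="{0<..}" and P="\<lambda>x. 1 / x" and P'="\<lambda>x. - (1 / x\<^sup>2)"])
         (auto intro!: derivative_eq_intros continuous_intros simp: y_pos power2_eq_square is_interval_io)
    then have "ac (\<lambda>t. 1 / y t h) (\<lambda>t. Z t h)" by (simp add: Z_def)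
    from ac_LINT[OF this assms(2)] show ?case .
  qed
  note ae = this
  note si = SQ_strip_integrable[OF Z_SQ, of s t]
  have "(LINT h|circle. 1 / y t h) - (LINT h|circle. 1 / y s h) = (LINT h|circle. 1 / y t h - 1 / y s h)"
    using i by simp
  also have "... = (LINT h|circle. (LINT r:{s..t}|lborel. Z r h))"
    using i borel_measurable_integrable[OF i] borel_measurable_integrable[OF strip_Fubini(2)[OF si]]
    by (intro integral_cong_AE ae) auto
  also have "... = (LINT r:{s..t}|lborel. LINT h|circle. Z r h)" by (rule strip_Fubini(1)[OF si])
  also have "... = (LINT r:{s..t}|lborel. 0)"
  proof -
    have "AE r in lborel. indicat_real {s..t} r *\<^sub>R (LINT h|circle. Z r h) = indicat_real {s..t} r *\<^sub>R 0"
      using chain4 Z_L2p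
    proof eventually_elim
      case (elim r)
      show ?case
      proof (cases "r \<in> {s..t}")
        case True
        then have "r \<in> {0..T}" using assms by auto
        then obtain v3 where v3: "per v3" "ac v3 (Z r)" using elim(1) unfolding Z_def by blast
        have "v3 (0 + 1) = v3 0" using v3 unfolding per_def by blast
        then have "(LINT h|circle. Z r h) = 0"
          using per_integral_unit[OF L2p_per[OF elim(2)] L2p_integrable[OF elim(2)], of 0] acD(2)[OF v3(2), of 0 1] by simp
        then show ?thesis by simp
      qed simp
    qed
    moreover have "(\<lambda>r. LINT h|circle. Z r h) \<in> borel_measurable lborel"
      using SQ_meas[OF Z_SQ] by (intro circle.borel_measurable_lebesgue_integral) (simp add: case_prod_unfold)
    ultimately show ?thesis
      unfolding set_lebesgue_integral_def by (intro integral_cong_AE) auto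
  qed
  finally show ?thesis by simp
qed

text \<open>The bound explodes as d tends to zero. It is used only at fixed d, to make the integrand
  of the discrete identity integrable.\<close>

lemma dq2_v_bound: "d > 0 \<Longrightarrow> \<bar>dq2 d (v t) h\<bar> \<le> 4 * cub C / d\<^sup>2"
proof -
  assume d: "d > 0"
  have b: "0 \<le> v t h \<and> v t h \<le> cub C" for h
  proof
    show "v t h \<le> cub C" unfolding v_def cub_def by (intro add_mono power_mono C less_imp_le y_pos)
    show "0 \<le> v t h" using y_pos[of t h] by (simp add: v_def cub_def)
  qed
  have "dq2 d (v t) h = (v t (h + d + d) - 2 * v t (h + d) + v t h) / d\<^sup>2"
    using d by (simp add: dq_def field_simps power2_eq_square)
  moreover have "\<bar>v t (h + d + d) - 2 * v t (h + d) + v t h\<bar> \<le> 4 * cub C"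
    using b[of "h + d + d"] b[of "h + d"] b[of h] by linarith
  ultimately show ?thesis using d by (simp add: divide_right_mono)
qed

lemma v_meas: "meas2 v"
  using y_meas unfolding v_def cub_def meas2_def by (auto simp: case_prod_unfold)

lemma v_L2p: "L2p (v t)"
proof (rule L2p_continuous)
  show "continuous_on UNIV (v t)" unfolding v_def cub_def by (intro continuous_intros y_cont)
  show "per (v t)" unfolding per_def by (intro conjI allI v_per meas2_section v_meas)
qed

lemma dq2_v_meas: "meas2 (\<lambda>t. dq2 d (v t))"
proof -
  have [measurable]: "(\<lambda>p. v (fst p) (snd p + a)) \<in> borel_measurable (borel \<Otimes>\<^sub>M borel)" for a
    by (rule meas2_compose[OF v_meas]) auto
  have e: "dq2 d (v t) h = ((v t (h + (d + d)) - v t (h + d)) / d - (v t (h + d) - v t (h + 0)) / d) / d" for t h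
    by (simp add: dq_def add.assoc)
  show ?thesis unfolding meas2_def case_prod_unfold e by measurable
qed

lemma ac_dq: "ac (\<lambda>t. F t h) (\<lambda>t. G t h) \<Longrightarrow> ac (\<lambda>t. F t (h + d)) (\<lambda>t. G t (h + d)) \<Longrightarrow>
  ac (\<lambda>t. dq d (F t) h) (\<lambda>t. dq d (G t) h)"
  using ac_cmult[OF ac_diff[of "\<lambda>t. F t (h + d)" "\<lambda>t. G t (h + d)" "\<lambda>t. F t h" "\<lambda>t. G t h"], of "1 / d"]
  unfolding dq_def by simp

lemma discrete_energy_identity:
  assumes st: "0 \<le> s" "s \<le> t" "t \<le> T" and d: "d > 0"
  shows "(LINT h|circle. (dq2 d (v t) h)\<^sup>2) - (LINT h|circle. (dq2 d (v s) h)\<^sup>2)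
    = (LINT r:{s..t}|lborel. 2 * (LINT h|circle. avg2 d (Z r) h * avg2 d (V r) h))"
proof -
  let ?B = "4 * cub C / d\<^sup>2"
  have v: "AE h in lborel. ac (\<lambda>t. v t h) (\<lambda>t. V t h)"
    using ftc
  proof eventually_elim
    case (elim h)
    show ?case unfolding v_def V_def
      by (rule ac_chain[OF elim, where I=UNIV and P=cub and P'="\<lambda>x. 3 * x\<^sup>2 + 1"])
         (auto intro!: derivative_eq_intros continuous_intros simp: cub_def[abs_def])
  qed
  \<comment> \<open>A second quotient at h involves the points h, h + d and h + 2 d, so three null
    sets are joined.\<close>
  have "AE h in lborel. ac (\<lambda>t. dq2 d (v t) h) (\<lambda>t. dq2 d (V t) h)"
    using v AE_shift[OF v, of d] AE_shift[OF v, of "d + d"]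
    by eventually_elim (intro ac_dq; simp add: add.assoc)
  from AE_lborel_circle[OF this]
  have ae: "AE h in circle. (dq2 d (v t) h)\<^sup>2 - (dq2 d (v s) h)\<^sup>2
      = (LINT r:{s..t}|lborel. 2 * dq2 d (v r) h * dq2 d (V r) h)"
    by eventually_elim (intro ac_LINT ac_square st(2))
  have dV: "SQ (\<lambda>t. dq2 d (V t))"
    by (intro SQ_dq per2_dq V_SQ V_per)
  have "SQ (\<lambda>r h. 2 * dq2 d (v r) h * dq2 d (V r) h)"
  proof (rule SQ_bmult[OF dV, where B="2 * ?B"])
    show "meas2 (\<lambda>t h. 2 * dq2 d (v t) h)"
      using dq2_v_meas[of d] unfolding meas2_def by (auto simp: case_prod_unfold)
    show "\<bar>2 * dq2 d (v t) h\<bar> \<le> 2 * ?B" for t h using dq2_v_bound[OF d, of t h] by (simp add: abs_mult)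
  qed
  note si = SQ_strip_integrable[OF this, of s t]
  have i: "integrable circle (\<lambda>h. (dq2 d (v r) h)\<^sup>2)" for r by (intro L2p_sq dq_L2 v_L2p)
  have "(LINT h|circle. (dq2 d (v t) h)\<^sup>2) - (LINT h|circle. (dq2 d (v s) h)\<^sup>2)
      = (LINT h|circle. (dq2 d (v t) h)\<^sup>2 - (dq2 d (v s) h)\<^sup>2)" using i by simp
  also have "... = (LINT h|circle. (LINT r:{s..t}|lborel. 2 * dq2 d (v r) h * dq2 d (V r) h))"
    using borel_measurable_integrable[OF i] borel_measurable_integrable[OF strip_Fubini(2)[OF si]]
    by (intro integral_cong_AE ae) auto
  also have "... = (LINT r:{s..t}|lborel. LINT h|circle. 2 * dq2 d (v r) h * dq2 d (V r) h)"
    by (rule strip_Fubini(1)[OF si])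
  also have "... = (LINT r:{s..t}|lborel. 2 * (LINT h|circle. avg2 d (Z r) h * avg2 d (V r) h))"
  proof -
    have "AE r in lborel. indicat_real {s..t} r *\<^sub>R (LINT h|circle. 2 * dq2 d (v r) h * dq2 d (V r) h)
        = indicat_real {s..t} r *\<^sub>R (2 * (LINT h|circle. avg2 d (Z r) h * avg2 d (V r) h))"
      using chain4 Z_L2p V_L2p
    proof eventually_elim
      case (elim r)
      show ?case
      proof (cases "r \<in> {s..t}")
        case True
        then have "r \<in> {0..T}" using st by auto
        then obtain v1 v2 v3 where ch: "periodic_chain (v r) v1 v2" "ac v2 v3" "ac v3 (Z r)"
          using elim(1) unfolding Z_def v_def by blast
        interpret periodic_chain "v r" v1 v2 by (rule ch(1))
        have "(LINT h|circle. dq2 d (v r) h * dq2 d (V r) h) = (LINT h|circle. avg2 d (Z r) h * avg2 d (V r) h)"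
          by (rule dq2_pairing[OF v(2) v1(2) ch(2,3) v_L2p v2 elim(2,3) d])
        then show ?thesis by (simp add: mult.assoc)
      qed simp
    qed
    moreover have "(\<lambda>r. LINT h|circle. 2 * dq2 d (v r) h * dq2 d (V r) h) \<in> borel_measurable lborel"
    proof (intro circle.borel_measurable_lebesgue_integral)
      have [measurable]: "(\<lambda>p. dq2 d (v (fst p)) (snd p)) \<in> borel_measurable (lborel \<Otimes>\<^sub>M circle)"
        by (rule meas2_compose[OF dq2_v_meas]) auto
      have [measurable]: "(\<lambda>p. dq2 d (V (fst p)) (snd p)) \<in> borel_measurable (lborel \<Otimes>\<^sub>M circle)" by (rule SQ_meas[OF dV])
      show "(\<lambda>(r, h). 2 * dq2 d (v r) h * dq2 d (V r) h) \<in> borel_measurable (lborel \<Otimes>\<^sub>M circle)"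
        unfolding case_prod_unfold by measurable
    qed
    moreover have "(\<lambda>r. 2 * (LINT h|circle. avg2 d (Z r) h * avg2 d (V r) h)) \<in> borel_measurable lborel"
    proof -
      \<comment> \<open>\<open>avg2\<close> hides two nested parameter integrals; these rules let
        joint measurability pass through them.\<close>
      have [measurable (raw)]: "(\<lambda>x. F (f x) (g x)) \<in> borel_measurable M"
        if "F = Z \<or> F = V" "f \<in> borel_measurable M" "g \<in> borel_measurable M" for F f g and M :: "'x measure"
        using that Z_SQ V_SQ by (intro meas2_compose[of F]) (auto simp: SQ_def)
      have [measurable]: "(\<lambda>p. avg2 d (F (fst p)) (snd p)) \<in> borel_measurable (borel \<Otimes>\<^sub>M borel)" if "F = Z \<or> F = V" for F
        unfolding avg_def
        by (intro circle.borel_measurable_lebesgue_integral) (use that in \<open>auto simp: case_prod_unfold intro!: circle.borel_measurable_lebesgue_integral\<close>)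
      show ?thesis
        by (intro borel_measurable_times borel_measurable_const circle.borel_measurable_lebesgue_integral) (simp add: case_prod_unfold)
    qed
    ultimately show ?thesis
      unfolding set_lebesgue_integral_def by (intro integral_cong_AE borel_measurable_scaleR) auto
  qed
  finally show ?thesis .
qed

text \<open>The discrete identity is passed to the limit in the step, on the left by convergence of
  averages at times s and t, on the right by dominated convergence in time. Pointwise Z V = -(3 y^2
  + 1) y^2 Z^2 <= -m^2 Z^2. The choice m = 0 is allowed and gives monotonicity.\<close>

lemma energy_inequality:
  assumes st: "0 \<le> s" "s \<le> t" "t \<le> T"
    and ch: "periodic_chain (v t) a1 a2" "periodic_chain (v s) b1 b2"
    and m: "m \<ge> 0" "\<And>r h. r \<in> {s..t} \<Longrightarrow> m \<le> y r h"
  shows "(LINT h|circle. (a2 h)\<^sup>2) + 2 * m\<^sup>2 * (LINT r:{s..t}|lborel. LINT h|circle. (Z r h)\<^sup>2) \<le> (LINT h|circle. (b2 h)\<^sup>2)"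
    and "set_integrable lborel {s..t} (\<lambda>r. LINT h|circle. (Z r h)\<^sup>2)"
proof -
  have lhs: "(\<lambda>n. LINT h|circle. (dq2 (dl n) (v r) h)\<^sup>2) \<longlonglongrightarrow> (LINT h|circle. (g2 h)\<^sup>2)"
    if "periodic_chain (v r) g1 g2" for r g1 g2
  proof -
    interpret periodic_chain "v r" g1 g2 by (rule that)
    show ?thesis
      using avg2_ip_tendsto[OF v2 v2] dq2_ac[OF v(2) v1(2) dl_pos] by (simp add: power2_eq_square)
  qed
  let ?N = "\<lambda>F r. LINT h|circle. (F r h)\<^sup>2"
  have iN: "integrable lborel (?N F)" if "SQ F" for F
    using strip.integrable_fst'[of "\<lambda>(t, h). (F t h)\<^sup>2"] that by (simp add: SQ_def)
  have L2: "AE r in lborel. L2p (Z r) \<and> L2p (V r)" using Z_L2p V_L2p by eventually_elim simp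
  have mint: "(\<lambda>r. LINT h|circle. F r h * G r h) \<in> borel_measurable lborel" if "SQ F" "SQ G" for F G
  proof (intro circle.borel_measurable_lebesgue_integral)
    have [measurable]: "(\<lambda>p. F (fst p) (snd p)) \<in> borel_measurable (lborel \<Otimes>\<^sub>M circle)"
      "(\<lambda>p. G (fst p) (snd p)) \<in> borel_measurable (lborel \<Otimes>\<^sub>M circle)" using that SQ_meas by auto
    show "(\<lambda>(r, h). F r h * G r h) \<in> borel_measurable (lborel \<Otimes>\<^sub>M circle)"
      unfolding case_prod_unfold by measurable
  qed
  let ?P = "\<lambda>r. LINT h|circle. Z r h * V r h"
  let ?Q = "\<lambda>n r. LINT h|circle. avg2 (dl n) (Z r) h * avg2 (dl n) (V r) h"
  have mQ: "?Q n \<in> borel_measurable lborel" for n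
  proof -
    have [measurable (raw)]: "(\<lambda>x. F (f x) (g x)) \<in> borel_measurable M"
      if "F = Z \<or> F = V" "f \<in> borel_measurable M" "g \<in> borel_measurable M" for F f g and M :: "'x measure"
      using that Z_SQ V_SQ by (intro meas2_compose[of F]) (auto simp: SQ_def)
    have [measurable]: "(\<lambda>p. avg2 (dl n) (F (fst p)) (snd p)) \<in> borel_measurable (borel \<Otimes>\<^sub>M borel)" if "F = Z \<or> F = V" for F
      unfolding avg_def
      by (intro circle.borel_measurable_lebesgue_integral) (use that in \<open>auto simp: case_prod_unfold intro!: circle.borel_measurable_lebesgue_integral\<close>)
    show ?thesis
      by (intro circle.borel_measurable_lebesgue_integral) (simp add: case_prod_unfold)
  qed
  have rhs: "(\<lambda>n. LINT r:{s..t}|lborel. 2 * ?Q n r) \<longlonglongrightarrow> (LINT r:{s..t}|lborel. 2 * ?P r)"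
    unfolding set_lebesgue_integral_def
  \<comment> \<open>The bound of \<open>avg2_ip_bound\<close>, doubled, is independent of n and
    integrable in time because Z and V are square integrable.\<close>
  proof (rule integral_dominated_convergence[where w="\<lambda>r. ?N Z r + ?N V r"])
    show "integrable lborel (\<lambda>r. ?N Z r + ?N V r)" using iN Z_SQ V_SQ by auto
    show "AE r in lborel. (\<lambda>n. indicat_real {s..t} r *\<^sub>R (2 * ?Q n r)) \<longlonglongrightarrow> indicat_real {s..t} r *\<^sub>R (2 * ?P r)"
      using L2 by eventually_elim (intro tendsto_intros avg2_ip_tendsto; simp)
    show "AE r in lborel. norm (indicat_real {s..t} r *\<^sub>R (2 * ?Q n r)) \<le> ?N Z r + ?N V r" for n
      using L2
    proof eventually_elim
      case (elim r)
      have "\<bar>?Q n r\<bar> \<le> (?N Z r + ?N V r) / 2" using elim by (intro avg2_ip_bound dl_pos) auto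
      then have "2 * \<bar>?Q n r\<bar> \<le> ?N Z r + ?N V r" by simp
      moreover have "norm (indicat_real {s..t} r *\<^sub>R (2 * ?Q n r)) \<le> 2 * \<bar>?Q n r\<bar>"
        by (auto simp: indicator_def abs_mult)
      ultimately show ?case by (rule order_trans[rotated])
    qed
  qed (use mQ mint[OF Z_SQ V_SQ] in measurable)
  have "(\<lambda>n. (LINT h|circle. (dq2 (dl n) (v t) h)\<^sup>2) - (LINT h|circle. (dq2 (dl n) (v s) h)\<^sup>2))
      \<longlonglongrightarrow> (LINT h|circle. (a2 h)\<^sup>2) - (LINT h|circle. (b2 h)\<^sup>2)"
    by (rule tendsto_diff[OF lhs[OF ch(1)] lhs[OF ch(2)]])
  then have "(\<lambda>n. LINT r:{s..t}|lborel. 2 * ?Q n r) \<longlonglongrightarrow> (LINT h|circle. (a2 h)\<^sup>2) - (LINT h|circle. (b2 h)\<^sup>2)"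
    using discrete_energy_identity[OF st dl_pos] by simp
  from LIMSEQ_unique[OF this rhs]
  have id: "(LINT h|circle. (a2 h)\<^sup>2) - (LINT h|circle. (b2 h)\<^sup>2) = (LINT r:{s..t}|lborel. 2 * ?P r)" .
  have siZ: "set_integrable lborel {s..t} (?N Z)"
    unfolding set_integrable_def by (rule integrable_mult_indicator) (use iN[OF Z_SQ] in auto)
  show "set_integrable lborel {s..t} (\<lambda>r. LINT h|circle. (Z r h)\<^sup>2)" by (rule siZ)
  have "(LINT r:{s..t}|lborel. 2 * ?P r) \<le> (LINT r:{s..t}|lborel. - (2 * m\<^sup>2) * ?N Z r)"
    unfolding set_lebesgue_integral_def
  proof (rule integral_mono_AE)
    show "integrable lborel (\<lambda>r. indicat_real {s..t} r *\<^sub>R (- (2 * m\<^sup>2) * ?N Z r))"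
      using siZ set_integrable_mult_right[of "- (2 * m\<^sup>2)" lborel "{s..t}" "?N Z"] by (simp add: set_integrable_def)
    show "integrable lborel (\<lambda>r. indicat_real {s..t} r *\<^sub>R (2 * ?P r))"
    proof (rule Bochner_Integration.integrable_bound)
      show "integrable lborel (\<lambda>r. ?N Z r + ?N V r)" using iN Z_SQ V_SQ by auto
      show "AE r in lborel. norm (indicat_real {s..t} r *\<^sub>R (2 * ?P r)) \<le> norm (?N Z r + ?N V r)"
        using L2
      proof eventually_elim
        case (elim r)
        have "\<bar>?P r\<bar> \<le> (?N Z r + ?N V r) / 2" using elim by (intro ip_young) auto
        then have "2 * \<bar>?P r\<bar> \<le> norm (?N Z r + ?N V r)" by simp
        moreover have "norm (indicat_real {s..t} r *\<^sub>R (2 * ?P r)) \<le> 2 * \<bar>?P r\<bar>"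
          by (auto simp: indicator_def abs_mult)
        ultimately show ?case by (rule order_trans[rotated])
      qed
    qed (use mint[OF Z_SQ V_SQ] in measurable)
    show "AE r in lborel. indicat_real {s..t} r *\<^sub>R (2 * ?P r) \<le> indicat_real {s..t} r *\<^sub>R (- (2 * m\<^sup>2) * ?N Z r)"
      using L2
    proof eventually_elim
      case (elim r)
      show ?case
      proof (cases "r \<in> {s..t}")
        case True
        have "?P r \<le> (LINT h|circle. - m\<^sup>2 * (Z r h)\<^sup>2)"
        proof (rule integral_mono)
          show "integrable circle (\<lambda>h. Z r h * V r h)" using elim L2p_mult by blast
          show "integrable circle (\<lambda>h. - m\<^sup>2 * (Z r h)\<^sup>2)" using elim L2p_sq by auto
          fix h
          have W: "W r h = - (y r h)\<^sup>2 * Z r h" using y_pos[of r h] by (simp add: Z_def)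
          have "Z r h * V r h = - ((3 * (y r h)\<^sup>2 + 1) * (y r h)\<^sup>2) * (Z r h)\<^sup>2"
            unfolding V_def W by (simp add: power2_eq_square)
          also have "... \<le> - m\<^sup>2 * (Z r h)\<^sup>2"
          proof (rule mult_right_mono)
            have "m\<^sup>2 \<le> (y r h)\<^sup>2" using m True by (intro power_mono) auto
            also have "... = 1 * (y r h)\<^sup>2" by simp
            also have "... \<le> (3 * (y r h)\<^sup>2 + 1) * (y r h)\<^sup>2" by (intro mult_right_mono) auto
            finally show "- ((3 * (y r h)\<^sup>2 + 1) * (y r h)\<^sup>2) \<le> - m\<^sup>2" by simp
          qed simp
          finally show "Z r h * V r h \<le> - m\<^sup>2 * (Z r h)\<^sup>2" .
        qed
        also have "... = - m\<^sup>2 * ?N Z r" by simp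
        finally show ?thesis using True by simp
      qed simp
    qed
  qed
  also have "... = - (2 * m\<^sup>2) * (LINT r:{s..t}|lborel. ?N Z r)" by (rule set_integral_mult_right)
  finally show "(LINT h|circle. (a2 h)\<^sup>2) + 2 * m\<^sup>2 * (LINT r:{s..t}|lborel. LINT h|circle. (Z r h)\<^sup>2) \<le> (LINT h|circle. (b2 h)\<^sup>2)"
    using id by linarith
qed

lemma energy_antimono:
  assumes "0 \<le> s" "s \<le> t" "t \<le> T" "periodic_chain (v t) a1 a2" "periodic_chain (v s) b1 b2"
  shows "(LINT h|circle. (a2 h)\<^sup>2) \<le> (LINT h|circle. (b2 h)\<^sup>2)"
  using energy_inequality(1)[OF assms, of 0] y_pos by (simp add: less_imp_le)

text \<open>For almost every r in [s, t] monotonicity and \<open>E_le_fourth\<close> bound the final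
  energy by the integral of Z(r)^2. Integrating in r gives an estimate as for an implicit Euler
  step, without differentiating the energy.\<close>

lemma energy_decay:
  assumes st: "0 \<le> s" "s \<le> t" "t \<le> T"
    and ch: "periodic_chain (v t) a1 a2" "periodic_chain (v s) b1 b2"
    and m: "m \<ge> 0" "\<And>r h. r \<in> {s..t} \<Longrightarrow> m \<le> y r h"
  shows "(LINT h|circle. (a2 h)\<^sup>2) * (1 + 2 * m\<^sup>2 * (t - s)) \<le> (LINT h|circle. (b2 h)\<^sup>2)"
proof -
  let ?E = "LINT h|circle. (a2 h)\<^sup>2"
  have "?E * (t - s) = (LINT r:{s..t}|lborel. ?E)"
    using st by (simp add: set_integral_const)
  also have "... \<le> (LINT r:{s..t}|lborel. LINT h|circle. (Z r h)\<^sup>2)"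
  proof (rule set_integral_mono_AE)
    show "set_integrable lborel {s..t} (\<lambda>_. ?E)" using loc_int_cont[of "\<lambda>_. ?E"] by (simp add: loc_int_def)
    show "set_integrable lborel {s..t} (\<lambda>r. LINT h|circle. (Z r h)\<^sup>2)" by (rule energy_inequality(2)[OF assms])
    show "AE r\<in>{s..t} in lborel. ?E \<le> (LINT h|circle. (Z r h)\<^sup>2)"
      using chain4 Z_L2p
    proof eventually_elim
      case (elim r)
      show ?case
      proof
        assume r: "r \<in> {s..t}"
        then obtain v1 v2 v3 where c4: "periodic_chain (v r) v1 v2" "ac v2 v3" "per v3" "ac v3 (Z r)"
          using elim(1) st unfolding Z_def v_def by (meson atLeastAtMost_iff order_trans)
        interpret periodic_chain "v r" v1 v2 by (rule c4(1))
        have "?E \<le> (LINT h|circle. (v2 h)\<^sup>2)"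
          using r st by (intro energy_antimono[OF _ _ _ ch(1) c4(1)]) auto
        also have "... \<le> (LINT h|circle. (Z r h)\<^sup>2)" by (rule E_le_fourth[OF c4(2,4) elim(2) c4(3)])
        finally show "?E \<le> (LINT h|circle. (Z r h)\<^sup>2)" .
      qed
    qed
  qed
  finally have "2 * m\<^sup>2 * (?E * (t - s)) \<le> 2 * m\<^sup>2 * (LINT r:{s..t}|lborel. LINT h|circle. (Z r h)\<^sup>2)"
    by (intro mult_left_mono) auto
  with energy_inequality(1)[OF assms] show ?thesis by (simp add: algebra_simps)
qed

end

section \<open>Approximation of the identity and the Sobolev norm\<close>

lemma deriv_step_continuous: "continuous_on A (deriv step)"
  by (intro smooth_continuous_on smooth_deriv step)

lemma deriv_step_integral: "integrable lborel (deriv step)" "(LINT s|lborel. deriv step s) = 1"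
proof -
  have one: "loc_int (\<lambda>_. 1)" by (rule loc_int_cont) (rule continuous_on_const)
  have "ac step (deriv step)" by (intro ac_deriv smooth_has_deriv step deriv_step_continuous)
  then have "integral {0..1} (deriv step) = 1" using acD(2)[of step "deriv step" 0 1] step by simp
  then show "integrable lborel (deriv step)" "(LINT s|lborel. deriv step s) = 1"
    using loc_int_test[OF one deriv_step_continuous deriv_step_outside] by auto
qed

text \<open>The substitution t = a + s / (n+1) moves the scaling from the kernel into the bounded
  continuous F, and dominated convergence applies to a kernel of integral one.\<close>

lemma approximate_identity:
  assumes F: "continuous_on UNIV F" "\<And>t. \<bar>F t\<bar> \<le> B"
  shows "integrable lborel (\<lambda>t. F t * (real (Suc n) * deriv step (real (Suc n) * (t - a))))"
    "(\<lambda>n. LINT t|lborel. F t * (real (Suc n) * deriv step (real (Suc n) * (t - a)))) \<longlonglongrightarrow> F a"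
proof -
  let ?th = "deriv step"
  have [measurable]: "F \<in> borel_measurable borel" "?th \<in> borel_measurable borel"
    using F(1) deriv_step_continuous by (auto intro: borel_measurable_continuous_onI)
  have th: "integrable lborel ?th" by (rule deriv_step_integral)
  have i: "integrable lborel (\<lambda>s. F (a + s / real (Suc n)) * ?th s)" for n
  proof (rule Bochner_Integration.integrable_bound)
    show "integrable lborel (\<lambda>s. B * ?th s)" using th by simp
    have "0 \<le> B" using F(2)[of 0] by linarith
    then show "AE s in lborel. norm (F (a + s / real (Suc n)) * ?th s) \<le> norm (B * ?th s)"
      using F(2) by (intro AE_I2) (simp add: abs_mult mult_right_mono)
  qed measurable
  have sub: "F (a + s / real (Suc n)) * ?th s
      = F (a + 1 / real (Suc n) * s) * ?th (real (Suc n) * ((a + 1 / real (Suc n) * s) - a))" for s n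
    by (simp del: of_nat_Suc)
  show "integrable lborel (\<lambda>t. F t * (real (Suc n) * ?th (real (Suc n) * (t - a))))"
  proof -
    have "integrable lborel (\<lambda>s. F (a + 1 / real (Suc n) * s) * ?th (real (Suc n) * ((a + 1 / real (Suc n) * s) - a)))"
      using i[of n] unfolding sub .
    then have "integrable lborel (\<lambda>t. F t * ?th (real (Suc n) * (t - a)))"
      by (subst (asm) lborel_integrable_real_affine_iff[of "1 / real (Suc n)" "\<lambda>t. F t * ?th (real (Suc n) * (t - a))" a]) auto
    then have "integrable lborel (\<lambda>t. real (Suc n) * (F t * ?th (real (Suc n) * (t - a))))" by simp
    then show ?thesis by (simp only: mult.left_commute)
  qed
  have eq: "(LINT t|lborel. F t * (real (Suc n) * ?th (real (Suc n) * (t - a)))) = (LINT s|lborel. F (a + s / real (Suc n)) * ?th s)" for n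
  proof -
    have "(LINT t|lborel. F t * (real (Suc n) * ?th (real (Suc n) * (t - a))))
        = real (Suc n) * (LINT t|lborel. F t * ?th (real (Suc n) * (t - a)))"
      by (simp only: mult.left_commute[of _ "real (Suc n)"] integral_mult_right_zero)
    also have "(LINT t|lborel. F t * ?th (real (Suc n) * (t - a)))
        = (1 / real (Suc n)) * (LINT s|lborel. F (a + s / real (Suc n)) * ?th s)"
      unfolding sub
      by (subst lborel_integral_real_affine[of "1 / real (Suc n)" _ a]) (auto simp del: of_nat_Suc)
    finally show ?thesis by (simp del: of_nat_Suc)
  qed
  have "(\<lambda>n. LINT s|lborel. F (a + s / real (Suc n)) * ?th s) \<longlonglongrightarrow> (LINT s|lborel. F a * ?th s)"
  proof (rule integral_dominated_convergence[where w="\<lambda>s. B * \<bar>?th s\<bar>"])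
    show "integrable lborel (\<lambda>s. B * \<bar>?th s\<bar>)" using th by simp
    show "AE s in lborel. norm (F (a + s / real (Suc n)) * ?th s) \<le> B * \<bar>?th s\<bar>" for n
      using F(2) by (intro AE_I2) (simp add: abs_mult mult_right_mono)
    show "AE s in lborel. (\<lambda>n. F (a + s / real (Suc n)) * ?th s) \<longlonglongrightarrow> F a * ?th s"
    proof (intro AE_I2 tendsto_mult tendsto_const)
      fix s
      have "(\<lambda>n. a + s / real (Suc n)) \<longlonglongrightarrow> a + 0"
        by (intro tendsto_add tendsto_const LIMSEQ_Suc lim_const_over_n)
      then show "(\<lambda>n. F (a + s / real (Suc n))) \<longlonglongrightarrow> F a"
        using F(1) by (intro continuous_on_tendsto_compose[OF F(1)]) auto
    qed
  qed measurable
  then show "(\<lambda>n. LINT t|lborel. F t * (real (Suc n) * ?th (real (Suc n) * (t - a)))) \<longlonglongrightarrow> F a"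
    unfolding eq using deriv_step_integral(2) by simp
qed

lemma deriv_plateau:
  "deriv (plateau a b n) t = real (Suc n) * deriv step (real (Suc n) * (t - a)) - real (Suc n) * deriv step (real (Suc n) * (t - b))"
proof (rule DERIV_imp_deriv)
  have "((\<lambda>t. step (real (Suc n) * (t - c))) has_field_derivative real (Suc n) * deriv step (real (Suc n) * (t - c))) (at t)" for c
  proof -
    have "((\<lambda>t. real (Suc n) * (t - c)) has_field_derivative real (Suc n)) (at t)"
      by (auto intro!: derivative_eq_intros simp del: of_nat_Suc)
    from DERIV_chain2[OF smooth_has_deriv[OF step(1)] this] show ?thesis by (simp only: mult.commute)
  qed
  then show "(plateau a b n has_field_derivative real (Suc n) * deriv step (real (Suc n) * (t - a)) - real (Suc n) * deriv step (real (Suc n) * (t - b))) (at t)"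
    unfolding plateau_def[abs_def] by (intro DERIV_diff)
qed

lemma plateau_deriv_tendsto:
  assumes F: "continuous_on UNIV F" "\<And>t. \<bar>F t\<bar> \<le> B"
  shows "(\<lambda>n. LINT t|lborel. F t * deriv (plateau a b n) t) \<longlonglongrightarrow> F a - F b"
proof -
  have eq: "F t * deriv (plateau a b n) t = F t * (real (Suc n) * deriv step (real (Suc n) * (t - a)))
      - F t * (real (Suc n) * deriv step (real (Suc n) * (t - b)))" for t n
    by (simp only: deriv_plateau right_diff_distrib[of "F t"])
  show ?thesis
  unfolding eq
  by (subst Bochner_Integration.integral_diff[OF approximate_identity(1)[OF F] approximate_identity(1)[OF F]])
     (intro tendsto_diff approximate_identity(2)[OF F])
qed

section \<open>Null sets and integrals between Borel and Lebesgue measurability\<close>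

lemma AE_frac:
  fixes P :: "real \<Rightarrow> bool"
  assumes "AE h in lborel. h \<in> {0..<1} \<longrightarrow> P h" shows "AE h in lborel. P (frac h)"
proof -
  have "AE h in lborel. (h + of_int k) \<in> {0..<1} \<longrightarrow> P (h + of_int k)" for k :: int
    by (rule AE_shift[OF assms])
  then have "AE h in lborel. \<forall>k::int. (h + of_int k) \<in> {0..<1} \<longrightarrow> P (h + of_int k)"
    by (simp add: AE_all_countable)
  then show ?thesis
  proof eventually_elim
    case (elim h)
    have "frac h = h + of_int (- \<lfloor>h\<rfloor>)" by (simp add: frac_def)
    then show ?case using elim[rule_format, of "- \<lfloor>h\<rfloor>"] frac_lt_1[of h] frac_ge_0[of h] by auto
  qed
qed

text \<open>P need not be measurable; Fubini is applied to a Borel null set containing the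
  exceptional points.\<close>

lemma AE_swap:
  fixes P :: "real \<times> real \<Rightarrow> bool"
  assumes "AE p in lborel. P p"
  shows "AE t in lborel. AE h in lborel. P (t, h)" "AE h in lborel. AE t in lborel. P (t, h)"
proof -
  obtain N where N: "N \<in> null_sets lborel" "{p. \<not> P p} \<subseteq> N"
    using assms unfolding eventually_ae_filter by auto
  have Ns: "N \<in> sets (lborel \<Otimes>\<^sub>M lborel)" using null_setsD2[OF N(1)] by (simp only: lborel_prod)
  have "AE p in lborel. p \<notin> N" using N(1) by (rule AE_not_in)
  then have "AE p in lborel \<Otimes>\<^sub>M lborel. p \<notin> N" by (simp only: lborel_prod)
  from lborel_pair.AE_pair[OF this] have 1: "AE t in lborel. AE h in lborel. (t, h) \<notin> N" .
  moreover have "(AE t in lborel. AE h in lborel. (t, h) \<notin> N) \<longleftrightarrow> (AE h in lborel. AE t in lborel. (t, h) \<notin> N)"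
  proof (rule lborel_pair.AE_commute)
    have "{x \<in> space (lborel \<Otimes>\<^sub>M lborel). (fst x, snd x) \<notin> N} = space (lborel \<Otimes>\<^sub>M lborel) - N" by auto
    then show "{x \<in> space (lborel \<Otimes>\<^sub>M lborel). (fst x, snd x) \<notin> N} \<in> sets (lborel \<Otimes>\<^sub>M lborel)"
      using sets.compl_sets[OF Ns] by (simp only: )
  qed
  ultimately have 2: "AE h in lborel. AE t in lborel. (t, h) \<notin> N" by simp
  have *: "(t, h) \<notin> N \<Longrightarrow> P (t, h)" for t h using N(2) by blast
  show "AE t in lborel. AE h in lborel. P (t, h)"
    using 1 by (rule eventually_mono) (erule eventually_mono, rule *)
  show "AE h in lborel. AE t in lborel. P (t, h)"
    using 2 by (rule eventually_mono) (erule eventually_mono, rule *)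
qed

text \<open>Measurability of f follows from completeness. This serves time slices at fixed h, which
  come with no measurability of their own.\<close>

lemma lebesgue_integral_AE_borel:
  fixes f g :: "real \<Rightarrow> real"
  assumes g: "g \<in> borel_measurable borel" "AE x in lborel. g x = f x"
  shows "(LINT x|lebesgue. f x) = (LINT x|lborel. g x)"
proof -
  have g': "g \<in> borel_measurable lebesgue" by (rule measurable_completion) (use g(1) in simp)
  have ae: "AE x in lebesgue. g x = f x" using g(2) by (simp add: AE_lebesgue_iff)
  have "f \<in> borel_measurable lebesgue" by (rule borel_measurable_AE[OF g' ae])
  then have "(LINT x|lebesgue. f x) = (LINT x|lebesgue. g x)"
    using g' ae by (intro integral_cong_AE) (auto elim: eventually_mono)
  also have "... = (LINT x|lborel. g x)" by (rule integral_completion) (use g(1) in simp)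
  finally show ?thesis .
qed

text \<open>The second part is the one-dimensional Sobolev embedding: f(x)^2 is at most 2 f(z)^2
  plus twice the integral of f1^2, and this is averaged over z.\<close>

lemma H_norm_chain:
  assumes "ac f f1" "ac f1 f2" "per f" "per f1" "L2p f2"
  shows "(H_norm 2 f)\<^sup>2 = (LINT x|circle. (f x)\<^sup>2) + (LINT x|circle. (f1 x)\<^sup>2) + (LINT x|circle. (f2 x)\<^sup>2)"
    and "\<bar>f x\<bar> \<le> sqrt 2 * H_norm 2 f"
proof -
  have L: "L2p f" "L2p f1" using assms L2p_continuous ac_continuous by blast+
  have l: "loc_int f" "loc_int f1" "loc_int f2" using L assms(5) L2p_loc_int by blast+
  have w: "has_weak_deriv 0 f f" "has_weak_deriv (Suc 0) f f1" "has_weak_deriv (Suc (Suc 0)) f f2"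
    using has_weak_deriv_0[OF l(1)] ac_has_weak_deriv_Suc assms l by blast+
  have sq: "(LINT h:{0..1}|lebesgue. (weak_deriv k f h)\<^sup>2) = (LINT x|circle. (g x)\<^sup>2)"
    if "has_weak_deriv k f g" "L2p g" for k g
    using LINT_weak_deriv_square[OF that(1) L2p_loc_int[OF that(2)]] L2p_measurable[OF that(2)]
    by (simp add: integral_circle)
  let ?N = "\<lambda>f. LINT x|circle. (f x)\<^sup>2"
  have N: "?N g \<ge> 0" for g :: "real \<Rightarrow> real" by (rule Bochner_Integration.integral_nonneg) simp
  have "H_norm 2 f = sqrt (?N f + ?N f1 + ?N f2)"
    unfolding H_norm_def using sq[OF w(1) L(1)] sq[OF w(2) L(2)] sq[OF w(3) assms(5)]
    by (simp add: numeral_2_eq_2)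
  then show H: "(H_norm 2 f)\<^sup>2 = ?N f + ?N f1 + ?N f2"
    using N[of f] N[of f1] N[of f2] by simp
  have osc: "(f z - f x)\<^sup>2 \<le> ?N f1" for z
  proof (rule per_global[OF assms(3), where P="\<lambda>y. (y - f x)\<^sup>2 \<le> ?N f1" and a=x])
    fix s :: real assume s: "0 \<le> s" "s \<le> 1"
    have "(f (x + s) - f x)\<^sup>2 = (integral {x..x+s} f1)\<^sup>2" using acD(2)[OF assms(1), of x "x + s"] s by simp
    also have "... \<le> s * integral {x..x+s} (\<lambda>x. (f1 x)\<^sup>2)"
      using integral_square_le[OF l(2) L2p_loc_int_sq[OF L(2)], of x "x + s"] s by simp
    also have "... \<le> 1 * integral {x..x+1} (\<lambda>x. (f1 x)\<^sup>2)"
      using s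
      by (intro mult_mono integral_subset_le loc_int_HK(1) L2p_loc_int_sq L Henstock_Kurzweil_Integration.integral_nonneg) auto
    also have "... = ?N f1" using per_integral_unit[OF per_square[OF assms(4)] L2p_sq[OF L(2)]] by simp
    finally show "(f (x + s) - f x)\<^sup>2 \<le> ?N f1" .
  qed
  have "(f x)\<^sup>2 = (LINT z|circle. (f x)\<^sup>2)" by simp
  also have "... \<le> (LINT z|circle. 2 * (f z)\<^sup>2 + 2 * ?N f1)"
  proof (rule integral_mono)
    fix z
    have "(f x)\<^sup>2 = (f z + (f x - f z))\<^sup>2" by simp
    also have "... \<le> 2 * (f z)\<^sup>2 + 2 * (f x - f z)\<^sup>2"
      using sum_squares_bound[of "f z" "f x - f z"] by (simp only: power2_sum)
    also have "... \<le> 2 * (f z)\<^sup>2 + 2 * ?N f1" using osc[of z] by (simp add: power2_commute)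
    finally show "(f x)\<^sup>2 \<le> 2 * (f z)\<^sup>2 + 2 * ?N f1" .
  qed (use L2p_sq[OF L(1)] in auto)
  also have "... = 2 * ?N f + 2 * ?N f1" using L2p_sq[OF L(1)] by simp
  also have "... \<le> 2 * (H_norm 2 f)\<^sup>2" using H N[of f2] by simp
  also have "... = (sqrt 2 * H_norm 2 f)\<^sup>2" by (simp add: power_mult_distrib)
  finally have "\<bar>f x\<bar> \<le> \<bar>sqrt 2 * H_norm 2 f\<bar>" by (simp add: abs_le_square_iff)
  moreover have "H_norm 2 f \<ge> 0" unfolding H_norm_def
    by (intro real_sqrt_ge_zero sum_nonneg) (auto simp: set_lebesgue_integral_def intro!: Bochner_Integration.integral_nonneg)
  ultimately show "\<bar>f x\<bar> \<le> sqrt 2 * H_norm 2 f" by simp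
qed

lemma H_per2_chain:
  assumes "f \<in> H_per 2" "continuous_on UNIV f"
  obtains f1 f2 where "ac f f1" "ac f1 f2" "per f" "per f1" "L2p f2"
proof -
  obtain G where G: "G 0 = f" "\<And>k. k < 2 \<Longrightarrow> ac (G k) (G (Suc k))"
    "\<And>k. k \<le> 2 \<Longrightarrow> has_weak_deriv k f (G k)"
    "\<And>a b. set_integrable lborel {a..b} (\<lambda>x. (G 2 x)\<^sup>2)" "\<And>k x. k \<le> 2 \<Longrightarrow> G k (x + 1) = G k x"
    by (rule H_per_chain[OF assms zero_less_numeral]) blast
  have a: "ac (G 0) (G 1)" "ac (G 1) (G 2)" using G(2)[of 0] G(2)[of 1] by (simp_all add: numeral_2_eq_2)
  have m: "G 0 \<in> borel_measurable borel" "G 1 \<in> borel_measurable borel" "G 2 \<in> borel_measurable borel"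
    using a acD(1) loc_intD(1) borel_measurable_continuous_onI[OF ac_continuous] by blast+
  have "L2p (G 2)" unfolding L2p_def per_def
    using m G(4)[of 0 1] G(5)[of 2] by (auto simp: integrable_circle_iff)
  moreover have "per (G 0)" "per (G 1)" unfolding per_def using m G(5)[of 0] G(5)[of 1] by auto
  ultimately show ?thesis using that[of "G 1" "G 2"] a G(1) by (simp only:)
qed

section \<open>Regularity of strong solutions\<close>

lemma cub_periodic_chain:
  assumes "ac f f1" "ac f1 f2" "per f" "per f1" "L2p f2"
  shows "periodic_chain (\<lambda>h. cub (f h)) (\<lambda>x. (3 * (f x)\<^sup>2 + 1) * f1 x) (\<lambda>x. 6 * f x * (f1 x)\<^sup>2 + (3 * (f x)\<^sup>2 + 1) * f2 x)"
proof
  have c: "continuous_on UNIV f" "continuous_on UNIV f1" using assms ac_continuous by blast+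
  have p: "per (\<lambda>x. 3 * (f x)\<^sup>2 + 1)" by (intro per_add per_mult per_square per_const assms)
  show "ac (\<lambda>h. cub (f h)) (\<lambda>x. (3 * (f x)\<^sup>2 + 1) * f1 x)"
    "ac (\<lambda>x. (3 * (f x)\<^sup>2 + 1) * f1 x) (\<lambda>x. 6 * f x * (f1 x)\<^sup>2 + (3 * (f x)\<^sup>2 + 1) * f2 x)"
    using cub_chain2 assms by blast+
  show "per (\<lambda>h. cub (f h))"
    using assms(3) unfolding per_def cub_def by auto
  show "per (\<lambda>x. (3 * (f x)\<^sup>2 + 1) * f1 x)" by (intro per_mult p assms)
  show "L2p (\<lambda>x. 6 * f x * (f1 x)\<^sup>2 + (3 * (f x)\<^sup>2 + 1) * f2 x)"
  proof (rule L2p_add)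
    show "L2p (\<lambda>x. 6 * f x * (f1 x)\<^sup>2)"
      by (intro L2p_continuous per_mult per_square per_const assms continuous_intros c)
    show "L2p (\<lambda>x. (3 * (f x)\<^sup>2 + 1) * f2 x)"
      by (intro L2p_cont_mult assms p continuous_intros c)
  qed
qed

text \<open>Any exhibited second derivative computes the energy, since the one selected by
  \<open>weak_deriv\<close> agrees with it almost everywhere.\<close>

lemma energy_chain:
  assumes "periodic_chain (\<lambda>h. cub (f h)) v1 v2"
  shows "energy f = (LINT x|circle. (v2 x)\<^sup>2)"
proof -
  interpret periodic_chain "\<lambda>h. cub (f h)" v1 v2 by (rule assms)
  have l: "loc_int (\<lambda>h. cub (f h))" by (rule loc_int_cont[OF ac_continuous[OF v(2)]])
  have "has_weak_deriv (Suc (Suc 0)) (\<lambda>h. cub (f h)) v2"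
    by (rule ac_has_weak_deriv_Suc[OF ac_has_weak_deriv_Suc[OF has_weak_deriv_0[OF l] v(2) l] v1(2) l])
  then have "has_weak_deriv 2 (\<lambda>h. (f h) ^ 3 + f h) v2" by (simp add: cub_def numeral_2_eq_2)
  from LINT_weak_deriv_square[OF this L2p_loc_int[OF v2]] show ?thesis
    unfolding energy_def using L2p_measurable[OF v2] by (simp add: integral_circle)
qed

locale strong =
  fixes T :: real and u0 :: "real \<Rightarrow> real" and u :: "real \<Rightarrow> real \<Rightarrow> real"
  assumes T: "T > 0" and sol: "strong_solution T u0 u"
begin

lemma u_cont: "t \<in> {0..T} \<Longrightarrow> continuous_on UNIV (u t)"
  and u_pos: "t \<in> {0..T} \<Longrightarrow> u t h > 0"
  and u_H2: "t \<in> {0..T} \<Longrightarrow> u t \<in> H_per 2"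
  and u_lim: "t \<in> {0..T} \<Longrightarrow> ((\<lambda>s. H_norm 2 (\<lambda>h. u s h - u t h)) \<longlongrightarrow> 0) (at t within {0..T})"
  using sol unfolding strong_solution_def C_H_per_def by blast+

lemma u_per: "t \<in> {0..T} \<Longrightarrow> per (u t)"
  using H_per2_chain[OF u_H2 u_cont] by blast

lemma u_dist:
  assumes "s \<in> {0..T}" "t \<in> {0..T}"
  shows "\<bar>u s h - u t h\<bar> \<le> sqrt 2 * H_norm 2 (\<lambda>h. u s h - u t h)"
proof -
  obtain f1 f2 where f: "ac (u s) f1" "ac f1 f2" "per (u s)" "per f1" "L2p f2"
    using H_per2_chain[OF u_H2 u_cont] assms by blast
  obtain g1 g2 where g: "ac (u t) g1" "ac g1 g2" "per (u t)" "per g1" "L2p g2"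
    using H_per2_chain[OF u_H2 u_cont] assms by blast
  have p: "per (\<lambda>x. a x - b x)" if "per a" "per b" for a b using that by (auto simp: per_def)
  show ?thesis
    using H_norm_chain(2)[OF ac_diff[OF f(1) g(1)] ac_diff[OF f(2) g(2)] p[OF f(3) g(3)] p[OF f(4) g(4)] L2p_diff[OF f(5) g(5)]] .
qed

text \<open>Clamping time freezes u outside \<open>{0..T}\<close>. The result is continuous on the
  whole plane, hence Borel, and its time derivative outside the interval is zero.\<close>

definition y :: "real \<Rightarrow> real \<Rightarrow> real" where "y t h = u (max 0 (min T t)) h"

lemma clamp_in: "max 0 (min T t) \<in> {0..T}" using T by auto

lemma y_eq: "t \<in> {0..T} \<Longrightarrow> y t h = u t h" by (auto simp: y_def max_def min_def)

lemma y_per: "per (y t)" using u_per[OF clamp_in] unfolding y_def by simp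

lemma y_cont: "continuous_on UNIV (y t)" using u_cont[OF clamp_in] unfolding y_def by simp

lemma y_pos: "y t h > 0" using u_pos[OF clamp_in] unfolding y_def by simp

text \<open>The Sobolev embedding makes convergence in time uniform in h, so continuity in h is
  needed only at the fixed time t.\<close>

lemma u_joint: "continuous_on ({0..T} \<times> UNIV) (\<lambda>p. u (fst p) (snd p))"
  unfolding continuous_on_iff
proof (intro ballI allI impI)
  fix p :: "real \<times> real" and e :: real assume p: "p \<in> {0..T} \<times> UNIV" and e: "e > 0"
  obtain t h where th: "p = (t, h)" "t \<in> {0..T}" using p by auto
  have "((\<lambda>s. sqrt 2 * H_norm 2 (\<lambda>h. u s h - u t h)) \<longlongrightarrow> sqrt 2 * 0) (at t within {0..T})"
    by (intro tendsto_mult tendsto_const u_lim th)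
  then have "\<forall>\<^sub>F s in at t within {0..T}. sqrt 2 * H_norm 2 (\<lambda>h. u s h - u t h) < e / 2"
    using order_tendstoD(2)[of _ 0 _ "e / 2"] e by simp
  then obtain d1 where d1: "d1 > 0" "\<And>s. s \<in> {0..T} \<Longrightarrow> s \<noteq> t \<Longrightarrow> dist s t < d1 \<Longrightarrow> sqrt 2 * H_norm 2 (\<lambda>h. u s h - u t h) < e / 2"
    unfolding eventually_at by blast
  have d1': "\<bar>u s k - u t k\<bar> < e / 2" if "s \<in> {0..T}" "dist s t < d1" for s k
    using u_dist[OF that(1) th(2), of k] d1(2)[OF that(1) _ that(2)] e by (cases "s = t") auto
  obtain d2 where d2: "d2 > 0" "\<And>k. dist k h < d2 \<Longrightarrow> dist (u t k) (u t h) < e / 2"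
    using u_cont[OF th(2)] e unfolding continuous_on_iff by (metis UNIV_I half_gt_zero)
  show "\<exists>d>0. \<forall>x'\<in>{0..T} \<times> UNIV. dist x' p < d \<longrightarrow> dist (u (fst x') (snd x')) (u (fst p) (snd p)) < e"
  proof (intro exI[of _ "min d1 d2"] conjI ballI impI)
    show "min d1 d2 > 0" using d1 d2 by simp
    fix q :: "real \<times> real" assume q: "q \<in> {0..T} \<times> UNIV" "dist q p < min d1 d2"
    have "dist (fst q) t < d1" "dist (snd q) h < d2"
      using q(2) dist_fst_le[of q p] dist_snd_le[of q p] th by auto
    then have qq: "\<bar>u (fst q) (snd q) - u t (snd q)\<bar> < e / 2" "\<bar>u t (snd q) - u t h\<bar> < e / 2"
      using d1'[of "fst q" "snd q"] d2(2)[of "snd q"] q(1) by (auto simp: dist_real_def)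
    show "dist (u (fst q) (snd q)) (u (fst p) (snd p)) < e"
    proof -
      have "\<bar>a - c\<bar> < e" if "\<bar>a - b\<bar> < e / 2" "\<bar>b - c\<bar> < e / 2" for a b c :: real
        using that by linarith
      from this[OF qq] show ?thesis using th(1) by (simp add: dist_real_def)
    qed
  qed
qed

lemma y_joint: "continuous_on UNIV (\<lambda>p. y (fst p) (snd p))"
proof -
  have "continuous_on UNIV (\<lambda>q::real \<times> real. (\<lambda>p. u (fst p) (snd p)) (max 0 (min T (fst q)), snd q))"
    by (rule continuous_on_compose2[OF u_joint]) (use clamp_in in \<open>auto intro!: continuous_intros\<close>)
  then show ?thesis by (simp add: y_def)
qed

lemma y_meas: "meas2 y"
  unfolding meas2_def case_prod_unfold
  using borel_measurable_continuous_onI[OF y_joint] by (simp add: borel_prod)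

lemma y_time_cont: "continuous_on UNIV (\<lambda>t. y t h)"
proof -
  have "continuous_on UNIV (\<lambda>t. (\<lambda>p. y (fst p) (snd p)) (t, h))"
    by (rule continuous_on_compose2[OF y_joint]) (auto intro!: continuous_intros)
  then show ?thesis by simp
qed

text \<open>Compactness of one period over \<open>{0..T}\<close>. The constants depend on T and give
  integrability only; the decay rate rests on \<open>lower_bound\<close>.\<close>

lemma y_bounds: obtains c C where "0 < c" "\<And>t h. c \<le> y t h" "\<And>t h. y t h \<le> C"
proof -
  let ?K = "{0..T} \<times> {0..1::real}" and ?f = "\<lambda>p. y (fst p) (snd p)"
  have K: "compact ?K" "?K \<noteq> {}" using T by (auto intro!: compact_Times)
  have cf: "continuous_on ?K ?f" by (rule continuous_on_subset[OF y_joint]) auto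
  obtain p where p: "p \<in> ?K" "\<And>q. q \<in> ?K \<Longrightarrow> ?f p \<le> ?f q"
    using continuous_attains_inf[OF K cf] by blast
  obtain r where r: "r \<in> ?K" "\<And>q. q \<in> ?K \<Longrightarrow> ?f q \<le> ?f r"
    using continuous_attains_sup[OF K cf] by blast
  have eq: "y t h = ?f (max 0 (min T t), frac h)" for t h
    using per_frac[OF y_per] clamp_in by (simp add: y_def y_eq)
  have inK: "(max 0 (min T t), frac h) \<in> ?K" for t h
    using clamp_in frac_lt_1[of h] by (simp add: less_imp_le)
  show ?thesis
  proof (rule that[of "?f p" "?f r"])
    show "0 < ?f p" by (rule y_pos)
    show "?f p \<le> y t h" for t h using p(2)[OF inK, of t h] eq[of t h] by (simp only:)
    show "y t h \<le> ?f r" for t h using r(2)[OF inK, of t h] eq[of t h] by (simp only:)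
  qed
qed

lemma y_chain: "t \<in> {0..T} \<Longrightarrow> \<exists>v1 v2. periodic_chain (\<lambda>h. cub (y t h)) v1 v2"
proof -
  assume t: "t \<in> {0..T}"
  obtain f1 f2 where f: "ac (u t) f1" "ac f1 f2" "per (u t)" "per f1" "L2p f2"
    using H_per2_chain[OF u_H2 u_cont] t by blast
  show ?thesis using cub_periodic_chain[OF f] y_eq[OF t] by auto
qed

lemma AE_time: "(AE t in lebesgue_on {0..T}. P t) \<longleftrightarrow> (AE t in lborel. t \<in> {0..T} \<longrightarrow> P t)"
  by (subst AE_restrict_space_iff) (auto simp: AE_lebesgue_iff)

text \<open>The given velocity is Lebesgue measurable and fixed only up to null sets. It is replaced
  by a Borel, exactly periodic W that vanishes outside \<open>{0..T}\<close>; the weak identities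
  are carried over on a single period and spread later.\<close>

lemma velocity:
  obtains W z where "meas2 W" "per2 W" "\<And>t h. t \<notin> {0..T} \<Longrightarrow> W t h = 0" "SQ W"
    "\<And>\<phi>. test_function_on {0<..<T} \<phi> \<Longrightarrow> AE h in lborel. h \<in> {0..<1} \<longrightarrow>
      (LINT t:{0..T}|lborel. deriv \<phi> t * y t h) = - (LINT t:{0..T}|lborel. \<phi> t * W t h)"
    "AE t in lborel. t \<in> {0..T} \<longrightarrow> has_weak_deriv 4 (\<lambda>h. cub (u t h)) (z t)"
    "AE t in lborel. t \<in> {0..T} \<longrightarrow> (AE h in lborel. h \<in> {0..<1} \<longrightarrow> z t h = - W t h / (y t h)\<^sup>2)"
proof -
  obtain w z where w: "w \<in> L2_H_per T 0" "jointly_measurable T w" "has_weak_time_deriv T u w"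
    and z: "AE t in lebesgue_on {0..T}. has_weak_deriv 4 (\<lambda>h. (u t h) ^ 3 + u t h) (z t)"
    and eqn: "AE (t, h) in lebesgue_on ({0..T} \<times> {0..1}). w t h = - (u t h)\<^sup>2 * z t h"
    using sol unfolding strong_solution_def by blast
  let ?S = "{0..T} \<times> (UNIV :: real set)"
  have "?S \<in> sets borel" by (intro borel_closed closed_Times) auto
  then have S: "?S \<in> sets lebesgue" by auto
  have "(\<lambda>p. indicator ?S p *\<^sub>R (case p of (t, h) \<Rightarrow> w t h)) \<in> borel_measurable lebesgue"
    using w(2) S unfolding jointly_measurable_def by (subst (asm) borel_measurable_restrict_space_iff) auto
  from completion_ex_borel_measurable_real[OF this] obtain w1 where w1: "w1 \<in> borel_measurable (lborel :: (real \<times> real) measure)"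
    "AE p in lborel. indicator ?S p *\<^sub>R (case p of (t, h) \<Rightarrow> w t h) = w1 p" by blast
  have m1: "w1 \<in> borel_measurable (borel \<Otimes>\<^sub>M borel)" using w1(1) by (simp add: borel_prod)
  \<comment> \<open>Values are copied from the period [0, 1), so periodicity is exact and w has to
    be matched there only.\<close>
  define W where "W t h = (if t \<in> {0..T} then w1 (t, frac h) else 0)" for t h
  have mW: "meas2 W"
  proof -
    have [measurable]: "(\<lambda>p. w1 (fst p, frac (snd p))) \<in> borel_measurable (borel \<Otimes>\<^sub>M borel)"
      by (rule measurable_compose[OF _ m1]) measurable
    show ?thesis unfolding meas2_def case_prod_unfold W_def by measurable
  qed
  have pW: "per2 W"
  proof -
    have f: "frac (h + 1) = frac h" for h :: real by (simp add: frac_def)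
    have "W t (h + 1) = W t h" for t h unfolding W_def by (simp only: f)
    then show ?thesis unfolding per2_def by (intro allI)
  qed
  have W0: "W t h = 0" if "t \<notin> {0..T}" for t h using that by (auto simp: W_def)
  have wW: "w t h = W t h" if "indicator ?S (t, h) *\<^sub>R (case (t, h) of (t, h) \<Rightarrow> w t h) = w1 (t, h)" "t \<in> {0..T}" "h \<in> {0..<1}" for t h
    using that frac_eq[of h] by (simp add: W_def)
  have aeth: "AE t in lborel. AE h in lborel. t \<in> {0..T} \<longrightarrow> h \<in> {0..<1} \<longrightarrow> w t h = W t h"
    using AE_swap(1)[OF w1(2)] by (rule eventually_mono) (erule eventually_mono, use wW in blast)
  have aeht: "AE h in lborel. AE t in lborel. t \<in> {0..T} \<longrightarrow> h \<in> {0..<1} \<longrightarrow> w t h = W t h"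
    using AE_swap(2)[OF w1(2)] by (rule eventually_mono) (erule eventually_mono, use wW in blast)
  have secW: "W t \<in> borel_measurable borel" for t by (rule meas2_section[OF mW])
  have wper: "AE t in lborel. t \<in> {0..T} \<longrightarrow> w t \<in> H_per 0"
    using w(1) unfolding L2_H_per_def AE_time[symmetric] by blast
  \<comment> \<open>\<open>H_norm 0\<close> is computed with a selected weak derivative of order
    zero, so it is compared with W through a Borel representative of w t; the point h = 1 is a null
    set.\<close>
  have normW: "AE t in lborel. t \<in> {0..T} \<longrightarrow> ennreal ((H_norm 0 (w t))\<^sup>2) = (\<integral>\<^sup>+ h. ennreal ((W t h)\<^sup>2) \<partial>circle)"
    using wper aeth
  proof eventually_elim
    case (elim t)
    show ?case
    proof
      assume t: "t \<in> {0..T}"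
      then have "w t \<in> H_loc 0" using elim(1) by (simp add: H_per_def)
      then have w2: "w t \<in> L2_loc" "w t \<in> L1_loc" by (auto simp: H_loc_def has_weak_deriv_def)
      obtain g where g: "loc_int g" "AE h in lborel. w t h = g h" using L1_loc_rep[OF w2(2)] by blast
      have hw: "has_weak_deriv 0 (w t) (w t)" using w2(2) by (simp add: has_weak_deriv_def)
      have gm [measurable]: "g \<in> borel_measurable borel" by (rule loc_intD[OF g(1)])
      note [measurable] = secW[of t]
      have H: "(H_norm 0 (w t))\<^sup>2 = (LINT h|circle. (g h)\<^sup>2)"
      proof -
        have "(LINT h:{0..1}|lebesgue. (weak_deriv 0 (w t) h)\<^sup>2) = (LINT h|circle. (g h)\<^sup>2)"
          using LINT_weak_deriv_square[OF hw g] by (simp add: integral_circle)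
        moreover have "(LINT h|circle. (g h)\<^sup>2) \<ge> 0" by (rule Bochner_Integration.integral_nonneg) simp
        ultimately show ?thesis by (simp add: H_norm_def)
      qed
      have gi: "integrable circle (\<lambda>h. (g h)\<^sup>2)"
        using L2_loc_rep[OF w2(1) g(2,1), of 0 1] by (subst integrable_circle_iff) auto
      have "AE h in lborel. h \<in> {0..1} \<longrightarrow> g h = W t h"
        using elim(2) g(2) AE_lborel_singleton[of 1] by eventually_elim (use t in auto)
      then have gW: "AE h in circle. g h = W t h" by (simp add: AE_circle)
      have "ennreal (LINT h|circle. (g h)\<^sup>2) = (\<integral>\<^sup>+ h. ennreal ((g h)\<^sup>2) \<partial>circle)"
        by (rule nn_integral_eq_integral[symmetric, OF gi]) simp
      also have "... = (\<integral>\<^sup>+ h. ennreal ((W t h)\<^sup>2) \<partial>circle)"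
        by (rule nn_integral_cong_AE) (use gW in eventually_elim, simp)
      finally show "ennreal ((H_norm 0 (w t))\<^sup>2) = (\<integral>\<^sup>+ h. ennreal ((W t h)\<^sup>2) \<partial>circle)" by (simp only: H)
    qed
  qed
  have SQW: "SQ W"
  proof -
    have m: "(\<lambda>p. W (fst p) (snd p)) \<in> borel_measurable (lborel \<Otimes>\<^sub>M circle)" by (rule meas2_compose[OF mW]) auto
    have mm: "(\<lambda>(t, h). ennreal ((W t h)\<^sup>2)) \<in> borel_measurable (lborel \<Otimes>\<^sub>M circle)"
      using m unfolding case_prod_unfold by measurable
    \<comment> \<open>As W vanishes outside \<open>{0..T}\<close>, the Bochner norm of w already
      accounts for the integral over all times.\<close>
    have "(\<integral>\<^sup>+ t. \<integral>\<^sup>+ h. ennreal ((W t h)\<^sup>2) \<partial>circle \<partial>lborel)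
        = (\<integral>\<^sup>+ t. (\<integral>\<^sup>+ h. ennreal ((W t h)\<^sup>2) \<partial>circle) * indicator {0..T} t \<partial>lebesgue)"
      unfolding nn_integral_completion by (rule nn_integral_cong) (auto simp: indicator_def W0)
    also have "... = (\<integral>\<^sup>+ t. (\<integral>\<^sup>+ h. ennreal ((W t h)\<^sup>2) \<partial>circle) \<partial>lebesgue_on {0..T})"
      by (subst nn_integral_restrict_space) auto
    also have "... = (\<integral>\<^sup>+ t. ennreal ((H_norm 0 (w t))\<^sup>2) \<partial>lebesgue_on {0..T})"
      by (rule nn_integral_cong_AE) (use normW in \<open>auto simp: AE_time elim: eventually_mono\<close>)
    also have "... < \<infinity>" using w(1) unfolding L2_H_per_def by blast
    finally have fin: "(\<integral>\<^sup>+ t. \<integral>\<^sup>+ h. ennreal ((W t h)\<^sup>2) \<partial>circle \<partial>lborel) < \<infinity>" .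
    have "integrable (lborel \<Otimes>\<^sub>M circle) (\<lambda>p. (W (fst p) (snd p))\<^sup>2)"
    proof (rule integrableI_bounded)
      show "(\<lambda>p. (W (fst p) (snd p))\<^sup>2) \<in> borel_measurable (lborel \<Otimes>\<^sub>M circle)" using m by measurable
      have "(\<integral>\<^sup>+ p. ennreal (norm ((W (fst p) (snd p))\<^sup>2)) \<partial>(lborel \<Otimes>\<^sub>M circle)) = (\<integral>\<^sup>+ t. \<integral>\<^sup>+ h. ennreal ((W t h)\<^sup>2) \<partial>circle \<partial>lborel)"
        using circle.nn_integral_fst[OF mm] by (simp add: case_prod_unfold)
      then show "(\<integral>\<^sup>+ p. ennreal (norm ((W (fst p) (snd p))\<^sup>2)) \<partial>(lborel \<Otimes>\<^sub>M circle)) < \<infinity>" using fin by simp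
    qed
    then show ?thesis using mW by (simp add: SQ_def case_prod_unfold)
  qed
  have timeW: "AE h in lborel. h \<in> {0..<1} \<longrightarrow>
      (LINT t:{0..T}|lborel. deriv \<phi> t * y t h) = - (LINT t:{0..T}|lborel. \<phi> t * W t h)"
    if phi: "test_function_on {0<..<T} \<phi>" for \<phi>
  proof -
    have cphi: "\<phi> \<in> borel_measurable borel" "deriv \<phi> \<in> borel_measurable borel"
      using test_funpow_borel[OF phi, of 0] test_funpow_borel[OF phi, of 1] by simp_all
    have "AE h in lborel. (LINT t:{0..T}|lebesgue. deriv \<phi> t * u t h) = - (LINT t:{0..T}|lebesgue. \<phi> t * w t h)"
      using w(3) phi unfolding has_weak_time_deriv_def AE_lebesgue_iff by blast
    then show ?thesis
      using aeht
    proof eventually_elim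
      case (elim h)
      show ?case
      proof
        assume h: "h \<in> {0..<1}"
        have my: "(\<lambda>t. y t h) \<in> borel_measurable borel" by (rule borel_measurable_continuous_onI[OF y_time_cont])
        have mW': "(\<lambda>t. W t h) \<in> borel_measurable borel" by (rule meas2_compose[OF mW]) auto
        have 1: "(LINT t:{0..T}|lebesgue. deriv \<phi> t * u t h) = (LINT t:{0..T}|lborel. deriv \<phi> t * y t h)"
          unfolding set_lebesgue_integral_def
        proof (rule lebesgue_integral_AE_borel)
          show "(\<lambda>t. indicat_real {0..T} t *\<^sub>R (deriv \<phi> t * y t h)) \<in> borel_measurable borel"
            using my cphi by measurable
        qed (auto simp: indicator_def y_eq)
        have 2: "(LINT t:{0..T}|lebesgue. \<phi> t * w t h) = (LINT t:{0..T}|lborel. \<phi> t * W t h)"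
          unfolding set_lebesgue_integral_def
        proof (rule lebesgue_integral_AE_borel)
          show "(\<lambda>t. indicat_real {0..T} t *\<^sub>R (\<phi> t * W t h)) \<in> borel_measurable borel"
            using mW' cphi by measurable
          show "AE t in lborel. indicat_real {0..T} t *\<^sub>R (\<phi> t * W t h) = indicat_real {0..T} t *\<^sub>R (\<phi> t * w t h)"
            using elim(2) by (rule eventually_mono) (use h in \<open>auto simp: indicator_def\<close>)
        qed
        show "(LINT t:{0..T}|lborel. deriv \<phi> t * y t h) = - (LINT t:{0..T}|lborel. \<phi> t * W t h)"
          using elim(1) 1 2 by simp
      qed
    qed
  qed
  have z': "AE t in lborel. t \<in> {0..T} \<longrightarrow> has_weak_deriv 4 (\<lambda>h. cub (u t h)) (z t)"
    using z unfolding AE_time cub_def .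
  have "{0..T} \<times> {0..1::real} \<in> sets borel" by (intro borel_closed closed_Times) auto
  then have S1: "{0..T} \<times> {0..1::real} \<in> sets lebesgue" by auto
  have "AE p in lborel. p \<in> {0..T} \<times> {0..1} \<longrightarrow> w (fst p) (snd p) = - (u (fst p) (snd p))\<^sup>2 * z (fst p) (snd p)"
    using eqn S1 by (subst (asm) AE_restrict_space_iff) (auto simp: AE_completion_iff case_prod_unfold)
  from AE_swap(1)[OF this] have
    "AE t in lborel. AE h in lborel. (t, h) \<in> {0..T} \<times> {0..1} \<longrightarrow> w t h = - (u t h)\<^sup>2 * z t h" by simp
  then have zW: "AE t in lborel. t \<in> {0..T} \<longrightarrow> (AE h in lborel. h \<in> {0..<1} \<longrightarrow> z t h = - W t h / (y t h)\<^sup>2)"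
    using aeth
  proof eventually_elim
    case (elim t)
    show ?case
    proof
      assume t: "t \<in> {0..T}"
      show "AE h in lborel. h \<in> {0..<1} \<longrightarrow> z t h = - W t h / (y t h)\<^sup>2"
        using elim
      proof eventually_elim
        case (elim h)
        show ?case
        proof
          assume h: "h \<in> {0..<1}"
          then have "W t h = - (y t h)\<^sup>2 * z t h" using elim t y_eq[OF t] by auto
          then show "z t h = - W t h / (y t h)\<^sup>2" using y_pos[of t h] by simp
        qed
      qed
    qed
  qed
  show ?thesis by (rule that[OF mW pW W0 SQW timeW z' zW])
qed

end

section \<open>Exponential decay\<close>

lemma integral_interior_zero:
  fixes g :: "real \<Rightarrow> real"
  assumes "\<And>t. a < t \<Longrightarrow> t < b \<Longrightarrow> g t = 0" shows "integral {a..b} g = 0"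
proof -
  have "integral {a..b} g = integral {a..b} (\<lambda>t. 0)"
  proof (rule integral_spike[where S="{a, b}"])
    show "negligible {a, b}" by simp
    show "(\<lambda>t. 0) t = g t" if "t \<in> {a..b} - {a, b}" for t using that assms[of t] by auto
  qed
  then show ?thesis by simp
qed

text \<open>Only plateaus with rational end points are tested, so countably many identities suffice.
  They show that f minus a primitive of g takes equal values at rational times; continuity and
  density do the rest on [0, T], and outside both functions are constant.\<close>

lemma ac_of_weak_time_deriv:
  fixes f g :: "real \<Rightarrow> real"
  assumes f: "continuous_on UNIV f" "\<And>t. \<bar>f t\<bar> \<le> B" and g: "loc_int g" and T: "T > 0"
    and fl: "\<And>t. t \<le> 0 \<Longrightarrow> f t = f 0" and fr: "\<And>t. t \<ge> T \<Longrightarrow> f t = f T"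
    and g0: "\<And>t. t \<notin> {0..T} \<Longrightarrow> g t = 0"
    and weak: "\<And>(p::rat) (q::rat) n. 0 < p \<Longrightarrow> p \<le> q \<Longrightarrow> of_rat q + 1 / real (Suc n) < T \<Longrightarrow>
      (LINT t:{0..T}|lborel. deriv (plateau (of_rat p) (of_rat q) n) t * f t)
        = - (LINT t:{0..T}|lborel. plateau (of_rat p) (of_rat q) n t * g t)"
  shows "ac f g"
proof -
  obtain G where G: "ac G g" using ac_exists[OF g] .
  define D where "D t = f t - G t" for t
  have Dc: "continuous_on UNIV D" unfolding D_def by (intro continuous_intros f(1) ac_continuous[OF G])
  have rat: "D (of_rat p) = D (of_rat q)" if pq: "0 < p" "p \<le> q" "of_rat q < T" for p q :: rat
  proof -
    let ?a = "of_rat p :: real" and ?b = "of_rat q :: real"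
    have ab: "0 < ?a" "?a \<le> ?b" using pq by (auto simp: of_rat_less_eq)
    \<comment> \<open>The support of a plateau overhangs its right end point by 1/(n+1); from N on
      it remains inside the open time interval.\<close>
    obtain N where N: "inverse (real (Suc N)) < T - ?b" using reals_Archimedean[of "T - ?b"] pq(3) by auto
    have ev: "- (LINT t|lborel. f t * deriv (plateau ?a ?b n) t) = (LINT t|lborel. g t * plateau ?a ?b n t)" if "n \<ge> N" for n
    proof -
      have "1 / real (Suc n) \<le> inverse (real (Suc N))" using that by (simp add: inverse_eq_divide frac_le)
      then have bn: "?b + 1 / real (Suc n) < T" using N by linarith
      have z: "t \<in> {0..T}" if "t \<in> {?a..?b + 1 / real (Suc n)}" for t
        using that ab bn unfolding atLeastAtMost_iff by linarith
      have p0: "plateau ?a ?b n t = 0" "deriv (plateau ?a ?b n) t = 0" if "t \<notin> {0..T}" for t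
        using plateau_outside[OF ab(2)] deriv_zero_outside[of ?a "?b + 1 / real (Suc n)" "plateau ?a ?b n" t] z that by blast+
      have "(LINT t:{0..T}|lborel. deriv (plateau ?a ?b n) t * f t) = (LINT t|lborel. f t * deriv (plateau ?a ?b n) t)"
        unfolding set_lebesgue_integral_def
        by (rule Bochner_Integration.integral_cong) (use p0(2) in \<open>auto simp: indicator_def\<close>)
      moreover have "(LINT t:{0..T}|lborel. plateau ?a ?b n t * g t) = (LINT t|lborel. g t * plateau ?a ?b n t)"
        unfolding set_lebesgue_integral_def
        by (rule Bochner_Integration.integral_cong) (use p0(1) in \<open>auto simp: indicator_def\<close>)
      ultimately show ?thesis using weak[OF pq(1,2) bn] by simp
    qed
    have "(\<lambda>n. - (LINT t|lborel. f t * deriv (plateau ?a ?b n) t)) \<longlonglongrightarrow> - (f ?a - f ?b)"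
      by (intro tendsto_minus plateau_deriv_tendsto[OF f])
    moreover have "(\<lambda>n. - (LINT t|lborel. f t * deriv (plateau ?a ?b n) t)) \<longlonglongrightarrow> integral {?a..?b} g"
      by (rule Lim_transform_eventually[OF plateau_integral_tendsto[OF g ab(2)]])
         (use ev[symmetric] in \<open>auto simp: eventually_sequentially intro!: exI[of _ N]\<close>)
    ultimately have "- (f ?a - f ?b) = integral {?a..?b} g" by (rule LIMSEQ_unique)
    then show ?thesis using acD(2)[OF G ab(2)] by (simp add: D_def)
  qed
  obtain q0 :: rat where q0: "0 < (of_rat q0 :: real)" "of_rat q0 < T" using of_rat_dense[OF T] by blast
  define c where "c = D (of_rat q0)"
  have ratc: "D (of_rat q) = c" if "0 < (of_rat q :: real)" "of_rat q < T" for q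
  proof -
    have pos: "0 < q" "0 < q0" using that(1) q0(1) by simp_all
    show ?thesis
    proof (cases "q \<le> q0")
      case True
      show ?thesis unfolding c_def by (rule rat[OF pos(1) True q0(2)])
    next
      case False
      then have "q0 \<le> q" by simp
      show ?thesis unfolding c_def by (rule rat[OF pos(2) \<open>q0 \<le> q\<close> that(2), symmetric])
    qed
  qed
  have inner: "D t = c" if "t \<in> {0..T}" for t
  proof (rule ccontr)
    assume "D t \<noteq> c"
    let ?O = "{x. D x \<noteq> c}"
    have op: "open ?O" by (rule open_Collect_neq[OF Dc continuous_on_const])
    \<comment> \<open>Passing to the closure covers the end points 0 and T: an open set meeting
      [0, T] meets the open interval and then contains a rational time in it.\<close>
    have "?O \<inter> closure {0<..<T} \<noteq> {}" using that T \<open>D t \<noteq> c\<close> by (auto simp: closure_greaterThanLessThan)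
    then have "?O \<inter> {0<..<T} \<noteq> {}" using open_Int_closure_eq_empty[OF op] by blast
    then obtain x where x: "x \<in> ?O \<inter> {0<..<T}" by blast
    have "open (?O \<inter> {0<..<T})" by (intro open_Int op) simp
    from openE[OF this x] obtain e where e: "e > 0" "ball x e \<subseteq> ?O \<inter> {0<..<T}" .
    obtain r :: rat where r: "x < of_rat r" "of_rat r < x + e" using of_rat_dense[of x "x + e"] e by auto
    then have "of_rat r \<in> ball x e" by (simp add: dist_real_def)
    then have "of_rat r \<in> ?O \<inter> {0<..<T}" using e(2) by blast
    then show False using ratc[of r] by auto
  qed
  have Dt: "D t = c" for t
  proof -
    consider "t < 0" | "t \<in> {0..T}" | "t > T" by fastforce
    then show ?thesis
    proof cases
      case 1
      have "G 0 - G t = 0" using acD(2)[OF G, of t 0] 1 integral_interior_zero[of t 0 g] g0 by auto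
      then show ?thesis using inner[of 0] fl[of t] 1 T by (simp add: D_def)
    next
      case 2 then show ?thesis by (rule inner)
    next
      case 3
      have "G t - G T = 0" using acD(2)[OF G, of T t] 3 integral_interior_zero[of T t g] g0 by auto
      then show ?thesis using inner[of T] fr[of t] 3 T by (simp add: D_def)
    qed
  qed
  have "G t + c = f t" for t using Dt[of t] by (simp add: D_def)
  from ac_cong[OF ac_add[OF G ac_const[of c]] this, of g] show ?thesis by simp
qed

context strong
begin

text \<open>For each test function the identity fails on a null set of its own. Restricting to
  rational plateaus leaves countably many null sets, off whose union the identity holds for all of
  them at once.\<close>

lemma ftc:
  assumes W: "meas2 W" "per2 W" "\<And>t h. t \<notin> {0..T} \<Longrightarrow> W t h = 0" "SQ W"
    and weak: "\<And>\<phi>. test_function_on {0<..<T} \<phi> \<Longrightarrow> AE h in lborel. h \<in> {0..<1} \<longrightarrow>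
      (LINT t:{0..T}|lborel. deriv \<phi> t * y t h) = - (LINT t:{0..T}|lborel. \<phi> t * W t h)"
  shows "AE h in lborel. ac (\<lambda>t. y t h) (\<lambda>t. W t h)"
proof -
  have mW: "(\<lambda>t. W t h) \<in> borel_measurable borel" for h by (rule meas2_compose[OF W(1)]) auto
  have "integrable (lborel \<Otimes>\<^sub>M circle) (\<lambda>(t, h). (W t h)\<^sup>2)" using W(4) by (simp add: SQ_def)
  then have "AE h in circle. integrable lborel (\<lambda>t. (W t h)\<^sup>2)" by (rule strip.AE_integrable_snd)
  then have A: "AE h in lborel. h \<in> {0..1} \<longrightarrow> integrable lborel (\<lambda>t. (W t h)\<^sup>2)" by (simp only: AE_circle)
  have li: "loc_int (\<lambda>t. W t h)" if "integrable lborel (\<lambda>t. (W t h)\<^sup>2)" for h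
  proof -
    note [measurable] = mW[of h]
    have "integrable lborel (\<lambda>t. indicat_real {a..b} t * W t h)" for a b
    proof (rule integrable_mult_sq)
      have "integrable lborel (indicat_real {a..b})"
        by (rule integrable_real_indicator) (auto simp: emeasure_lborel_Icc_eq)
      moreover have "(\<lambda>t. (indicat_real {a..b} t)\<^sup>2) = indicat_real {a..b}" by (auto simp: indicator_def)
      ultimately show "integrable lborel (\<lambda>t. (indicat_real {a..b} t)\<^sup>2)" by simp
    qed (use that in measurable)
    then show ?thesis using mW by (simp add: loc_int_def set_integrable_def)
  qed
  let ?Q = "\<lambda>(p::rat) (q::rat) n h. (LINT t:{0..T}|lborel. deriv (plateau (of_rat p) (of_rat q) n) t * y t h)
        = - (LINT t:{0..T}|lborel. plateau (of_rat p) (of_rat q) n t * W t h)"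
  have "AE h in lborel. h \<in> {0..<1} \<longrightarrow> 0 < p \<longrightarrow> p \<le> q \<longrightarrow> of_rat q + 1 / real (Suc n) < T \<longrightarrow> ?Q p q n h" for p q :: rat and n
  proof (cases "0 < p \<and> p \<le> q \<and> of_rat q + 1 / real (Suc n) < T")
    case True
    have "test_function_on {0<..<T} (plateau (of_rat p) (of_rat q) n)"
    proof (rule test_function_plateau)
      show "(of_rat p :: real) \<le> of_rat q" using True by (simp add: of_rat_less_eq)
      have "(0::real) < of_rat p" using True by simp
      moreover have "of_rat q + 1 / real (Suc n) < T" using True by blast
      ultimately have "x \<in> {0<..<T}" if "x \<in> {of_rat p..of_rat q + 1 / real (Suc n)}" for x
        using that unfolding atLeastAtMost_iff greaterThanLessThan_iff by linarith
      then show "{of_rat p..of_rat q + 1 / real (Suc n)} \<subseteq> {0<..<T}" by blast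
    qed
    from weak[OF this] show ?thesis by (rule eventually_mono) blast
  qed auto
  then have B: "AE h in lborel. \<forall>(p::rat) (q::rat) n. h \<in> {0..<1} \<longrightarrow> 0 < p \<longrightarrow> p \<le> q \<longrightarrow> of_rat q + 1 / real (Suc n) < T \<longrightarrow> ?Q p q n h"
    by (simp only: AE_all_countable)  blast
  obtain c C where cC: "0 < c" "\<And>t h. c \<le> y t h" "\<And>t h. y t h \<le> C" using y_bounds by blast
  have "AE h in lborel. h \<in> {0..<1} \<longrightarrow> ac (\<lambda>t. y t h) (\<lambda>t. W t h)"
    using A B
  proof eventually_elim
    case (elim h)
    show ?case
    proof
      assume h: "h \<in> {0..<1}"
      show "ac (\<lambda>t. y t h) (\<lambda>t. W t h)"
      proof (rule ac_of_weak_time_deriv[OF y_time_cont _ _ T])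
        show "\<bar>y t h\<bar> \<le> C" for t using cC(3)[of t h] y_pos[of t h] by simp
        show "loc_int (\<lambda>t. W t h)" using elim(1) h by (intro li) auto
        show "y t h = y 0 h" if "t \<le> 0" for t using that T by (simp add: y_def)
        show "y t h = y T h" if "t \<ge> T" for t using that T by (simp add: y_def)
      qed (use W(3) elim(2) h in auto)
    qed
  qed
  from AE_frac[OF this] have "AE h in lborel. ac (\<lambda>t. y t (frac h)) (\<lambda>t. W t (frac h))" .
  moreover have "y t (frac h) = y t h" "W t (frac h) = W t h" for t h
    using per_frac[OF y_per] per_frac[OF SQ_per[OF W(4,2)]] by auto
  ultimately show ?thesis by simp
qed

text \<open>H4 regularity makes \<open>cub\<close> of u four times differentiable along a chain of
  primitives. Its last member is a weak fourth derivative, so it agrees with z almost everywhere and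
  with Z on one period; periodicity spreads this to the line.\<close>

lemma fourth:
  assumes t: "t \<in> {0..T}" and u4: "u t \<in> H_per 4" and z: "has_weak_deriv 4 (\<lambda>h. cub (u t h)) z"
    and Z: "per Z" "AE h in lborel. h \<in> {0..<1} \<longrightarrow> z h = Z h"
  shows "\<exists>v1 v2 v3. periodic_chain (\<lambda>h. cub (y t h)) v1 v2 \<and> ac v2 v3 \<and> per v3 \<and> ac v3 Z"
proof -
  obtain G where G: "G 0 = u t" "\<And>k. k < 4 \<Longrightarrow> ac (G k) (G (Suc k))"
    "\<And>k. k \<le> 4 \<Longrightarrow> has_weak_deriv k (u t) (G k)"
    "\<And>a b. set_integrable lborel {a..b} (\<lambda>x. (G 4 x)\<^sup>2)" "\<And>k x. k \<le> 4 \<Longrightarrow> G k (x + 1) = G k x"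
    by (rule H_per_chain[OF u4 u_cont[OF t] zero_less_numeral]) blast
  have a: "ac (G 0) (G 1)" "ac (G 1) (G 2)" "ac (G 2) (G 3)" "ac (G 3) (G 4)"
    using G(2)[of 0] G(2)[of 1] G(2)[of 2] G(2)[of 3] by (simp_all add: eval_nat_numeral)
  have m: "G 4 \<in> borel_measurable borel" using acD(1)[OF a(4)] by (rule loc_intD)
  have p: "per (G 0)" "per (G 1)" "per (G 2)" "per (G 3)" "per (G 4)"
    unfolding per_def using borel_measurable_continuous_onI[OF ac_continuous] a m G(5) by auto
  have L2: "L2p (G 2)" by (rule L2p_continuous[OF p(3) ac_continuous[OF a(3)]])
  note ch = cub_periodic_chain[OF a(1,2) p(1,2) L2]
  obtain v3 v4 where v: "ac (\<lambda>x. 6 * G 0 x * (G 1 x)\<^sup>2 + (3 * (G 0 x)\<^sup>2 + 1) * G 2 x) v3" "ac v3 v4" "per v3" "per v4"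
    using cub_chain4[OF a p] by blast
  have l: "loc_int (\<lambda>h. cub (G 0 h))" by (rule loc_int_cont[OF ac_continuous[OF periodic_chain.v(2)[OF ch]]])
  have "has_weak_deriv (Suc (Suc (Suc (Suc 0)))) (\<lambda>h. cub (G 0 h)) v4"
    by (rule ac_has_weak_deriv_Suc[OF ac_has_weak_deriv_Suc[OF ac_has_weak_deriv_Suc[OF ac_has_weak_deriv_Suc[OF
          has_weak_deriv_0[OF l] periodic_chain.v(2)[OF ch] l] periodic_chain.v1(2)[OF ch] l] v(1) l] v(2) l])
  then have "has_weak_deriv 4 (\<lambda>h. cub (u t h)) v4" using G(1) by (simp add: eval_nat_numeral)
  from has_weak_deriv_unique[OF z this] have "AE h in lborel. h \<in> {0..<1} \<longrightarrow> v4 h = Z h"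
    using Z(2) by eventually_elim auto
  from AE_frac[OF this] have ae: "AE h in lborel. v4 h = Z h" by (simp add: per_frac[OF v(4)] per_frac[OF Z(1)])
  have lv4: "loc_int v4" using acD(1)[OF v(2)] .
  have lZ: "loc_int Z"
  proof -
    have [measurable]: "Z \<in> borel_measurable borel" "v4 \<in> borel_measurable borel"
      using per_measurable Z(1) v(4) by auto
    have "set_integrable lborel {a..b} Z" for a b
      using loc_intD(2)[OF lv4, of a b]
      by (rule set_integrable_cong_AE[THEN iffD1, rotated -1]) (use ae in auto)
    then show ?thesis by (auto simp: loc_int_def)
  qed
  have "ac v3 Z" by (rule ac_AE_cong[OF v(2) ae lZ])
  moreover have "(\<lambda>h. cub (G 0 h)) = (\<lambda>h. cub (y t h))" using G(1) y_eq[OF t] by auto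
  note ch[unfolded this]
  ultimately show ?thesis using v(1,3) by (intro exI conjI)
qed

lemma evolution: obtains c C W where "evolution T c C y W"
proof -
  obtain W z where W: "meas2 W" "per2 W" "\<And>t h. t \<notin> {0..T} \<Longrightarrow> W t h = 0" "SQ W"
    "\<And>\<phi>. test_function_on {0<..<T} \<phi> \<Longrightarrow> AE h in lborel. h \<in> {0..<1} \<longrightarrow>
      (LINT t:{0..T}|lborel. deriv \<phi> t * y t h) = - (LINT t:{0..T}|lborel. \<phi> t * W t h)"
    "AE t in lborel. t \<in> {0..T} \<longrightarrow> has_weak_deriv 4 (\<lambda>h. cub (u t h)) (z t)"
    "AE t in lborel. t \<in> {0..T} \<longrightarrow> (AE h in lborel. h \<in> {0..<1} \<longrightarrow> z t h = - W t h / (y t h)\<^sup>2)"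
    by (rule velocity) blast
  obtain c C where cC: "0 < c" "\<And>t h. c \<le> y t h" "\<And>t h. y t h \<le> C" using y_bounds by blast
  have pZ: "per (\<lambda>h. - W t h / (y t h)\<^sup>2)" for t
    using SQ_per[OF W(4,2), of t] y_per[of t] by (auto simp: per_def)
  have "AE t in lebesgue_on {0..T}. u t \<in> H_per 4"
    using sol unfolding strong_solution_def L2_H_per_def by blast
  then have u4: "AE t in lborel. t \<in> {0..T} \<longrightarrow> u t \<in> H_per 4" unfolding AE_time .
  have "evolution T c C y W"
  proof
    show "AE t in lborel. t \<in> {0..T} \<longrightarrow> (\<exists>v1 v2 v3. periodic_chain (\<lambda>h. cub (y t h)) v1 v2 \<and>
      ac v2 v3 \<and> per v3 \<and> ac v3 (\<lambda>h. - W t h / (y t h)\<^sup>2))"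
      using u4 W(6,7)
    proof eventually_elim
      case (elim t)
      then show ?case using fourth[OF _ _ _ pZ] by blast
    qed
    show "AE h in lborel. ac (\<lambda>t. y t h) (\<lambda>t. W t h)" by (rule ftc[OF W(1-5)])
  qed (use y_meas y_cont y_per cC W y_chain in auto)
  then show ?thesis using that by blast
qed

end

theorem theorem2:
  fixes u0 :: "real \<Rightarrow> real" and u :: "real \<Rightarrow> real \<Rightarrow> real" and L :: real
  assumes "u0 \<in> H_per 2"
    and "AE h in lebesgue. u0 h \<ge> 0"
    and "(\<integral>\<^sup>+ h\<in>{0..1}. (1 / ennreal (u0 h)) \<partial>lebesgue) = ennreal L"
    and "global_strong_solution u0 u"
  shows "(\<exists>\<beta>>0. \<forall>\<^sub>F t in at_top. energy (u t) \<le> energy (u 0) * exp (- \<beta> * t)) \<and>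
    ((\<lambda>t. esssup (lebesgue_on {0..1}) (\<lambda>h. ereal \<bar>u t h - 1 / L\<bar>)) \<longlongrightarrow> 0) at_top"
proof -
  have st: "strong T u0 u" if "T > 0" for T
    using assms(4) that unfolding global_strong_solution_def by (intro strong.intro) auto
  \<comment> \<open>Any horizon beyond t serves to import facts at a single time t.\<close>
  have st1: "strong (\<bar>t\<bar> + 1) u0 u" for t by (rule st) simp
  have tin: "t \<in> {0..\<bar>t\<bar> + 1}" if "t \<ge> 0" for t :: real using that by simp
  have up: "per (u t)" and uc: "continuous_on UNIV (u t)" and upos: "u t h > 0" if "t \<ge> 0" for t h
    using strong.u_per[OF st1 tin[OF that]] strong.u_cont[OF st1 tin[OF that]] strong.u_pos[OF st1 tin[OF that]] .
  have pinv: "per (\<lambda>h. 1 / u t h)" and cinv: "continuous_on UNIV (\<lambda>h. 1 / u t h)" if "t \<ge> 0" for t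
  proof -
    show "per (\<lambda>h. 1 / u t h)" using up[OF that] by (auto simp: per_def)
    show "continuous_on UNIV (\<lambda>h. 1 / u t h)"
      using upos[OF that] by (intro continuous_intros uc[OF that]) (auto simp: less_imp_neq[symmetric])
  qed
  have iinv: "integrable circle (\<lambda>h. 1 / u t h)" if "t \<ge> 0" for t
    by (rule L2p_integrable[OF L2p_continuous[OF pinv[OF that] cinv[OF that]]])
  have L: "(LINT h|circle. 1 / u 0 h) = L" "L > 0"
  proof -
    have [measurable]: "(\<lambda>h. 1 / u 0 h) \<in> borel_measurable borel"
      by (rule borel_measurable_continuous_onI[OF cinv]) simp
    let ?I = "LINT h|circle. 1 / u 0 h"
    have ae0: "AE h in lborel. u 0 h = u0 h"
      using strong.sol[OF st1] unfolding strong_solution_def AE_lebesgue_iff by blast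
    have "ennreal L = (\<integral>\<^sup>+ h. (1 / ennreal (u0 h)) * indicator {0..1} h \<partial>lborel)"
      using assms(3) by (simp add: nn_integral_completion)
    also have "... = (\<integral>\<^sup>+ h. ennreal (1 / u 0 h) * indicator {0..<1} h \<partial>lborel)"
    proof (rule nn_integral_cong_AE)
      show "AE h in lborel. (1 / ennreal (u0 h)) * indicator {0..1} h = ennreal (1 / u 0 h) * indicator {0..<1} h"
        using ae0 AE_lborel_singleton[of 1]
      proof eventually_elim
        case (elim h)
        have "1 / ennreal (u 0 h) = ennreal (1 / u 0 h)"
          using divide_ennreal[of 1 "u 0 h"] upos[of 0 h] by simp
        then show ?case using elim by (auto simp: indicator_def)
      qed
    qed
    also have "... = (\<integral>\<^sup>+ h. ennreal (1 / u 0 h) \<partial>circle)" by (rule nn_integral_circle[symmetric]) measurable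
    also have "... = ennreal ?I"
      by (rule nn_integral_eq_integral[OF iinv]) (use upos[of 0] in \<open>auto simp: less_imp_le\<close>)
    finally have eq: "ennreal L = ennreal ?I" .
    obtain c C where cC: "0 < c" "\<And>t h. c \<le> strong.y 1 u t h" "\<And>t h. strong.y 1 u t h \<le> C"
      using strong.y_bounds[OF st[OF zero_less_one]] by blast
    have uC: "u 0 h \<le> C" for h
      using cC(3)[of 0 h] strong.y_eq[OF st[OF zero_less_one], of 0 h] by simp
    have C: "C > 0" using uC[of 0] upos[of 0 0] by linarith
    have "1 / C = (LINT h|circle. 1 / C)" by simp
    also have "... \<le> ?I"
      by (rule integral_mono[OF _ iinv]) (use uC upos[of 0] in \<open>auto intro!: divide_left_mono mult_pos_pos C\<close>)
    finally have I: "?I > 0" using C by (meson less_le_trans zero_less_divide_1_iff)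
    \<comment> \<open>\<open>ennreal\<close> maps negative numbers to 0, so a negative L must be
      excluded through ?I > 0.\<close>
    have "L = ?I"
    proof (cases "L \<ge> 0")
      case True then show ?thesis using eq I by simp
    next
      case False
      then have "ennreal L = 0" by (simp add: ennreal_neg)
      then show ?thesis using eq I by simp
    qed
    then show "?I = L" "L > 0" using I by auto
  qed
  have key: "\<exists>c C W. evolution t c C (strong.y t u) W" if "t > 0" for t
    using strong.evolution[OF st[OF that]] by blast
  have yeq: "strong.y t u s = u s" if "t > 0" "s \<in> {0..t}" for s t
    using strong.y_eq[OF st[OF that(1)] that(2)] by (intro ext)
  have mass: "(LINT h|circle. 1 / u t h) = L" if "t \<ge> 0" for t
  proof (cases "t = 0")
    case False
    then have t: "t > 0" using that by simp
    obtain c C W where "evolution t c C (strong.y t u) W" using key[OF t] by blast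
    from evolution.mass_conserved[OF this, of 0 t] show ?thesis using t L yeq[OF t, of 0] yeq[OF t, of t] by simp
  qed (use L in simp)
  have chain: "\<exists>v1 v2. periodic_chain (\<lambda>h. cub (u t h)) v1 v2" if "t \<ge> 0" for t
    using strong.y_chain[OF st1 tin[OF that]] strong.y_eq[OF st1 tin[OF that]] by simp
  have E0: "energy (u t) \<ge> 0" if t0: "t \<ge> 0" for t
  proof -
    obtain v1 v2 where ch: "periodic_chain (\<lambda>h. cub (u t h)) v1 v2" using chain[OF t0] by blast
    show ?thesis unfolding energy_chain[OF ch] by (rule periodic_chain.E_nonneg[OF ch])
  qed
  have decay: "energy (u t) * (1 + 2 * m\<^sup>2 * (t - s)) \<le> energy (u s)"
    if st: "0 \<le> s" "s \<le> t" and m: "m \<ge> 0" "\<And>r h. r \<in> {s..t} \<Longrightarrow> m \<le> u r h" for s t m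
  \<comment> \<open>The evolution is taken on [0, t], which needs t > 0; for t = 0 also s = 0 and
    the claim is trivial.\<close>
  proof (cases "t = 0")
    case False
    then have t: "t > 0" using st by simp
    obtain c C W where ev: "evolution t c C (strong.y t u) W" using key[OF t] by blast
    obtain a1 a2 where a: "periodic_chain (\<lambda>h. cub (u t h)) a1 a2" using chain t by (meson less_imp_le)
    obtain b1 b2 where b: "periodic_chain (\<lambda>h. cub (u s h)) b1 b2" using chain st by blast
    have v: "evolution.v (strong.y t u) r = (\<lambda>h. cub (u r h))" if "r \<in> {0..t}" for r
      using evolution.v_def[OF ev] yeq[OF t that] by (intro ext) simp
    have "(LINT h|circle. (a2 h)\<^sup>2) * (1 + 2 * m\<^sup>2 * (t - s)) \<le> (LINT h|circle. (b2 h)\<^sup>2)"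
    proof (rule evolution.energy_decay[OF ev st order_refl _ _ m(1)])
      show "periodic_chain (evolution.v (strong.y t u) t) a1 a2" using a v[of t] t by simp
      show "periodic_chain (evolution.v (strong.y t u) s) b1 b2" using b v[of s] st by simp
      show "m \<le> strong.y t u r h" if "r \<in> {s..t}" for r h using m(2)[OF that, of h] yeq[OF t, of r] that st by simp
    qed
    then show ?thesis by (simp only: energy_chain[OF a] energy_chain[OF b])
  qed (use that in simp)
  have anti: "energy (u t) \<le> energy (u s)" if "0 \<le> s" "s \<le> t" for s t
    using decay[OF that, of 0] upos that by (simp add: less_imp_le)
  \<comment> \<open>The added 1 keeps K positive when the initial energy is zero.\<close>
  define K where "K = energy (u 0) + 1"
  have K: "K > 0" using E0[of 0] by (simp add: K_def)
  define m where "m = min (1 / (4 * L)) (1 / (64 * L ^ 3 * K))"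
  have m: "m > 0" using L K by (simp add: m_def)
  have lower: "m \<le> u t h" if t0: "t \<ge> 0" for t h
  proof -
    obtain v1 v2 where ch: "periodic_chain (\<lambda>h. cub (u t h)) v1 v2" using chain[OF t0] by blast
    have "(LINT x|circle. (v2 x)\<^sup>2) \<le> K" using anti[of 0 t] t0 unfolding energy_chain[OF ch] by (simp add: K_def)
    then show ?thesis unfolding m_def
      by (intro lower_bound[OF up[OF t0] uc[OF t0] upos[OF t0] mass[OF t0] L(2) ch _ K])
  qed
  \<comment> \<open>Gain over one unit of time, from \<open>decay\<close> with t - s = 1.\<close>
  define k where "k = 1 + 2 * m\<^sup>2"
  have k: "k > 1" using m by (simp add: k_def)
  have steps: "energy (u (real n)) * k ^ n \<le> energy (u 0)" for n
  proof (induction n)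
    case (Suc n)
    have "energy (u (real (Suc n))) * k \<le> energy (u (real n))"
      using decay[of "real n" "real (Suc n)" m] m lower by (simp add: k_def)
    then have "energy (u (real (Suc n))) * k * k ^ n \<le> energy (u (real n)) * k ^ n"
      using k by (intro mult_right_mono) auto
    then show ?case using Suc by (simp add: mult.assoc)
  qed simp
  \<comment> \<open>Half of the rate ln k: the energy is controlled at integer times, and for t >= 2
    the integer part of t is at least t/2, so k^n = exp (2 b n) dominates exp (b t).\<close>
  define b where "b = ln k / 2"
  have b: "b > 0" using k by (simp add: b_def)
  have kexp: "k ^ n = exp (2 * b * real n)" for n
    using k exp_of_nat_mult[of n "ln k"] by (simp add: b_def mult.commute)
  have bound: "energy (u t) \<le> energy (u 0) * exp (- b * t)" if t: "t \<ge> 2" for t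
  proof -
    define n where "n = nat \<lfloor>t\<rfloor>"
    have n: "real n \<le> t" "t \<le> 2 * real n" using t by (simp_all add: n_def) linarith
    have "energy (u t) \<le> energy (u (real n))" by (rule anti) (use n in auto)
    also have "... \<le> energy (u 0) * exp (- (2 * b * real n))"
      using steps[of n] by (simp add: kexp exp_minus field_simps)
    also have "... \<le> energy (u 0) * exp (- b * t)"
      using n b E0[of 0] by (intro mult_left_mono) (simp_all add: mult.assoc)
    finally show ?thesis .
  qed
  have ev: "\<forall>\<^sub>F t in at_top. energy (u t) \<le> energy (u 0) * exp (- b * t)"
    using eventually_ge_at_top[of 2] by eventually_elim (rule bound)
  have close: "\<bar>u t h - 1 / L\<bar> \<le> sqrt (energy (u t))" if t0: "t \<ge> 0" for t h
  proof -
    obtain v1 v2 where ch: "periodic_chain (\<lambda>h. cub (u t h)) v1 v2" using chain[OF t0] by blast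
    show ?thesis unfolding energy_chain[OF ch]
      by (rule sup_bound[OF up[OF t0] uc[OF t0] upos[OF t0] mass[OF t0] ch])
  qed
  have "filterlim (\<lambda>t. - b * t) at_bot at_top"
    by (rule filterlim_tendsto_neg_mult_at_bot[OF tendsto_const _ filterlim_ident]) (use b in simp)
  from filterlim_compose[OF exp_at_bot this]
  have "((\<lambda>t. energy (u 0) * exp (- b * t)) \<longlongrightarrow> energy (u 0) * 0) at_top"
    by (intro tendsto_mult tendsto_const)
  then have lim0: "((\<lambda>t. energy (u 0) * exp (- b * t)) \<longlongrightarrow> 0) at_top" by simp
  have "((\<lambda>t. energy (u t)) \<longlongrightarrow> 0) at_top"
  proof (rule tendsto_sandwich[OF _ ev tendsto_const lim0])
    show "\<forall>\<^sub>F t in at_top. 0 \<le> energy (u t)"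
      using eventually_ge_at_top[of 0] by eventually_elim (rule E0)
  qed
  from tendsto_real_sqrt[OF this]
  have sq: "((\<lambda>t. ereal (sqrt (energy (u t)))) \<longlongrightarrow> 0) at_top"
    by (simp add: zero_ereal_def)
  have "((\<lambda>t. esssup (lebesgue_on {0..1}) (\<lambda>h. ereal \<bar>u t h - 1 / L\<bar>)) \<longlongrightarrow> 0) at_top"
  proof (rule tendsto_sandwich[OF _ _ tendsto_const sq])
    have meas: "(\<lambda>h. ereal \<bar>u t h - 1 / L\<bar>) \<in> borel_measurable (lebesgue_on {0..1})" if "t \<ge> 0" for t
    proof -
      have "u t \<in> borel_measurable lebesgue"
        by (rule measurable_completion) (use borel_measurable_continuous_onI[OF uc[OF that]] in simp)
      then have "u t \<in> borel_measurable (lebesgue_on {0..1})" by (rule measurable_restrict_space1)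
      then show ?thesis by measurable
    qed
    have e1: "emeasure (lebesgue_on {0..1::real}) (space (lebesgue_on {0..1})) \<noteq> 0"
      by (simp add: emeasure_restrict_space)
    show "\<forall>\<^sub>F t in at_top. 0 \<le> esssup (lebesgue_on {0..1}) (\<lambda>h. ereal \<bar>u t h - 1 / L\<bar>)"
    \<comment> \<open>The lower bound holds for every t, also for negative times, at which nothing
      is known about u.\<close>
    proof (intro always_eventually allI)
      fix t
      have "esssup (lebesgue_on {0..1}) (\<lambda>h::real. 0 :: ereal) \<le> esssup (lebesgue_on {0..1}) (\<lambda>h. ereal \<bar>u t h - 1 / L\<bar>)"
        by (rule esssup_mono) auto
      then show "0 \<le> esssup (lebesgue_on {0..1}) (\<lambda>h. ereal \<bar>u t h - 1 / L\<bar>)" by (simp add: esssup_const[OF e1])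
    qed
    show "\<forall>\<^sub>F t in at_top. esssup (lebesgue_on {0..1}) (\<lambda>h. ereal \<bar>u t h - 1 / L\<bar>) \<le> ereal (sqrt (energy (u t)))"
      using eventually_ge_at_top[of 0]
      by eventually_elim (intro esssup_I meas AE_I2; simp add: close)
  qed
  then show ?thesis using ev b by blast
qed

end
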